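(* Let $d\ge2$, $\alpha\in\mathbb R$, $\varepsilon>0$ and $m\in\mathbb N=\{1,2,\dots\}$. For any $T>0$ there is a constant $C=C(T,d,m,\varepsilon)$ such that for every $\lambda\ge1$, $$\|\mathscr I^\lambda(f)\|_{L^\infty([0,T];\mathbf C^{\alpha,**}_{m,\varepsilon})}\le C\,\|f\|_{L^\infty([0,T];\mathbf C^{\alpha-2,**}_{m,\varepsilon})}$$ for all $f\in L^\infty([0,T];\mathbf C^{\alpha-2,**}_{m,\varepsilon})$, and $$\|\mathscr I^\lambda(f)\|_{L^\infty([0,T];\mathbf C^{\alpha,**}_{m,\varepsilon})}\le \frac{C}{\ell_{m+2}(J_\lambda)}\,\|f\|_{L^\infty([0,T];\mathbf C^{\alpha-2,*}_{m,\varepsilon})}$$ for all $f\in L^\infty([0,T];\mathbf C^{\alpha-2,*}_{m,\varepsilon})$.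
   Context: Iterated logarithms: for $r\ge0$, $\ell_0(r)=1+r$, $\ell_1(r)=\log(e+r)$, $\ell_{k+1}(r)=\log(e+\ell_k(r))$ for $k\ge1$; $\ell_k^{a}(r):=(\ell_k(r))^a$. For $\lambda\ge1$, $J_\lambda=2+\lfloor\frac12\log_2(e+\lambda)\rfloor$. Resolvent: $\mathscr I^\lambda_t(f)=\int_0^te^{-\lambda(t-s)}P_{t-s}f_s\,\mathrm ds$, $t\in[0,T]$, with $P_tf=\varphi_t*f$, $\varphi_t(x)=(4\pi t)^{-d/2}e^{-|x|^2/(4t)}$. Littlewood–Paley blocks: let $\chi_0$ be a symmetric $C^\infty$ function on $\mathbb R^d$ with $\chi_0=1$ on $B_1$ and $\chi_0=0$ outside $B_{4/3}$; $\chi_j(\xi)=\chi_0(2^{-j}\xi)-\chi_0(2^{-(j-1)}\xi)$ for $j\ge1$; $\mathcal R_jf$ is the inverse Fourier transform of $\chi_j\hat f$, for $f\in\mathscr S'(\mathbb R^d)$, $j\ge0$. Spaces: for $\theta\in\{0,1\}$ put $w_{m,\varepsilon,\theta}(j)=\big(\prod_{i=0}^m\ell_i(j)\big)\,\ell_{m+1}^{1+\varepsilon}(j)\,\ell_{m+2}^{\theta}(j)$, $j\ge0$. For $\alpha\in\mathbb R$, $\mathbf C^{\alpha}_{m,\varepsilon,\theta}$ is the set of $f\in\mathscr S'(\mathbb R^d)$ with $\|f\|_{\mathbf C^{\alpha}_{m,\varepsilon,\theta}}=\sup_{j\ge0}w_{m,\varepsilon,\theta}(j)2^{j\alpha}\|\mathcal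 R_jf\|_\infty<\infty$. Write $\mathbf C^{\alpha,*}_{m,\varepsilon}=\mathbf C^{\alpha}_{m,\varepsilon,1}$ and $\mathbf C^{\alpha,**}_{m,\varepsilon}=\mathbf C^{\alpha}_{m,\varepsilon,0}$. *)

theory Defs
  imports "HOL-Analysis.Analysis" "HOL-Probability.Essential_Supremum"
begin

section \<open>Iterated logarithms\<close>

fun ell :: "nat \<Rightarrow> real \<Rightarrow> real" where
  "ell 0 r = 1 + r"
| "ell (Suc 0) r = ln (exp 1 + r)"
| "ell (Suc (Suc k)) r = ln (exp 1 + ell (Suc k) r)"

definition J_idx :: "real \<Rightarrow> int" where
  "J_idx lam = 2 + \<lfloor>1 / 2 * log 2 (exp 1 + lam)\<rfloor>"

definition weight :: "nat \<Rightarrow> real \<Rightarrow> nat \<Rightarrow> nat \<Rightarrow> real" where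
  "weight m \<epsilon> \<theta> j =
     (\<Prod>i=0..m. ell i (real j)) * (ell (m + 1) (real j) powr (1 + \<epsilon>)) * (ell (m + 2) (real j)) ^ \<theta>"

section \<open>Schwartz functions and tempered distributions\<close>

fun partials :: "'n list \<Rightarrow> (real ^ 'n \<Rightarrow> 'b) \<Rightarrow> real ^ 'n \<Rightarrow> 'b::real_normed_vector" where
  "partials [] f = f"
| "partials (i # is) f = (\<lambda>x. frechet_derivative (partials is f) (at x) (axis i 1))"

definition smooth :: "(real ^ 'n \<Rightarrow> 'b::real_normed_vector) \<Rightarrow> bool" where
  "smooth f \<longleftrightarrow> (\<forall>is x. partials is f differentiable (at x))"

definition schwartz :: "(real ^ 'n \<Rightarrow> complex) set" where
  "schwartz = {\<phi>. smooth \<phi> \<and>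
     (\<forall>k is. bounded (range (\<lambda>x. (1 + norm x) ^ k *\<^sub>R partials is \<phi> x)))}"

definition schwartz_seminorm :: "nat \<Rightarrow> (real ^ 'n \<Rightarrow> complex) \<Rightarrow> real" where
  "schwartz_seminorm N \<phi> =
     (SUP (is, x) \<in> {is. length is \<le> N} \<times> UNIV. (1 + norm x) ^ N * norm (partials is \<phi> x))"

text \<open>
  A distribution is a functional of which only the values on \<^const>\<open>schwartz\<close> matter: nothing is
  assumed about, and nothing below depends on, its values on other functions.
\<close>

type_synonym 'n distr = "(real ^ 'n \<Rightarrow> complex) \<Rightarrow> complex"

text \<open>
  The seminorms above increase with \<open>N\<close> and generate the topology of the Schwartz space, so a
  linear functional is continuous iff it is bounded by a multiple of one of them.
\<close>

definition tempered :: "'n::finite distr \<Rightarrow> bool" where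
  "tempered u \<longleftrightarrow>
     (\<forall>\<phi>\<in>schwartz. \<forall>\<psi>\<in>schwartz. u (\<lambda>x. \<phi> x + \<psi> x) = u \<phi> + u \<psi>) \<and>
     (\<forall>c. \<forall>\<phi>\<in>schwartz. u (\<lambda>x. c * \<phi> x) = c * u \<phi>) \<and>
     (\<exists>N K. \<forall>\<phi>\<in>schwartz. norm (u \<phi>) \<le> K * schwartz_seminorm N \<phi>)"

definition fourier :: "(real ^ 'n \<Rightarrow> complex) \<Rightarrow> real ^ 'n \<Rightarrow> complex" where
  "fourier \<phi> \<xi> = (LINT x|lborel. cis (- (x \<bullet> \<xi>)) * \<phi> x)"

definition inv_fourier :: "(real ^ 'n \<Rightarrow> complex) \<Rightarrow> real ^ 'n \<Rightarrow> complex" where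
  "inv_fourier \<phi> x = of_real (1 / (2 * pi) ^ CARD('n)) * (LINT \<xi>|lborel. cis (x \<bullet> \<xi>) * \<phi> \<xi>)"

text \<open>Operations on tempered distributions, by transposition.\<close>

definition fourier_distr :: "'n::finite distr \<Rightarrow> 'n distr" where
  "fourier_distr u = (\<lambda>\<phi>. u (fourier \<phi>))"

definition inv_fourier_distr :: "'n::finite distr \<Rightarrow> 'n distr" where
  "inv_fourier_distr u = (\<lambda>\<phi>. u (inv_fourier \<phi>))"

definition mult_distr :: "(real ^ 'n \<Rightarrow> real) \<Rightarrow> 'n::finite distr \<Rightarrow> 'n distr" where
  "mult_distr a u = (\<lambda>\<phi>. u (\<lambda>x. of_real (a x) * \<phi> x))"

definition conv_distr :: "(real ^ 'n \<Rightarrow> real) \<Rightarrow> 'n::finite distr \<Rightarrow> 'n distr" where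
  "conv_distr k u = (\<lambda>\<phi>. u (\<lambda>x. LINT y|lborel. of_real (k (y - x)) * \<phi> y))"

definition represents :: "(real ^ 'n \<Rightarrow> complex) \<Rightarrow> 'n::finite distr \<Rightarrow> bool" where
  "represents g u \<longleftrightarrow> g \<in> borel_measurable lborel \<and>
     (\<forall>\<phi>\<in>schwartz. integrable lborel (\<lambda>x. g x * \<phi> x) \<and> u \<phi> = (LINT x|lborel. g x * \<phi> x))"

text \<open>
  The \<open>L\<^sup>\<infinity>(\<real>\<^sup>d)\<close> norm of a distribution: the essential supremum of the function
  representing it (unique up to null sets), and \<open>\<infinity>\<close> if there is no such function.
\<close>

definition sup_norm_distr :: "'n::finite distr \<Rightarrow> ennreal" where
  "sup_norm_distr u = (INF g\<in>{g. represents g u}. esssup lborel (\<lambda>x. ennreal (norm (g x))))"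

section \<open>Littlewood--Paley blocks and the spaces\<close>

definition lp_cutoff :: "(real ^ 'n \<Rightarrow> real) \<Rightarrow> bool" where
  "lp_cutoff \<chi>\<^sub>0 \<longleftrightarrow> smooth \<chi>\<^sub>0 \<and> (\<forall>\<xi>. \<chi>\<^sub>0 (- \<xi>) = \<chi>\<^sub>0 \<xi>) \<and>
     (\<forall>\<xi>\<in>ball 0 1. \<chi>\<^sub>0 \<xi> = 1) \<and> (\<forall>\<xi>. \<xi> \<notin> ball 0 (4 / 3) \<longrightarrow> \<chi>\<^sub>0 \<xi> = 0)"

fun lp_chi :: "(real ^ 'n \<Rightarrow> real) \<Rightarrow> nat \<Rightarrow> real ^ 'n \<Rightarrow> real" where
  "lp_chi \<chi>\<^sub>0 0 \<xi> = \<chi>\<^sub>0 \<xi>"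
| "lp_chi \<chi>\<^sub>0 (Suc j) \<xi> = \<chi>\<^sub>0 ((1 / 2 ^ Suc j) *\<^sub>R \<xi>) - \<chi>\<^sub>0 ((1 / 2 ^ j) *\<^sub>R \<xi>)"

definition lp_block :: "(real ^ 'n \<Rightarrow> real) \<Rightarrow> nat \<Rightarrow> 'n::finite distr \<Rightarrow> 'n distr" where
  "lp_block \<chi>\<^sub>0 j f = inv_fourier_distr (mult_distr (lp_chi \<chi>\<^sub>0 j) (fourier_distr f))"

definition C_norm ::
    "(real ^ 'n \<Rightarrow> real) \<Rightarrow> nat \<Rightarrow> real \<Rightarrow> nat \<Rightarrow> real \<Rightarrow> 'n::finite distr \<Rightarrow> ennreal" where
  "C_norm \<chi>\<^sub>0 m \<epsilon> \<theta> \<alpha> f =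
     (SUP j. ennreal (weight m \<epsilon> \<theta> j * 2 powr (real j * \<alpha>)) * sup_norm_distr (lp_block \<chi>\<^sub>0 j f))"

definition C_space ::
    "(real ^ 'n \<Rightarrow> real) \<Rightarrow> nat \<Rightarrow> real \<Rightarrow> nat \<Rightarrow> real \<Rightarrow> 'n::finite distr set" where
  "C_space \<chi>\<^sub>0 m \<epsilon> \<theta> \<alpha> = {f. tempered f \<and> C_norm \<chi>\<^sub>0 m \<epsilon> \<theta> \<alpha> f < \<infinity>}"

text \<open>
  \<open>L\<^sup>\<infinity>([0,T]; \<^bold>C)\<close>. Since the spaces are not separable, measurability in time is understood in the
  weak sense, against each Schwartz function. The essential supremum is written out because the
  library constant \<^const>\<open>esssup\<close> is \<open>\<infinity>\<close> unless the norm is already known to be measurable in time.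
\<close>

definition LinfC_norm ::
    "(real ^ 'n \<Rightarrow> real) \<Rightarrow> nat \<Rightarrow> real \<Rightarrow> nat \<Rightarrow> real \<Rightarrow> real \<Rightarrow> (real \<Rightarrow> 'n::finite distr) \<Rightarrow> ennreal" where
  "LinfC_norm \<chi>\<^sub>0 m \<epsilon> \<theta> \<alpha> T f =
     Inf {c. AE t in lebesgue_on {0..T}. C_norm \<chi>\<^sub>0 m \<epsilon> \<theta> \<alpha> (f t) \<le> c}"

definition LinfC ::
    "(real ^ 'n \<Rightarrow> real) \<Rightarrow> nat \<Rightarrow> real \<Rightarrow> nat \<Rightarrow> real \<Rightarrow> real \<Rightarrow> (real \<Rightarrow> 'n::finite distr) set" where
  "LinfC \<chi>\<^sub>0 m \<epsilon> \<theta> \<alpha> T = {f.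
     (\<forall>t\<in>{0..T}. f t \<in> C_space \<chi>\<^sub>0 m \<epsilon> \<theta> \<alpha>) \<and>
     (\<forall>\<phi>\<in>schwartz. (\<lambda>t. f t \<phi>) \<in> borel_measurable (lebesgue_on {0..T})) \<and>
     LinfC_norm \<chi>\<^sub>0 m \<epsilon> \<theta> \<alpha> T f < \<infinity>}"

text \<open>The double-star spaces are \<open>\<theta> = 0\<close>, the single-star spaces are \<open>\<theta> = 1\<close>.\<close>

abbreviation "LinfC_ss_norm \<chi>\<^sub>0 m \<epsilon> \<equiv> LinfC_norm \<chi>\<^sub>0 m \<epsilon> 0"
abbreviation "LinfC_ss \<chi>\<^sub>0 m \<epsilon> \<equiv> LinfC \<chi>\<^sub>0 m \<epsilon> 0"
abbreviation "LinfC_s_norm \<chi>\<^sub>0 m \<epsilon> \<equiv> LinfC_norm \<chi>\<^sub>0 m \<epsilon> 1"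
abbreviation "LinfC_s \<chi>\<^sub>0 m \<epsilon> \<equiv> LinfC \<chi>\<^sub>0 m \<epsilon> 1"

section \<open>Heat semigroup and resolvent\<close>

text \<open>At \<open>t = 0\<close> this is \<open>0\<close>, a value used below only for a null set of times.\<close>

definition heat_kernel :: "real \<Rightarrow> real ^ 'n \<Rightarrow> real" where
  "heat_kernel t x = (4 * pi * t) powr (- (real CARD('n) / 2)) * exp (- ((norm x)\<^sup>2 / (4 * t)))"

definition heat :: "real \<Rightarrow> 'n::finite distr \<Rightarrow> 'n distr" where
  "heat t f = conv_distr (heat_kernel t) f"

text \<open>The integral in time is that of a distribution-valued function, tested against \<open>\<phi>\<close>.\<close>

definition resolvent :: "real \<Rightarrow> (real \<Rightarrow> 'n::finite distr) \<Rightarrow> real \<Rightarrow> 'n distr" where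
  "resolvent lam f t =
     (\<lambda>\<phi>. LINT s:{0..t}|lebesgue. of_real (exp (- lam * (t - s))) * heat (t - s) (f s) \<phi>)"

end

theory Submission
  imports Defs "HOL-Probability.Characteristic_Functions" "HOL-Probability.Sinc_Integral"
begin

text \<open>
  Write \<open>R\<^sub>j\<close> for the blocks and \<open>P\<^sub>r\<close> for the heat semigroup, both acting on test functions. If \<open>\<eta>\<^sub>j\<close> is a
  slightly larger annular cutoff, equal to \<open>1\<close> on the support of \<open>\<chi>\<^sub>j\<close>, then \<open>P\<^sub>r R\<^sub>j = R\<^sub>j (\<eta>\<^sub>j P\<^sub>r)\<close>.
  Since \<open>\<eta>(2\<^sup>-\<^sup>j\<xi>) exp(-r|\<xi>|\<^sup>2)\<close> equals \<open>(4\<^sup>j r)\<^sup>-\<^sup>2\<close> times the product of \<open>(\<eta>/|\<cdot>|\<^sup>4)(2\<^sup>-\<^sup>j\<xi>)\<close> and the dilated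
  symbol \<open>|\<xi>|\<^sup>4 exp(-|\<xi>|\<^sup>2)\<close>, whose kernels have scale-invariant \<open>L\<^sup>1\<close> norms, \<open>\<eta>\<^sub>j P\<^sub>r\<close> has \<open>L\<^sup>1\<close> norm
  at most a constant times \<open>min 1 ((4\<^sup>j r)\<^sup>-\<^sup>2)\<close>. Integrating against \<open>exp(-\<lambda>r)\<close> yields the gain
  \<open>min (1/\<lambda>) (4\<^sup>-\<^sup>j)\<close> in the \<open>j\<close>-th block. This is the first bound; the second one follows because \<open>\<ell>\<^sub>k\<close> is
  1-Lipschitz and at least \<open>1\<close>, so that \<open>\<ell>\<^sub>k(J\<^sub>\<lambda>) min (4\<^sup>j/\<lambda>) 1 \<le> 64 \<ell>\<^sub>k(j)\<close>.

  A block of the resolvent is a functional on test functions that is bounded in \<open>L\<^sup>1\<close> and invariant under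
  \<open>\<eta>\<^sub>j\<close>; evaluating it on the translates of the kernel of \<open>\<eta>\<^sub>j\<close> gives the bounded function representing it.
\<close>

subsection \<open>Partial derivatives and the Schwartz class\<close>

text \<open>The power 2 in the decay \<open>(4^j r)^-2\<close> is what makes it integrable in r at
  infinity; the first power would leave a divergent logarithm. Both exp(-lambda r) and the decay are
  then dominated by a dilated Cauchy profile 1/(1 + (c r)^2), with c = lambda or c = 4^j, so a
  single integral over the whole line yields both halves of the minimum, with a constant free of T.
  Block 0 has no such decay; there lambda >= 1 makes 1/lambda the smaller bound. Two obstacles come
  from the distributional setting. \<open>f s\<close> is measurable in s only against a fixed test
  function, while the resolvent tests it with the heat evolution of phi for time t - s; joint
  measurability rests on continuity in the dilation parameter, the value 0 included. And each
  \<open>f s\<close> is tempered with an order and a constant of its own; a bound uniform in s has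
  to be rebuilt from the block norms, where the smoothness of phi pays for their possible growth in
  j.\<close>

definition pd :: "'n::finite \<Rightarrow> (real ^ 'n \<Rightarrow> 'b::real_normed_vector) \<Rightarrow> real ^ 'n \<Rightarrow> 'b" where
  "pd i f x = frechet_derivative f (at x) (axis i 1)"

lemma partials_Cons: "partials (i # is) f = pd i (partials is f)"
  by (simp add: pd_def fun_eq_iff)

lemma partials_append: "partials (is @ js) f = partials is (partials js f)"
  by (induction "is") (simp_all add: partials_Cons del: partials.simps(2))

lemma pd_eqI: "(f has_derivative D) (at x) \<Longrightarrow> pd i f x = D (axis i 1)"
  unfolding pd_def by (metis frechet_derivative_at)

lemma vec_axis_sum: "(v::real^'n) = (\<Sum>i\<in>UNIV. v $ i *\<^sub>R axis i 1)"
  by (simp add: vec_eq_iff axis_def if_distrib sum.delta cong: if_cong)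

text \<open>With the derivative written through the partials, every differentiation rule below has
  one pattern: exhibit a derivative of this form, then evaluate it on a basis vector with
  \<open>axis_sum\<close>.\<close>

lemma has_derivative_pd:
  fixes f :: "real ^ 'n \<Rightarrow> 'b::real_normed_vector"
  assumes "f differentiable (at x)"
  shows "(f has_derivative (\<lambda>v. \<Sum>i\<in>UNIV. v $ i *\<^sub>R pd i f x)) (at x)"
proof -
  let ?D = "frechet_derivative f (at x)"
  have D: "(f has_derivative ?D) (at x)"
    using assms frechet_derivative_works by blast
  then have l: "linear ?D" by (rule has_derivative_linear)
  have "?D v = (\<Sum>i\<in>UNIV. v $ i *\<^sub>R pd i f x)" for v
  proof -
    have "?D v = ?D (\<Sum>i\<in>UNIV. v $ i *\<^sub>R axis i 1)" using vec_axis_sum[of v] by simp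
    also have "\<dots> = (\<Sum>i\<in>UNIV. v $ i *\<^sub>R pd i f x)"
      by (simp add: linear_sum[OF l] linear_cmul[OF l] pd_def)
    finally show ?thesis .
  qed
  then have "?D = (\<lambda>v. \<Sum>i\<in>UNIV. v $ i *\<^sub>R pd i f x)" by auto
  then show ?thesis using D by simp
qed

text \<open>
  The coinductive reading of smoothness (\<open>Q\<close> trivial) and of the Schwartz class (\<open>Q\<close> rapid decay): the
  largest class of differentiable functions with property \<open>Q\<close> that is closed under partial derivatives.
\<close>

definition dclass :: "((real ^ 'n::finite \<Rightarrow> 'b::real_normed_vector) \<Rightarrow> bool) \<Rightarrow> (real ^ 'n \<Rightarrow> 'b) set" where
  "dclass Q = {f. \<forall>is. (\<forall>x. partials is f differentiable (at x)) \<and> Q (partials is f)}"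

text \<open>All iterated partials stay inside the invariant set \<open>A\<close>. Choosing
  \<open>A\<close> well replaces Leibniz or chain rule formulas for derivatives of arbitrary
  order.\<close>

lemma dclass_coinduct:
  assumes "f \<in> A" "\<And>g x. g \<in> A \<Longrightarrow> g differentiable (at x)"
    "\<And>g i. g \<in> A \<Longrightarrow> pd i g \<in> A" "\<And>g. g \<in> A \<Longrightarrow> Q g"
  shows "f \<in> dclass Q"
proof -
  have "partials is f \<in> A" for "is"
    by (induction "is") (use assms in \<open>simp_all add: partials_Cons del: partials.simps(2)\<close>)
  then show ?thesis using assms by (auto simp: dclass_def)
qed

lemma dclass_pd: assumes "f \<in> dclass Q" shows "pd i f \<in> dclass Q"
proof -
  have "partials is (pd i f) = partials (is @ [i]) f" for "is"
    by (simp only: partials_append partials_Cons partials.simps(1))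
  then show ?thesis using assms unfolding dclass_def by auto
qed

lemma dclass_differentiable: assumes "f \<in> dclass Q" shows "f differentiable (at x)"
proof -
  have "partials [] f differentiable (at x)" using assms unfolding dclass_def by blast
  then show ?thesis by simp
qed

lemma dclass_prop: assumes "f \<in> dclass Q" shows "Q f"
proof -
  have "Q (partials [] f)" using assms unfolding dclass_def by blast
  then show ?thesis by simp
qed

lemma dclass_partials: "f \<in> dclass Q \<Longrightarrow> partials is f \<in> dclass Q"
  by (induction "is") (simp_all add: partials_Cons dclass_pd del: partials.simps(2))

lemma dclass_has_derivative:
  "f \<in> dclass Q \<Longrightarrow> (f has_derivative (\<lambda>v. \<Sum>i\<in>UNIV. v $ i *\<^sub>R pd i f x)) (at x)"
  by (intro has_derivative_pd dclass_differentiable)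

lemma dclass_continuous_on: "f \<in> dclass Q \<Longrightarrow> continuous_on A f"
  by (meson dclass_differentiable continuous_at_imp_continuous_on differentiable_imp_continuous_within)

lemma axis_sum [simp]: 
  fixes h :: "'n::finite \<Rightarrow> 'b::real_vector"
  shows "(\<Sum>k\<in>UNIV. (axis i (1::real) :: real^'n) $ k *\<^sub>R h k) = h i"
proof -
  have "(axis i (1::real) :: real^'n) $ k *\<^sub>R h k = (if k = i then h k else 0)" for k by (simp add: axis_def)
  then show ?thesis by simp
qed

lemma pd_zero: "pd i (\<lambda>x. 0) = (\<lambda>x. 0)"
  by (rule ext, rule pd_eqI) (rule has_derivative_const)

lemma dclass_zero: "Q (\<lambda>x. 0) \<Longrightarrow> (\<lambda>x. 0) \<in> dclass Q"
  by (rule dclass_coinduct[where A = "{\<lambda>x. 0}"]) (auto simp: pd_zero)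

lemma dclass_add:
  assumes "f \<in> dclass Q" "g \<in> dclass Q" "\<And>u v. Q u \<Longrightarrow> Q v \<Longrightarrow> Q (\<lambda>x. u x + v x)"
  shows "(\<lambda>x. f x + g x) \<in> dclass Q"
proof (rule dclass_coinduct)
  let ?A = "{\<lambda>x. u x + v x | u v. u \<in> dclass Q \<and> v \<in> dclass Q}"
  show "(\<lambda>x. f x + g x) \<in> ?A" using assms by blast
  fix h assume "h \<in> ?A"
  then obtain u v where h: "h = (\<lambda>x. u x + v x)" "u \<in> dclass Q" "v \<in> dclass Q" by blast
  have D: "(h has_derivative (\<lambda>w. (\<Sum>i\<in>UNIV. w $ i *\<^sub>R pd i u x) + (\<Sum>i\<in>UNIV. w $ i *\<^sub>R pd i v x))) (at x)" for x
    unfolding h(1) by (intro has_derivative_add dclass_has_derivative[OF h(2)] dclass_has_derivative[OF h(3)])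
  show "h differentiable (at x)" for x using D differentiableI by blast
  have "pd i h = (\<lambda>x. pd i u x + pd i v x)" for i
    by (rule ext, subst pd_eqI[OF D]) simp
  then show "pd i h \<in> ?A" for i using h dclass_pd by blast
  show "Q h" using h assms(3) dclass_prop by metis
qed

lemma pd_add: "f \<in> dclass Q \<Longrightarrow> g \<in> dclass R \<Longrightarrow> pd i (\<lambda>x. f x + g x) = (\<lambda>x. pd i f x + pd i g x)"
  by (rule ext, subst pd_eqI[OF has_derivative_add[OF dclass_has_derivative dclass_has_derivative]]) auto

lemma pd_cmult:
  fixes f :: "real^'n::finite \<Rightarrow> complex"
  shows "f \<in> dclass Q \<Longrightarrow> pd i (\<lambda>x. c * f x) = (\<lambda>x. c * pd i f x)"
  by (rule ext, subst pd_eqI[OF has_derivative_mult_right[OF dclass_has_derivative]]) auto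

lemma dclass_cmult:
  fixes f :: "real^'n::finite \<Rightarrow> complex"
  assumes "f \<in> dclass Q" "\<And>u. Q u \<Longrightarrow> Q (\<lambda>x. c * u x)"
  shows "(\<lambda>x. c * f x) \<in> dclass Q"
proof (rule dclass_coinduct)
  let ?A = "{\<lambda>x. c * u x | u. u \<in> dclass Q}"
  show "(\<lambda>x. c * f x) \<in> ?A" using assms by blast
  fix h assume "h \<in> ?A"
  then obtain u where h: "h = (\<lambda>x. c * u x)" "u \<in> dclass Q" by blast
  show "h differentiable (at x)" for x
    unfolding h(1) by (rule differentiableI[OF has_derivative_mult_right[OF dclass_has_derivative[OF h(2)]]])
  show "pd i h \<in> ?A" for i using h dclass_pd pd_cmult by blast
  show "Q h" using h assms(2) dclass_prop by metis
qed

lemma dclass_affine: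
  fixes f :: "real^'n::finite \<Rightarrow> complex"
  assumes "f \<in> dclass Q" "\<And>u a. Q u \<Longrightarrow> Q (\<lambda>x. a * u (c *\<^sub>R x + v))"
  shows "(\<lambda>x. f (c *\<^sub>R x + v)) \<in> dclass Q"
proof (rule dclass_coinduct)
  \<comment> \<open>The coefficient \<open>a\<close> absorbs the factor \<open>c\<close> that each
    application of the chain rule produces; this closes the set under \<open>pd\<close>.\<close>
  let ?A = "{\<lambda>x. a * u (c *\<^sub>R x + v) | u a. u \<in> dclass Q}"
  have "(\<lambda>x. f (c *\<^sub>R x + v)) = (\<lambda>x. 1 * f (c *\<^sub>R x + v))" by simp
  with assms(1) show "(\<lambda>x. f (c *\<^sub>R x + v)) \<in> ?A" by blast
  fix h assume "h \<in> ?A"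
  then obtain u a where h: "h = (\<lambda>x. a * u (c *\<^sub>R x + v))" "u \<in> dclass Q" by blast
  have D: "(h has_derivative (\<lambda>w. a * (\<Sum>i\<in>UNIV. (c *\<^sub>R w) $ i *\<^sub>R pd i u (c *\<^sub>R x + v)))) (at x)" for x
  proof -
    have "((\<lambda>x. c *\<^sub>R x + v) has_derivative (\<lambda>w. c *\<^sub>R w)) (at x)"
      by (auto intro!: derivative_eq_intros)
    then have "((\<lambda>x. u (c *\<^sub>R x + v)) has_derivative (\<lambda>w. \<Sum>i\<in>UNIV. (c *\<^sub>R w) $ i *\<^sub>R pd i u (c *\<^sub>R x + v))) (at x)"
      using has_derivative_compose[OF _ dclass_has_derivative[OF h(2)]] by fast
    then show ?thesis unfolding h(1) by (rule has_derivative_mult_right)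
  qed
  show "h differentiable (at x)" for x using D differentiableI by blast
  have "pd i h = (\<lambda>x. (a * of_real c) * pd i u (c *\<^sub>R x + v))" for i
  proof (rule ext, subst pd_eqI[OF D])
    fix x
    have "(\<Sum>k\<in>UNIV. (c *\<^sub>R axis i 1) $ k *\<^sub>R pd k u (c *\<^sub>R x + v)) = (c::real) *\<^sub>R pd i u (c *\<^sub>R x + v)"
      using axis_sum[of i "\<lambda>k. c *\<^sub>R pd k u (c *\<^sub>R x + v)"] by (simp add: mult.commute scaleR_right.sum[symmetric])
    then show "a * (\<Sum>k\<in>UNIV. (c *\<^sub>R axis i 1) $ k *\<^sub>R pd k u (c *\<^sub>R x + v)) = a * complex_of_real c * pd i u (c *\<^sub>R x + v)"
      by (simp add: scaleR_conv_of_real)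
  qed
  then show "pd i h \<in> ?A" for i using h(2) dclass_pd by blast
  show "Q h" unfolding h(1) using h(2) assms(2) dclass_prop by blast
qed

lemma has_derivative_coord_mult:
  fixes f :: "real^'n::finite \<Rightarrow> complex"
  assumes "f \<in> dclass Q"
  shows "((\<lambda>x. of_real (x $ i) * f x) has_derivative
     (\<lambda>w. of_real (x $ i) * (\<Sum>k\<in>UNIV. w $ k *\<^sub>R pd k f x) + of_real (w $ i) * f x)) (at x)"
proof -
  have "((\<lambda>x. complex_of_real (x $ i)) has_derivative (\<lambda>w. of_real (w $ i))) (at x)"
    by (intro bounded_linear.has_derivative[OF bounded_linear_of_real] bounded_linear.has_derivative[OF bounded_linear_vec_nth] has_derivative_ident)
  from has_derivative_mult[OF this dclass_has_derivative[OF assms]] show ?thesis .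
qed

lemma dclass_coord_mult:
  fixes f :: "real^'n::finite \<Rightarrow> complex"
  assumes "f \<in> dclass Q" and add: "\<And>u v. Q u \<Longrightarrow> Q v \<Longrightarrow> Q (\<lambda>x. u x + v x)"
    and coord: "\<And>u. Q u \<Longrightarrow> Q (\<lambda>x. of_real (x $ i) * u x)" and zero: "Q (\<lambda>x. 0)"
  shows "(\<lambda>x. of_real (x $ i) * f x) \<in> dclass Q"
proof (rule dclass_coinduct)
  \<comment> \<open>The summand \<open>u\<close> absorbs the term without coordinate that the
    product rule produces when the coordinate itself is differentiated.\<close>
  let ?A = "{\<lambda>x. u x + of_real (x $ i) * v x | u v. u \<in> dclass Q \<and> v \<in> dclass Q}"
  have z: "(\<lambda>x. 0::complex) \<in> dclass Q"
    using zero by (rule dclass_zero)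
  have "(\<lambda>x. of_real (x $ i) * f x) = (\<lambda>x. 0 + of_real (x $ i) * f x)" by simp
  then show "(\<lambda>x. of_real (x $ i) * f x) \<in> ?A" using assms(1) z by (intro CollectI exI[of _ "\<lambda>x. 0"] exI[of _ f]) simp
  fix h assume "h \<in> ?A"
  then obtain u v where h: "h = (\<lambda>x. u x + of_real (x $ i) * v x)" "u \<in> dclass Q" "v \<in> dclass Q" by blast
  have D: "(h has_derivative (\<lambda>w. (\<Sum>k\<in>UNIV. w $ k *\<^sub>R pd k u x) +
     (of_real (x $ i) * (\<Sum>k\<in>UNIV. w $ k *\<^sub>R pd k v x) + of_real (w $ i) * v x))) (at x)" for x
    unfolding h(1) by (intro has_derivative_add dclass_has_derivative[OF h(2)] has_derivative_coord_mult[OF h(3)])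
  show "h differentiable (at x)" for x using D differentiableI by blast
  have "pd k h = (\<lambda>x. (if k = i then (\<lambda>x. pd k u x + v x) else pd k u) x + of_real (x $ i) * pd k v x)" for k
    by (rule ext, subst pd_eqI[OF D], unfold axis_sum) (auto simp: axis_def)
  moreover have "(if k = i then (\<lambda>x. pd k u x + v x) else pd k u) \<in> dclass Q" for k
    using dclass_pd[OF h(2)] dclass_add[OF dclass_pd[OF h(2)] h(3) add] by (cases "k = i") simp_all
  ultimately show "pd k h \<in> ?A" for k using h(3) dclass_pd[of v Q k] by blast
  show "Q h" unfolding h(1) using add coord h dclass_prop by blast
qed

section \<open>Rapid decay and closure properties of the Schwartz class\<close>

definition rapid :: "(real ^ 'n::finite \<Rightarrow> complex) \<Rightarrow> bool" where
  "rapid f \<longleftrightarrow> (\<forall>N. \<exists>C. \<forall>x. (1 + norm x) ^ N * norm (f x) \<le> C)"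

lemma smooth_eq_dclass: "smooth f \<longleftrightarrow> f \<in> dclass (\<lambda>_. True)"
  by (auto simp: smooth_def dclass_def)

lemma schwartz_eq_dclass: "schwartz = dclass rapid"
proof -
  have "bounded (range (\<lambda>x. (1 + norm x) ^ k *\<^sub>R g x)) \<longleftrightarrow> (\<exists>C. \<forall>x. (1 + norm x) ^ k * norm (g x) \<le> C)"
    for k and g :: "real^'n \<Rightarrow> complex"
    by (simp add: bounded_iff)
  then have "bounded (range (\<lambda>x. (1 + norm x) ^ k *\<^sub>R partials is f x)) \<longleftrightarrow> (\<exists>C. \<forall>x. (1 + norm x) ^ k * norm (partials is f x) \<le> C)"
    for k "is" and f :: "real^'n \<Rightarrow> complex" .
  then show ?thesis
    unfolding schwartz_def dclass_def rapid_def smooth_def by blast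
qed

lemma rapidE:
  assumes "rapid f" obtains C where "C \<ge> 0" "\<And>x. (1 + norm x) ^ N * norm (f x) \<le> C"
proof -
  obtain C where C: "\<And>x. (1 + norm x) ^ N * norm (f x) \<le> C" using assms unfolding rapid_def by blast
  from C[of 0] have "C \<ge> 0" by (smt (verit) norm_ge_zero mult_nonneg_nonneg zero_le_power)
  with C that show ?thesis by blast
qed

lemma rapid_add: assumes "rapid f" "rapid g" shows "rapid (\<lambda>x. f x + g x)"
  unfolding rapid_def
proof
  fix N
  obtain C D where C: "\<And>x. (1 + norm x) ^ N * norm (f x) \<le> C" and D: "\<And>x. (1 + norm x) ^ N * norm (g x) \<le> D"
    using assms unfolding rapid_def by meson
  have "(1 + norm x) ^ N * norm (f x + g x) \<le> C + D" for x
  proof -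
    have "(1 + norm x) ^ N * norm (f x + g x) \<le> (1 + norm x) ^ N * (norm (f x) + norm (g x))"
      by (intro mult_left_mono norm_triangle_ineq) auto
    then show ?thesis using C[of x] D[of x] by (simp add: ring_distribs)
  qed
  then show "\<exists>C. \<forall>x. (1 + norm x) ^ N * norm (f x + g x) \<le> C" by blast
qed

lemma rapid_dominated:
  assumes "rapid f" "\<And>x. norm (g x) \<le> B * (1 + norm x) ^ k * norm (f x)" shows "rapid g"
  unfolding rapid_def
proof
  fix N
  obtain C where C: "C \<ge> 0" "\<And>x. (1 + norm x) ^ (N + k) * norm (f x) \<le> C" using assms(1) rapidE by blast
  have "(1 + norm x) ^ N * norm (g x) \<le> \<bar>B\<bar> * C" for x
  proof -
    have "norm (g x) \<le> \<bar>B\<bar> * ((1 + norm x) ^ k * norm (f x))"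
      by (rule order.trans[OF assms(2)]) (auto simp: mult.assoc intro!: mult_right_mono)
    then have "(1 + norm x) ^ N * norm (g x) \<le> (1 + norm x) ^ N * (\<bar>B\<bar> * ((1 + norm x) ^ k * norm (f x)))"
      by (intro mult_left_mono) auto
    also have "\<dots> = \<bar>B\<bar> * ((1 + norm x) ^ (N + k) * norm (f x))" by (simp add: power_add)
    also have "\<dots> \<le> \<bar>B\<bar> * C" by (intro mult_left_mono C(2)) auto
    finally show ?thesis .
  qed
  then show "\<exists>C. \<forall>x. (1 + norm x) ^ N * norm (g x) \<le> C" by blast
qed

lemma rapid_cmult: "rapid f \<Longrightarrow> rapid (\<lambda>x. c * f x)"
  by (rule rapid_dominated[where B = "norm c" and k = 0]) (auto simp: norm_mult)

lemma rapid_zero: "rapid (\<lambda>x. 0)" by (auto simp: rapid_def)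

lemma rapid_coord_mult: 
  fixes f :: "real^'n::finite \<Rightarrow> complex"
  shows "rapid f \<Longrightarrow> rapid (\<lambda>x. of_real (x $ i) * f x)"
proof (erule rapid_dominated[where B = 1 and k = 1])
  fix x :: "real^'n" 
  show "norm (of_real (x $ i) * f x) \<le> 1 * (1 + norm x) ^ 1 * norm (f x)"
    using component_le_norm_cart[of x i] by (auto simp: norm_mult intro!: mult_right_mono)
qed

text \<open>Peetre's inequality: a weight is moved from one point to another at the price of a
  weight in the difference.\<close>

lemma weight_shift: "(1 + norm (x + y)) \<le> (1 + norm x) * (1 + norm (y::'a::real_normed_vector))"
proof -
  have "0 \<le> norm x * norm y" by simp
  then have "1 + (norm x + norm y) \<le> (1 + norm x) * (1 + norm y)" by (simp add: algebra_simps)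
  then show ?thesis using norm_triangle_ineq[of x y] by linarith
qed

lemma rapid_affine:
  fixes f :: "real^'n::finite \<Rightarrow> complex"
  assumes "rapid f" "c \<noteq> 0" shows "rapid (\<lambda>x. a * f (c *\<^sub>R x + v))"
  unfolding rapid_def
proof
  fix N
  obtain C where C: "C \<ge> 0" "\<And>x. (1 + norm x) ^ N * norm (f x) \<le> C" using assms(1) rapidE by blast
  \<comment> \<open>From x = (y - v) / c, followed by norm y + norm v <= (1 + norm v) (1 + norm
    y).\<close>
  define B where "B = (1 + 1 / \<bar>c\<bar>) * (1 + norm v)"
  have "(1 + norm x) ^ N * norm (a * f (c *\<^sub>R x + v)) \<le> norm a * B ^ N * C" for x
  proof -
    let ?y = "c *\<^sub>R x + v"
    have "norm x = norm ((?y - v) /\<^sub>R c)" using assms(2) by simp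
    also have "\<dots> \<le> (norm ?y + norm v) / \<bar>c\<bar>"
      using norm_triangle_ineq4[of ?y v] assms(2) by (simp add: divide_simps mult.commute)
    finally have "norm x \<le> (1 / \<bar>c\<bar>) * (norm ?y + norm v)" by simp
    also have "\<dots> \<le> (1 / \<bar>c\<bar>) * ((1 + norm v) * (1 + norm ?y))"
      by (intro mult_left_mono) (auto simp: algebra_simps)
    finally have "norm x \<le> (1 / \<bar>c\<bar>) * ((1 + norm v) * (1 + norm ?y))" .
    moreover have "1 \<le> (1 + norm v) * (1 + norm ?y)"
      using mult_mono[of 1 "1 + norm v" 1 "1 + norm ?y"] by simp
    ultimately have "1 + norm x \<le> (1 + 1 / \<bar>c\<bar>) * ((1 + norm v) * (1 + norm ?y))"
      by (simp only: distrib_right mult_1)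
    then have "(1 + norm x) ^ N \<le> (B * (1 + norm ?y)) ^ N"
      by (intro power_mono) (auto simp: B_def mult.assoc)
    then have "(1 + norm x) ^ N * norm (f ?y) \<le> B ^ N * ((1 + norm ?y) ^ N * norm (f ?y))"
      using mult_right_mono[of "(1 + norm x) ^ N" "(B * (1 + norm ?y)) ^ N" "norm (f ?y)"] 
      by (simp add: power_mult_distrib mult.assoc)
    also have "\<dots> \<le> B ^ N * C" by (intro mult_left_mono C) (auto simp: B_def)
    finally have "norm a * ((1 + norm x) ^ N * norm (f ?y)) \<le> norm a * (B ^ N * C)"
      by (intro mult_left_mono) auto
    then show ?thesis by (simp add: norm_mult mult_ac)
  qed
  then show "\<exists>C. \<forall>x. (1 + norm x) ^ N * norm (a * f (c *\<^sub>R x + v)) \<le> C" by blast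
qed

lemma schwartz_add: "f \<in> schwartz \<Longrightarrow> g \<in> schwartz \<Longrightarrow> (\<lambda>x. f x + g x) \<in> schwartz"
  unfolding schwartz_eq_dclass by (rule dclass_add) (auto intro: rapid_add)

lemma schwartz_cmult: "f \<in> schwartz \<Longrightarrow> (\<lambda>x. c * f x) \<in> schwartz"
  unfolding schwartz_eq_dclass by (rule dclass_cmult) (auto intro: rapid_cmult)

lemma schwartz_diff: "f \<in> schwartz \<Longrightarrow> g \<in> schwartz \<Longrightarrow> (\<lambda>x. f x - g x) \<in> schwartz"
  using schwartz_add[OF _ schwartz_cmult[of g "-1"], of f] by simp

lemma schwartz_zero: "(\<lambda>x. 0) \<in> schwartz"
  unfolding schwartz_eq_dclass
  using rapid_zero by (rule dclass_zero)

lemma schwartz_sum: "(\<And>i. i \<in> I \<Longrightarrow> f i \<in> schwartz) \<Longrightarrow> (\<lambda>x. \<Sum>i\<in>I. f i x) \<in> schwartz"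
  by (induction I rule: infinite_finite_induct) (auto simp: schwartz_zero intro!: schwartz_add)

lemma schwartz_coord_mult: "f \<in> schwartz \<Longrightarrow> (\<lambda>x. of_real (x $ i) * f x) \<in> schwartz"
  unfolding schwartz_eq_dclass by (rule dclass_coord_mult) (auto intro: rapid_add rapid_zero rapid_coord_mult)

lemma schwartz_affine: "f \<in> schwartz \<Longrightarrow> c \<noteq> 0 \<Longrightarrow> (\<lambda>x. f (c *\<^sub>R x + v)) \<in> schwartz"
  unfolding schwartz_eq_dclass by (rule dclass_affine) (auto intro: rapid_affine)

lemma schwartz_pd: "f \<in> schwartz \<Longrightarrow> pd i f \<in> schwartz"
  unfolding schwartz_eq_dclass by (rule dclass_pd)

lemma schwartz_partials: "f \<in> schwartz \<Longrightarrow> partials is f \<in> schwartz"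
  unfolding schwartz_eq_dclass by (rule dclass_partials)

lemma schwartz_rapid: "f \<in> schwartz \<Longrightarrow> rapid f"
  unfolding schwartz_eq_dclass by (rule dclass_prop)

lemma schwartz_has_derivative:
  "f \<in> schwartz \<Longrightarrow> (f has_derivative (\<lambda>v. \<Sum>i\<in>UNIV. v $ i *\<^sub>R pd i f x)) (at x)"
  unfolding schwartz_eq_dclass by (rule dclass_has_derivative)

lemma schwartz_continuous_on: "f \<in> schwartz \<Longrightarrow> continuous_on A f"
  unfolding schwartz_eq_dclass by (rule dclass_continuous_on)

lemma schwartz_measurable: "f \<in> schwartz \<Longrightarrow> f \<in> borel_measurable lborel"
  using borel_measurable_continuous_onI[OF schwartz_continuous_on] by simp

lemma schwartz_coinduct:
  assumes "f \<in> A" "\<And>g x. g \<in> A \<Longrightarrow> g differentiable (at x)"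
    "\<And>g i. g \<in> A \<Longrightarrow> pd i g \<in> A" "\<And>g. g \<in> A \<Longrightarrow> rapid g"
  shows "f \<in> schwartz"
  unfolding schwartz_eq_dclass using assms by (rule dclass_coinduct)

section \<open>Smooth functions, compact support, and division by powers of the norm\<close>

lemma smooth_add: 
  "smooth f \<Longrightarrow> smooth g \<Longrightarrow> smooth (\<lambda>x. f x + g x)"
  unfolding smooth_eq_dclass by (rule dclass_add)

lemma smooth_cmult: "smooth f \<Longrightarrow> smooth (\<lambda>x. (c::complex) * f x)"
  unfolding smooth_eq_dclass by (rule dclass_cmult)

lemma smooth_sum: "(\<And>i. i \<in> I \<Longrightarrow> smooth (f i)) \<Longrightarrow> smooth (\<lambda>x. \<Sum>i\<in>I. f i x :: complex)"
proof (induction I rule: infinite_finite_induct)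
  case empty
  show ?case by (simp add: smooth_eq_dclass dclass_zero)
next
  case (infinite A)
  then show ?case by (simp add: smooth_eq_dclass dclass_zero)
qed (auto intro!: smooth_add)

lemma smooth_coord_mult: "smooth f \<Longrightarrow> smooth (\<lambda>x. of_real (x $ i) * f x :: complex)"
  unfolding smooth_eq_dclass by (rule dclass_coord_mult) auto

lemma smooth_of_real:
  assumes "smooth f" shows "smooth (\<lambda>x. complex_of_real (f x))"
  unfolding smooth_eq_dclass
proof (rule dclass_coinduct)
  let ?A = "{\<lambda>x. complex_of_real (u x) | u. u \<in> dclass (\<lambda>_. True)}"
  show "(\<lambda>x. complex_of_real (f x)) \<in> ?A" using assms by (auto simp: smooth_eq_dclass)
  fix h assume "h \<in> ?A"
  then obtain u where h: "h = (\<lambda>x. complex_of_real (u x))" "u \<in> dclass (\<lambda>_. True)" by blast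
  have D: "(h has_derivative (\<lambda>w. of_real (\<Sum>i\<in>UNIV. w $ i *\<^sub>R pd i u x))) (at x)" for x
    unfolding h(1) by (rule bounded_linear.has_derivative[OF bounded_linear_of_real dclass_has_derivative[OF h(2)]])
  show "h differentiable (at x)" for x using D differentiableI by blast
  have "pd i h = (\<lambda>x. of_real (pd i u x))" for i
    by (rule ext, subst pd_eqI[OF D], subst axis_sum) simp
  then show "pd i h \<in> ?A" for i using h dclass_pd by blast
qed auto

lemma smooth_pd: "smooth f \<Longrightarrow> smooth (pd i f)"
  unfolding smooth_eq_dclass by (rule dclass_pd)

lemma pd_zero_on_open:
  assumes "open U" "\<And>y. y \<in> U \<Longrightarrow> f y = 0" "x \<in> U"
  shows "pd i f x = 0"
proof -
  have "(f has_derivative (\<lambda>_. 0)) (at x)"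
    by (rule has_derivative_transform_within_open[of "\<lambda>_. 0" _ _ _ U]) (use assms in auto)
  then show ?thesis by (rule pd_eqI)
qed

lemma schwartz_compact_support:
  fixes f :: "real^'n::finite \<Rightarrow> complex"
  assumes "smooth f" "\<And>x. norm x > R \<Longrightarrow> f x = 0"
  shows "f \<in> schwartz"
proof (rule schwartz_coinduct)
  let ?A = "{g :: real^'n \<Rightarrow> complex. smooth g \<and> (\<forall>x. norm x > R \<longrightarrow> g x = 0)}"
  show "f \<in> ?A" using assms by blast
  fix g assume g: "g \<in> ?A"
  show "g differentiable (at x)" for x using g by (auto simp: smooth_eq_dclass intro: dclass_differentiable)
  have op: "open {x::real^'n. norm x > R}" by (simp add: open_Collect_less continuous_on_norm_id continuous_on_const)
  have "pd i g x = 0" if "norm x > R" for i x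
    by (rule pd_zero_on_open[OF op]) (use g that in auto)
  then show "pd i g \<in> ?A" for i using g smooth_pd by blast
  show "rapid g" unfolding rapid_def
  proof
    fix N
    have "continuous_on (cball 0 R) (\<lambda>x. (1 + norm x) ^ N * norm (g x))"
      by (intro continuous_intros dclass_continuous_on[of g "\<lambda>_. True"]) (use g in \<open>auto simp: smooth_eq_dclass\<close>)
    then have "bounded ((\<lambda>x. (1 + norm x) ^ N * norm (g x)) ` cball 0 R)"
      by (intro compact_imp_bounded compact_continuous_image compact_cball)
    then obtain C where C: "\<And>x. norm x \<le> R \<Longrightarrow> (1 + norm x) ^ N * norm (g x) \<le> C"
      by (auto simp: bounded_iff image_iff) (metis abs_le_D1 mem_cball_0)
    have "(1 + norm x) ^ N * norm (g x) \<le> max C 0" for x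
      using C[of x] g by (cases "norm x \<le> R") (auto simp: max_def)
    then show "\<exists>C. \<forall>x. (1 + norm x) ^ N * norm (g x) \<le> C" by blast
  qed
qed

text \<open>The quotients whose numerator is smooth and vanishes on the ball of radius
  \<open>r\<close> are closed under \<open>pd\<close>: the quotient rule raises the exponent by one
  and changes the numerator. On the ball everything is 0, so division by zero at the origin does no
  harm.\<close>

lemma smooth_div_norm_power:
  fixes f :: "real^'n::finite \<Rightarrow> complex"
  assumes "smooth f" "r > 0" "\<And>x. norm x < r \<Longrightarrow> f x = 0"
  shows "smooth (\<lambda>x. f x / of_real ((norm x)\<^sup>2 ^ n))"
  unfolding smooth_eq_dclass
proof (rule dclass_coinduct)
  define A where "A = {\<lambda>x::real^'n. u x / of_real ((norm x)\<^sup>2 ^ k) | u k. smooth u \<and> (\<forall>x. norm x < r \<longrightarrow> u x = (0::complex))}"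
  show "(\<lambda>x. f x / of_real ((norm x)\<^sup>2 ^ n)) \<in> A" using assms unfolding A_def by blast
  fix h assume "h \<in> A"
  then obtain u k where h: "h = (\<lambda>x. u x / of_real ((norm x)\<^sup>2 ^ k))" "smooth u" "\<And>x. norm x < r \<Longrightarrow> u x = 0"
    unfolding A_def by blast
  have u: "u \<in> dclass (\<lambda>_. True)" using h(2) by (simp add: smooth_eq_dclass)
  let ?sq = "\<lambda>x::real^'n. complex_of_real ((norm x)\<^sup>2)"
  \<comment> \<open>The numerator of the quotient rule, |x|^2 \<open>pd i u\<close> - 2 k x_i u. The
    square of the norm is expanded in coordinates so that smoothness follows from
    \<open>smooth_coord_mult\<close>.\<close>
  define w where "w i = (\<lambda>x. (\<Sum>j\<in>UNIV. of_real (x $ j) * (of_real (x $ j) * pd i u x)) - 2 * of_nat k * (of_real (x $ i) * u x))" for i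
  have sw: "smooth (w i)" for i
  proof -
    have "smooth (\<lambda>x. (\<Sum>j\<in>UNIV. of_real (x $ j) * (of_real (x $ j) * pd i u x)) + (- 2 * of_nat k) * (of_real (x $ i) * u x))"
      by (intro smooth_add smooth_sum smooth_cmult smooth_coord_mult smooth_pd h(2))
    then show ?thesis by (simp add: w_def)
  qed
  have w_eq: "w i x = ?sq x * pd i u x - 2 * of_nat k * of_real (x $ i) * u x" for i x
  proof -
    have "?sq x = (\<Sum>j\<in>UNIV. of_real (x $ j) * of_real (x $ j))"
      by (simp only: power2_norm_eq_inner inner_vec_def inner_real_def of_real_sum of_real_mult)
    then show ?thesis unfolding w_def by (simp add: sum_distrib_right mult.assoc)
  qed
  have opn: "open (ball (0::real^'n) r)" by simp
  have w0: "w i x = 0" if "norm x < r" for i x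
    using pd_zero_on_open[OF opn, of u x i] h(3) that by (simp add: w_eq)
  have inn: "(h has_derivative (\<lambda>_. 0)) (at x)" if "norm x < r" for x
    by (rule has_derivative_transform_within_open[of "\<lambda>_. 0" _ _ _ "ball 0 r"]) (use that h in auto)
  have outt: "(h has_derivative (\<lambda>v. u x * (- of_nat k * of_real (2 * (x \<bullet> v)) / ?sq x ^ Suc k) + (\<Sum>i\<in>UNIV. v $ i *\<^sub>R pd i u x) / ?sq x ^ k)) (at x)" if "x \<noteq> 0" for x
  proof -
    have 1: "((\<lambda>y. ((norm y)\<^sup>2)) has_derivative (\<lambda>v. (2 * (x \<bullet> v)))) (at x)"
      by (auto intro!: derivative_eq_intros simp: power2_norm_eq_inner inner_commute)
    have sq: "((\<lambda>y. ?sq y) has_derivative (\<lambda>v. of_real (2 * (x \<bullet> v)))) (at x)"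
      by (rule bounded_linear.has_derivative[OF bounded_linear_of_real 1])
    have "((\<lambda>z. 1 / z ^ k) has_field_derivative (- of_nat k / z ^ Suc k)) (at z)" if "z \<noteq> 0" for z :: complex
    proof (cases k)
      case (Suc n)
      have "((\<lambda>z. 1 / z ^ k) has_field_derivative ((0 * z ^ k - 1 * (of_nat k * z ^ (k - 1))) / (z ^ k * z ^ k))) (at z)"
        using that by (auto intro!: derivative_eq_intros)
      also have "(0 * z ^ k - 1 * (of_nat k * z ^ (k - 1))) / (z ^ k * z ^ k) = - of_nat k / z ^ Suc k"
        unfolding Suc using that by (simp add: divide_simps)
      finally show ?thesis .
    qed simp
    then have "((\<lambda>z. 1 / z ^ k) has_field_derivative (- of_nat k / ?sq x ^ Suc k)) (at (?sq x))" using that by simp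
    from has_derivative_compose[OF sq this[unfolded has_field_derivative_def]]
    have "((\<lambda>y. 1 / ?sq y ^ k) has_derivative (\<lambda>v. (- of_nat k / ?sq x ^ Suc k) * of_real (2 * (x \<bullet> v)))) (at x)" .
    from has_derivative_mult[OF dclass_has_derivative[OF u, of x] this]
    have "((\<lambda>y. u y * (1 / ?sq y ^ k)) has_derivative (\<lambda>v. u x * ((- of_nat k / ?sq x ^ Suc k) * of_real (2 * (x \<bullet> v)))
       + (\<Sum>i\<in>UNIV. v $ i *\<^sub>R pd i u x) * (1 / ?sq x ^ k))) (at x)" .
    then show ?thesis unfolding h(1) by (simp only: times_divide_eq_right times_divide_eq_left mult_1_right of_real_power)
  qed
  show "h differentiable (at x)" for x
  proof (cases "norm x < r")
    case True then show ?thesis using inn differentiableI by blast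
  next
    case False with assms(2) have "x \<noteq> 0" by auto
    then show ?thesis using outt differentiableI by blast
  qed
  have "pd i h = (\<lambda>x. w i x / of_real ((norm x)\<^sup>2 ^ Suc k))" for i
  proof
    fix x show "pd i h x = w i x / of_real ((norm x)\<^sup>2 ^ Suc k)"
    proof (cases "norm x < r")
      case True then show ?thesis using pd_eqI[OF inn] w0 by simp
    next
      case False with assms(2) have x: "x \<noteq> 0" by auto
      then have nz: "?sq x \<noteq> 0" by simp
      have "pd i h x = u x * (- of_nat k * of_real (2 * (x $ i)) / ?sq x ^ Suc k) + pd i u x / ?sq x ^ k"
        by (subst pd_eqI[OF outt[OF x]], subst axis_sum) (simp add: inner_axis)
      also have "\<dots> = w i x / ?sq x ^ Suc k"
        using nz unfolding w_eq by (simp add: field_simps del: of_real_power)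
      finally show ?thesis by simp
    qed
  qed
  then show "pd i h \<in> A" for i using sw w0 unfolding A_def by blast
qed auto

subsection \<open>Lebesgue integrals on Euclidean space\<close>

text \<open>\<open>lborel\<close> is the image of the product of one-dimensional measures under the
  coordinate map, so this is Fubini transported along \<open>lborel_eq\<close>. It serves the
  integrable weight and the Gaussian.\<close>

lemma lborel_integral_prod:
  fixes f :: "'a::euclidean_space \<Rightarrow> real \<Rightarrow> 'b::{real_normed_field,banach,second_countable_topology}"
  assumes "\<And>b. b \<in> Basis \<Longrightarrow> integrable lborel (f b)"
  shows "integrable lborel (\<lambda>x::'a. \<Prod>b\<in>Basis. f b (x \<bullet> b))"
    and "(LINT x|lborel. (\<Prod>b\<in>Basis. f b ((x::'a) \<bullet> b))) = (\<Prod>b\<in>Basis. (LINT t|lborel. f b t))"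
proof -
  interpret P: product_sigma_finite "\<lambda>_::'a. lborel :: real measure" ..
  have [measurable]: "f b \<in> borel_measurable borel" if "b \<in> Basis" for b
    using assms[OF that] by (simp add: borel_measurable_integrable)
  have M: "(\<lambda>x::'a. \<Prod>b\<in>Basis. f b (x \<bullet> b)) \<in> borel_measurable borel" by measurable
  have D: "(\<lambda>g::'a\<Rightarrow>real. \<Sum>b\<in>Basis. g b *\<^sub>R b) \<in> measurable (Pi\<^sub>M Basis (\<lambda>_. lborel)) borel" by measurable
  have eq: "(\<Prod>b\<in>Basis. f b ((\<Sum>c\<in>Basis. g c *\<^sub>R c) \<bullet> b)) = (\<Prod>b\<in>Basis. f b (g b))" for g :: "'a \<Rightarrow> real"
    by (rule prod.cong) simp_all
  show "integrable lborel (\<lambda>x::'a. \<Prod>b\<in>Basis. f b (x \<bullet> b))"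
    unfolding lborel_eq[where 'a='a] integrable_distr_eq[OF D M] eq
    by (rule P.product_integrable_prod) (use assms in auto)
  show "(LINT x|lborel. (\<Prod>b\<in>Basis. f b ((x::'a) \<bullet> b))) = (\<Prod>b\<in>Basis. (LINT t|lborel. f b t))"
    unfolding lborel_eq[where 'a='a] integral_distr[OF D M] eq
    by (subst P.product_integral_prod) (use assms in \<open>auto simp: lborel_eq[symmetric]\<close>)
qed

lemma lborel_integral_affine:
  fixes f :: "'a::euclidean_space \<Rightarrow> 'b::{banach, second_countable_topology}"
  assumes "c \<noteq> 0" "f \<in> borel_measurable borel"
  shows "(LINT x|lborel. f x) = \<bar>c\<bar> ^ DIM('a) *\<^sub>R (LINT x|lborel. f (t + c *\<^sub>R x))"
  using assms by (subst lborel_affine[OF assms(1), of t]) (simp add: integral_density integral_distr)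

lemma lborel_integrable_affine:
  fixes f :: "'a::euclidean_space \<Rightarrow> 'b::{banach, second_countable_topology}"
  assumes "c \<noteq> 0" "f \<in> borel_measurable borel"
  shows "integrable lborel (\<lambda>x. f (t + c *\<^sub>R x)) \<longleftrightarrow> integrable lborel f"
proof -
  have "integrable lborel f \<longleftrightarrow> integrable lborel (\<lambda>x. \<bar>c\<bar> ^ DIM('a) *\<^sub>R f (t + c *\<^sub>R x))"
    using assms by (subst lborel_affine[OF assms(1), of t]) (simp add: integrable_density integrable_distr_eq)
  moreover have "integrable lborel (\<lambda>x. a *\<^sub>R g x) \<longleftrightarrow> integrable lborel g"
    if "a \<noteq> 0" for a and g :: "'a \<Rightarrow> 'b"
    using integrable_scaleR_right[of "inverse a" lborel "\<lambda>x. a *\<^sub>R g x"] that by auto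
  ultimately show ?thesis using assms(1) by simp
qed

lemma lborel_integral_translate:
  fixes f :: "'a::euclidean_space \<Rightarrow> 'b::{banach, second_countable_topology}"
  assumes "f \<in> borel_measurable borel"
  shows "(LINT x|lborel. f (x + t)) = (LINT x|lborel. f x)"
  using lborel_integral_affine[of 1 f t] assms by (simp add: add.commute)

lemma lborel_integrable_translate:
  fixes f :: "'a::euclidean_space \<Rightarrow> 'b::{banach, second_countable_topology}"
  assumes "f \<in> borel_measurable borel"
  shows "integrable lborel (\<lambda>x. f (x + t)) \<longleftrightarrow> integrable lborel f"
  using lborel_integrable_affine[of 1 f t] assms by (simp add: add.commute)

lemma integrable_inverse_1_plus_square_real: "integrable lborel (\<lambda>x::real. inverse (1 + x\<^sup>2))"
  using integrable_inverse_1_plus_square by (simp add: set_integrable_def)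

text \<open>The exponent makes the product of the one-dimensional functions 1/(1 + x_b^2) a
  majorant: each factor 1 + x_b^2 is at most (1 + |x|)^2, and there are \<open>CARD('n)\<close> of
  them.\<close>

lemma integrable_norm_weight:
  "integrable lborel (\<lambda>x::real^'n::finite. inverse ((1 + norm x) ^ (2 * CARD('n))))"
proof (rule Bochner_Integration.integrable_bound)
  show "integrable lborel (\<lambda>x::real^'n. \<Prod>b\<in>Basis. inverse (1 + (x \<bullet> b)\<^sup>2))"
    by (rule lborel_integral_prod) (rule integrable_inverse_1_plus_square_real)
  show "AE x in lborel. norm (inverse ((1 + norm x) ^ (2 * CARD('n))))
      \<le> norm (\<Prod>b\<in>Basis. inverse (1 + ((x::real^'n) \<bullet> b)\<^sup>2))" (is "AE x in lborel. ?P x")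
  proof (rule AE_I2)
    fix x :: "real^'n"
    have "(\<Prod>b\<in>Basis. 1 + (x \<bullet> b)\<^sup>2) \<le> (\<Prod>b\<in>(Basis::(real^'n) set). (1 + norm x)\<^sup>2)"
    proof (rule prod_mono)
      fix b :: "real^'n" assume "b \<in> Basis"
      then have "\<bar>x \<bullet> b\<bar> \<le> norm x" by (rule Basis_le_norm)
      then have "(x \<bullet> b)\<^sup>2 \<le> (norm x)\<^sup>2" by (metis abs_le_square_iff abs_norm_cancel)
      moreover have "1 + (norm x)\<^sup>2 \<le> (1 + norm x)\<^sup>2" by (simp add: power2_sum)
      ultimately show "0 \<le> 1 + (x \<bullet> b)\<^sup>2 \<and> 1 + (x \<bullet> b)\<^sup>2 \<le> (1 + norm x)\<^sup>2" by auto
    qed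
    also have "\<dots> = (1 + norm x) ^ (2 * CARD('n))" by (simp add: power_mult)
    finally have "inverse ((1 + norm x) ^ (2 * CARD('n))) \<le> inverse (\<Prod>b\<in>Basis. 1 + (x \<bullet> b)\<^sup>2)"
      by (intro le_imp_inverse_le prod_pos) (auto simp: add_pos_nonneg)
    moreover have "0 \<le> inverse ((1 + norm x) ^ (2 * CARD('n)))" by simp
    ultimately show "?P x"
      by (simp add: prod_inversef[symmetric] o_def del: inverse_nonnegative_iff_nonnegative)
  qed
qed simp

definition wint :: "'n::finite itself \<Rightarrow> real" where
  "wint _ = (LINT x|lborel. inverse ((1 + norm (x::real^'n)) ^ (2 * CARD('n))))"

lemma wint_nonneg: "wint TYPE('n::finite) \<ge> 0"
  unfolding wint_def by (intro integral_nonneg_AE) auto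

lemma integrable_of_weighted_bound:
  fixes f :: "real^'n::finite \<Rightarrow> complex"
  assumes "f \<in> borel_measurable borel" "\<And>x. (1 + norm x) ^ (2 * CARD('n)) * norm (f x) \<le> C"
  shows "integrable lborel f" "(LINT x|lborel. norm (f x)) \<le> C * wint TYPE('n)"
proof -
  have b: "norm (f x) \<le> C * inverse ((1 + norm x) ^ (2 * CARD('n)))" for x
  proof -
    have "(1 + norm x) ^ (2 * CARD('n)) > 0" by (intro zero_less_power) (simp add: add_pos_nonneg)
    then show ?thesis using assms(2)[of x] by (simp add: field_simps)
  qed
  have i: "integrable lborel (\<lambda>x::real^'n. C * inverse ((1 + norm x) ^ (2 * CARD('n))))"
    using integrable_norm_weight by (rule integrable_mult_right)
  show f: "integrable lborel f"
    by (rule Bochner_Integration.integrable_bound[OF i]) (use assms(1) order.trans[OF b abs_ge_self] in auto)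
  have "(LINT x|lborel. norm (f x)) \<le> (LINT x|lborel. C * inverse ((1 + norm (x::real^'n)) ^ (2 * CARD('n))))"
    using b by (intro integral_mono integrable_norm f i) auto
  then show "(LINT x|lborel. norm (f x)) \<le> C * wint TYPE('n)" by (simp add: wint_def)
qed

lemma rapid_integrable:
  assumes "rapid f" "f \<in> borel_measurable borel" shows "integrable lborel f"
proof -
  obtain C where "\<And>x. (1 + norm x) ^ (2 * CARD('a)) * norm (f x) \<le> C" using assms(1) rapidE by blast
  with assms(2) show ?thesis by (rule integrable_of_weighted_bound)
qed

lemma schwartz_borel: "f \<in> schwartz \<Longrightarrow> f \<in> borel_measurable borel"
  using schwartz_measurable by simp

lemma schwartz_integrable: "f \<in> schwartz \<Longrightarrow> integrable lborel f"
  by (intro rapid_integrable schwartz_rapid schwartz_borel)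

lemma schwartz_integrable_weight:
  assumes "f \<in> schwartz" shows "integrable lborel (\<lambda>x. (1 + norm x) ^ N * norm (f x))"
proof -
  let ?g = "\<lambda>x. complex_of_real ((1 + norm x) ^ N) * f x"
  have n: "norm (?g x) = (1 + norm x) ^ N * norm (f x)" for x
    unfolding norm_mult norm_of_real by (subst abs_of_nonneg) auto
  have "rapid ?g"
    by (rule rapid_dominated[OF schwartz_rapid[OF assms], of _ 1 N]) (simp only: n mult_1)
  moreover have [measurable]: "f \<in> borel_measurable borel" using assms by (rule schwartz_borel)
  have "?g \<in> borel_measurable borel" by measurable
  ultimately have "integrable lborel ?g" by (intro rapid_integrable)
  from integrable_norm[OF this] show ?thesis unfolding n .
qed

lemma schwartz_bounded:
  assumes "f \<in> schwartz" obtains C where "C \<ge> 0" "\<And>x. norm (f x) \<le> C"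
  using rapidE[OF schwartz_rapid[OF assms], of 0] by auto

section \<open>The L1 norm, and weighted mean value and Taylor estimates\<close>

definition L1 :: "(real^'n::finite \<Rightarrow> complex) \<Rightarrow> real" where
  "L1 f = (LINT x|lborel. norm (f x))"

lemma L1_nonneg [simp]: "L1 f \<ge> 0"
  unfolding L1_def by (intro integral_nonneg_AE) auto

text \<open>The derivative is bounded on the ball about x that contains both points; there Peetre's
  inequality trades the weight at x for the weight at the intermediate point, where the partials
  decay.\<close>

lemma schwartz_mean_value:
  assumes "f \<in> schwartz"
  obtains C where "C \<ge> 0"
    "\<And>x u v. (1 + norm x) ^ N * norm (f (x + u) - f (x + v)) \<le> C * norm (u - v) * (1 + max (norm u) (norm v)) ^ N"
proof -
  have "\<exists>C. \<forall>i. C i \<ge> 0 \<and> (\<forall>x. (1 + norm x) ^ N * norm (pd i f x) \<le> C i)"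
  proof (intro choice allI)
    fix i
    show "\<exists>C. C \<ge> 0 \<and> (\<forall>x. (1 + norm x) ^ N * norm (pd i f x) \<le> C)"
      by (rule rapidE[OF schwartz_rapid[OF schwartz_pd[OF assms]], where N = N]) blast
  qed
  then obtain C where C: "\<And>i. C i \<ge> 0" "\<And>i x. (1 + norm x) ^ N * norm (pd i f x) \<le> C i" by blast
  define B where "B = (\<Sum>i\<in>UNIV. C i)"
  show thesis
  proof
    show "B \<ge> 0" unfolding B_def by (intro sum_nonneg C)
    fix x u v :: "real^'a"
    define M where "M = max (norm u) (norm v)"
    define D where "D = (\<lambda>w h. \<Sum>i\<in>UNIV. h $ i *\<^sub>R pd i f w)"
    have pos: "(1 + norm x) ^ N > 0" by (intro zero_less_power) (simp add: add_pos_nonneg)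
    have "onorm (D w) \<le> B * (1 + M) ^ N / (1 + norm x) ^ N" if w: "w \<in> cball x M" for w
    proof (rule onorm_le)
      fix h
      have n: "norm (x - w) \<le> M" using w by (simp add: dist_norm)
      have "1 + norm x \<le> (1 + norm w) * (1 + norm (x - w))" using weight_shift[of w "x - w"] by simp
      also have "\<dots> \<le> (1 + norm w) * (1 + M)" using n by (intro mult_left_mono) auto
      finally have "(1 + norm x) ^ N \<le> ((1 + norm w) * (1 + M)) ^ N" by (intro power_mono) auto
      then have s: "(1 + norm x) ^ N \<le> (1 + norm w) ^ N * (1 + M) ^ N" by (simp add: power_mult_distrib)
      have M0: "M \<ge> 0" unfolding M_def by (simp add: le_max_iff_disj)
      have "(1 + norm x) ^ N * norm (D w h) \<le> (1 + norm x) ^ N * (\<Sum>i\<in>UNIV. norm h * norm (pd i f w))"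
        unfolding D_def using component_le_norm_cart[of h]
        by (intro mult_left_mono order.trans[OF norm_sum] sum_mono) (auto intro!: mult_right_mono)
      also have "\<dots> \<le> (1 + norm w) ^ N * (1 + M) ^ N * (\<Sum>i\<in>UNIV. norm h * norm (pd i f w))"
        using s by (intro mult_right_mono sum_nonneg) auto
      also have "\<dots> = (1 + M) ^ N * norm h * (\<Sum>i\<in>UNIV. (1 + norm w) ^ N * norm (pd i f w))"
        by (simp add: sum_distrib_left mult_ac)
      also have "\<dots> \<le> (1 + M) ^ N * norm h * B"
        unfolding B_def using M0 by (intro mult_left_mono sum_mono C) auto
      finally show "norm (D w h) \<le> B * (1 + M) ^ N / (1 + norm x) ^ N * norm h"
        using pos by (simp add: field_simps)
    qed
    moreover have "(f has_derivative D w) (at w within cball x M)" for w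
      unfolding D_def using schwartz_has_derivative[OF assms] by (rule has_derivative_at_withinI)
    ultimately have "norm (f (x + u) - f (x + v)) \<le> B * (1 + M) ^ N / (1 + norm x) ^ N * norm ((x + u) - (x + v))"
      by (intro differentiable_bound[where S = "cball x M" and f' = D]) (auto simp: M_def dist_norm)
    then show "(1 + norm x) ^ N * norm (f (x + u) - f (x + v)) \<le> B * norm (u - v) * (1 + max (norm u) (norm v)) ^ N"
      using pos unfolding M_def[symmetric] by (simp add: field_simps)
  qed
qed

text \<open>Lipschitz partials make the remainder quadratic in \<open>v\<close> with a constant
  uniform in \<open>x\<close>. The uniformity is what lets the remainder be integrated against a
  kernel.\<close>

lemma schwartz_Taylor:
  assumes "f \<in> schwartz"
  obtains C where "C \<ge> 0" "\<And>x v. norm (f (x + v) - f x - (\<Sum>i\<in>UNIV. v $ i *\<^sub>R pd i f x)) \<le> C * (norm v)\<^sup>2"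
proof -
  have "\<exists>C. \<forall>i. C i \<ge> 0 \<and> (\<forall>x u v. (1 + norm x) ^ 0 * norm (pd i f (x + u) - pd i f (x + v)) \<le> C i * norm (u - v) * (1 + max (norm u) (norm v)) ^ 0)"
  proof (intro choice allI)
    fix i
    show "\<exists>C. C \<ge> 0 \<and> (\<forall>x u v. (1 + norm x) ^ 0 * norm (pd i f (x + u) - pd i f (x + v)) \<le> C * norm (u - v) * (1 + max (norm u) (norm v)) ^ 0)"
      by (rule schwartz_mean_value[OF schwartz_pd[OF assms], where N = 0]) blast
  qed
  then have "\<exists>C. \<forall>i. C i \<ge> 0 \<and> (\<forall>x u v. norm (pd i f (x + u) - pd i f (x + v)) \<le> C i * norm (u - v))" by simp
  then obtain C where C: "\<And>i. C i \<ge> 0" "\<And>i x u v. norm (pd i f (x + u) - pd i f (x + v)) \<le> C i * norm (u - v)" by blast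
  define B where "B = (\<Sum>i\<in>UNIV. C i)"
  show thesis
  proof
    show "B \<ge> 0" unfolding B_def by (intro sum_nonneg C)
    fix x v :: "real^'a"
    define D where "D = (\<lambda>w h. \<Sum>i\<in>UNIV. h $ i *\<^sub>R pd i f w)"
    have "norm (f (x + v) - f x - D x ((x + v) - x)) \<le> norm ((x + v) - x) * (B * norm v)"
    proof (rule differentiable_bound_linearization[where S = "cball x (norm v)" and f' = D])
      show "x + t *\<^sub>R (x + v - x) \<in> cball x (norm v)" if "t \<in> {0..1}" for t
        using that by (auto simp: dist_norm intro!: mult_left_le_one_le)
      show "(f has_derivative D w) (at w within cball x (norm v))" for w
        unfolding D_def using schwartz_has_derivative[OF assms] by (rule has_derivative_at_withinI)
      show "x \<in> cball x (norm v)" by simp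
      show "onorm (D w - D x) \<le> B * norm v" if w: "w \<in> cball x (norm v)" for w
      proof (rule onorm_le)
        fix h
        have n: "norm (w - x) \<le> norm v" using w by (simp add: dist_norm norm_minus_commute)
        have "(D w - D x) h = (\<Sum>i\<in>UNIV. h $ i *\<^sub>R (pd i f w - pd i f x))"
          unfolding D_def by (simp add: sum_subtractf scaleR_diff_right)
        also have "norm \<dots> \<le> (\<Sum>i\<in>UNIV. norm h * (C i * norm v))"
        proof (intro order.trans[OF norm_sum] sum_mono)
          fix i
          have "norm (pd i f w - pd i f x) \<le> C i * norm (w - x)" using C(2)[of i x "w - x" 0] by simp
          also have "\<dots> \<le> C i * norm v" using n C(1) by (intro mult_left_mono)
          finally show "norm (h $ i *\<^sub>R (pd i f w - pd i f x)) \<le> norm h * (C i * norm v)"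
            using component_le_norm_cart[of h i] C(1)[of i] by (auto intro!: mult_mono)
        qed
        also have "\<dots> = B * norm v * norm h" by (simp add: B_def sum_distrib_left sum_distrib_right mult_ac)
        finally show "norm ((D w - D x) h) \<le> B * norm v * norm h" .
      qed
    qed
    then show "norm (f (x + v) - f x - (\<Sum>i\<in>UNIV. v $ i *\<^sub>R pd i f x)) \<le> B * (norm v)\<^sup>2"
      unfolding D_def by (simp add: power2_eq_square mult_ac)
  qed
qed

text \<open>Quadratic remainder bounds survive integration, so for \<open>ft\<close> and
  \<open>dconv\<close> this takes the place of differentiation under the integral sign.\<close>

lemma has_derivative_quadratic:
  fixes f :: "real^'n::finite \<Rightarrow> complex"
  assumes "\<And>v. norm (f (x + v) - f x - (\<Sum>i\<in>UNIV. v $ i *\<^sub>R a i)) \<le> C * (norm v)\<^sup>2"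
  shows "(f has_derivative (\<lambda>v. \<Sum>i\<in>UNIV. v $ i *\<^sub>R a i)) (at x)"
  unfolding has_derivative_at
proof
  show "bounded_linear (\<lambda>v. \<Sum>i\<in>UNIV. v $ i *\<^sub>R a i)"
    by (intro bounded_linear_sum bounded_linear_scaleR_left[THEN bounded_linear_compose] bounded_linear_vec_nth)
  have "((\<lambda>h::real^'n. C * norm h) \<longlongrightarrow> 0) (at 0)" by (auto intro!: tendsto_eq_intros)
  then show "(\<lambda>h. norm (f (x + h) - f x - (\<Sum>i\<in>UNIV. h $ i *\<^sub>R a i)) / norm h) \<midarrow>0\<rightarrow> 0"
  proof (rule Lim_null_comparison[rotated], intro eventually_at_topological[THEN iffD2] exI conjI ballI impI)
    show "open (UNIV::(real^'n) set)" "0 \<in> (UNIV::(real^'n) set)" by auto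
    fix h :: "real^'n" assume "h \<noteq> 0"
    then show "norm (norm (f (x + h) - f x - (\<Sum>i\<in>UNIV. h $ i *\<^sub>R a i)) / norm h) \<le> C * norm h"
      using assms[of h] by (simp add: divide_simps power2_eq_square)
  qed
qed

subsection \<open>The Fourier transform\<close>

text \<open>Positive sign and no normalising factor: \<open>fourier\<close> is the reflection of
  this function and \<open>inv_fourier\<close> a constant multiple of it, so one calculus covers
  both.\<close>

definition ft :: "(real ^ 'n::finite \<Rightarrow> complex) \<Rightarrow> real ^ 'n \<Rightarrow> complex" where
  "ft f \<xi> = (LINT x|lborel. cis (x \<bullet> \<xi>) * f x)"

lemma fourier_ft: "fourier f \<xi> = ft f (- \<xi>)"
  by (simp add: fourier_def ft_def)

lemma inv_fourier_ft: "inv_fourier f \<xi> = of_real (1 / (2 * pi) ^ CARD('n)) * ft f (\<xi> :: real^'n::finite)"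
  unfolding inv_fourier_def ft_def by (subst (2) inner_commute) (rule refl)

lemma cis_measurable [measurable]: "cis \<in> borel_measurable borel"
  by (intro borel_measurable_continuous_onI continuous_intros) 

lemma integrable_cis:
  fixes f :: "'a::euclidean_space \<Rightarrow> complex"
  assumes "integrable lborel f" shows "integrable lborel (\<lambda>x. cis (x \<bullet> \<xi>) * f x)"
proof (rule Bochner_Integration.integrable_bound[OF assms])
  have [measurable]: "f \<in> borel_measurable borel" using assms by (simp add: borel_measurable_integrable)
  show "(\<lambda>x. cis (x \<bullet> \<xi>) * f x) \<in> borel_measurable lborel" by simp
qed (simp add: norm_mult)

lemma norm_ft_le: "integrable lborel f \<Longrightarrow> norm (ft f \<xi>) \<le> L1 f"
  unfolding ft_def L1_def
  by (rule order.trans[OF integral_norm_bound]) (simp add: norm_mult)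

lemma ft_cmult: "ft (\<lambda>x. c * f x) \<xi> = c * ft f \<xi>"
  unfolding ft_def by (simp add: mult.left_commute[of _ c])

lemma ft_sum: "(\<And>i. i \<in> I \<Longrightarrow> integrable lborel (f i)) \<Longrightarrow> ft (\<lambda>x. \<Sum>i\<in>I. f i x) \<xi> = (\<Sum>i\<in>I. ft (f i) \<xi>)"
  unfolding ft_def by (simp add: sum_distrib_left Bochner_Integration.integral_sum integrable_cis)

lemma cis_Taylor2: "norm (cis b - 1 - \<i> * b) \<le> b\<^sup>2 / 2"
  using iexp_approx1[of b 1] by (simp add: cis_conv_exp power2_eq_square algebra_simps)

text \<open>No integration by parts: translating \<open>f\<close> multiplies its transform by a
  character, so the difference quotients \<open>q n\<close> have explicit transforms. Dominated
  convergence identifies one limit, the derivative of the character the other.\<close>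

lemma ft_pd:
  assumes f: "f \<in> schwartz"
  shows "ft (pd i f) \<xi> = - \<i> * of_real (\<xi> $ i) * ft f \<xi>"
proof -
  define e where "e = axis i (1::real)"
  define s where "s n = 1 / real (Suc n)" for n
  have s: "s \<longlonglongrightarrow> 0" "\<And>n. s n > 0" "\<And>n. s n \<le> 1" unfolding s_def
    using LIMSEQ_inverse_real_of_nat by (auto simp: divide_simps)
  have ne: "norm e = 1" by (simp add: e_def)
  have fm [measurable]: "f \<in> borel_measurable borel" using f by (rule schwartz_borel)
  define q where "q n x = (f (x + s n *\<^sub>R e) - f x) / of_real (s n)" for n x
  obtain C where C: "C \<ge> 0" "\<And>x u v. (1 + norm x) ^ (2 * CARD('a)) * norm (f (x + u) - f (x + v))
       \<le> C * norm (u - v) * (1 + max (norm u) (norm v)) ^ (2 * CARD('a))"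
    using schwartz_mean_value[OF f] by blast
  \<comment> \<open>Dominates all difference quotients: the steps \<open>s n\<close> are at most 1,
    so the weight \<open>1 + s n\<close> costs at most the power of 2.\<close>
  define w where "w x = C * 2 ^ (2 * CARD('a)) * inverse ((1 + norm (x::real^'a)) ^ (2 * CARD('a)))" for x
  have qb: "norm (q n x) \<le> w x" for n x
  proof -
    have pos: "(1 + norm x) ^ (2 * CARD('a)) > 0" by (intro zero_less_power) (simp add: add_pos_nonneg)
    have "(1 + norm x) ^ (2 * CARD('a)) * norm (f (x + s n *\<^sub>R e) - f x) \<le> C * s n * (1 + s n) ^ (2 * CARD('a))"
      using C(2)[of x "s n *\<^sub>R e" 0] ne s(2)[of n] by simp
    also have "\<dots> \<le> C * s n * 2 ^ (2 * CARD('a))"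
      using C(1) s(2)[of n] s(3)[of n] by (intro mult_left_mono power_mono) auto
    finally have "s n * (norm (q n x) * (1 + norm x) ^ (2 * CARD('a))) \<le> s n * (C * 2 ^ (2 * CARD('a)))"
      using s(2)[of n] unfolding q_def by (simp add: norm_divide mult_ac)
    then have "norm (q n x) * (1 + norm x) ^ (2 * CARD('a)) \<le> C * 2 ^ (2 * CARD('a))"
      using s(2)[of n] by simp
    then show ?thesis unfolding w_def using pos by (simp add: field_simps)
  qed
  have qm [measurable]: "q n \<in> borel_measurable borel" for n unfolding q_def by measurable
  have wi: "integrable lborel w" unfolding w_def using integrable_norm_weight by (rule integrable_mult_right)
  have qi: "integrable lborel (q n)" for n
    by (rule Bochner_Integration.integrable_bound[OF wi]) (use order.trans[OF qb abs_ge_self] in auto)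
  have qlim: "(\<lambda>n. q n x) \<longlonglongrightarrow> pd i f x" for x
  proof -
    obtain B where B: "\<And>x v. norm (f (x + v) - f x - (\<Sum>i\<in>UNIV. v $ i *\<^sub>R pd i f x)) \<le> B * (norm v)\<^sup>2"
      using schwartz_Taylor[OF f] by blast
    have 1: "norm (q n x - pd i f x) \<le> B * s n" for n
    proof -
      have "(\<Sum>k\<in>UNIV. (s n *\<^sub>R e) $ k *\<^sub>R pd k f x) = of_real (s n) * pd i f x"
      proof -
        have "(\<Sum>k\<in>UNIV. (s n *\<^sub>R e) $ k *\<^sub>R pd k f x) = s n *\<^sub>R (\<Sum>k\<in>UNIV. e $ k *\<^sub>R pd k f x)"
          by (simp add: scaleR_right.sum)
        also have "\<dots> = s n *\<^sub>R pd i f x" unfolding e_def by (subst axis_sum) (rule refl)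
        finally show ?thesis by (simp add: scaleR_conv_of_real)
      qed
      then have "norm (f (x + s n *\<^sub>R e) - f x - of_real (s n) * pd i f x) \<le> B * (s n)\<^sup>2"
        using B[of x "s n *\<^sub>R e"] ne by simp
      moreover have "f (x + s n *\<^sub>R e) - f x - of_real (s n) * pd i f x = of_real (s n) * (q n x - pd i f x)"
        using s(2)[of n] by (simp add: q_def field_simps)
      ultimately have "s n * norm (q n x - pd i f x) \<le> s n * (B * s n)"
        using s(2)[of n] by (simp add: norm_mult power2_eq_square mult_ac)
      then show ?thesis using s(2)[of n] by simp
    qed
    have 2: "(\<lambda>n. B * s n) \<longlonglongrightarrow> 0" using tendsto_mult_right_zero[OF s(1)] by simp
    have "(\<lambda>n. q n x - pd i f x) \<longlonglongrightarrow> 0"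
      by (rule Lim_null_comparison[OF always_eventually[OF allI[OF 1]] 2])
    then show ?thesis by (rule LIM_zero_cancel)
  qed
  have L1: "(\<lambda>n. ft (q n) \<xi>) \<longlonglongrightarrow> ft (pd i f) \<xi>"
    unfolding ft_def
  proof (rule integral_dominated_convergence[OF _ _ wi])
    show "(\<lambda>x. cis (x \<bullet> \<xi>) * pd i f x) \<in> borel_measurable lborel"
      using integrable_cis[OF schwartz_integrable[OF schwartz_pd[OF f]]] by (simp add: borel_measurable_integrable)
    show "(\<lambda>x. cis (x \<bullet> \<xi>) * q n x) \<in> borel_measurable lborel" for n by simp
    show "AE x in lborel. (\<lambda>n. cis (x \<bullet> \<xi>) * q n x) \<longlonglongrightarrow> cis (x \<bullet> \<xi>) * pd i f x"
      using qlim by (auto intro!: tendsto_intros)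
    show "AE x in lborel. norm (cis (x \<bullet> \<xi>) * q n x) \<le> w x" for n
      using qb by (simp add: norm_mult)
  qed
  have qn: "ft (q n) \<xi> = (cis (- s n * (\<xi> $ i)) - 1) / of_real (s n) * ft f \<xi>" for n
  proof -
    have tr: "(LINT x|lborel. cis (x \<bullet> \<xi>) * f (x + s n *\<^sub>R e)) = cis (- s n * (\<xi> $ i)) * ft f \<xi>"
    proof -
      have "(LINT x|lborel. cis (x \<bullet> \<xi>) * f (x + s n *\<^sub>R e))
         = (LINT x|lborel. cis (((x + s n *\<^sub>R e) - s n *\<^sub>R e) \<bullet> \<xi>) * f (x + s n *\<^sub>R e))" by simp
      also have "\<dots> = (LINT x|lborel. cis ((x - s n *\<^sub>R e) \<bullet> \<xi>) * f x)"
        by (rule lborel_integral_translate[of "\<lambda>x. cis ((x - s n *\<^sub>R e) \<bullet> \<xi>) * f x"]) measurable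
      also have "\<dots> = (LINT x|lborel. cis (- s n * (\<xi> $ i)) * (cis (x \<bullet> \<xi>) * f x))"
        by (intro Bochner_Integration.integral_cong)
          (auto simp: inner_diff_left e_def inner_axis' cis_mult mult.assoc[symmetric])
      finally show ?thesis by (simp add: ft_def)
    qed
    have fi: "integrable lborel f" using f by (rule schwartz_integrable)
    have fi': "integrable lborel (\<lambda>x. f (x + s n *\<^sub>R e))" using fi lborel_integrable_translate[OF fm] by simp
    have "ft (q n) \<xi> = (LINT x|lborel. (1 / of_real (s n)) * (cis (x \<bullet> \<xi>) * f (x + s n *\<^sub>R e) - cis (x \<bullet> \<xi>) * f x))"
      unfolding ft_def q_def by (intro Bochner_Integration.integral_cong) (auto simp: right_diff_distrib diff_divide_distrib)
    also have "\<dots> = (1 / of_real (s n)) * (cis (- s n * (\<xi> $ i)) * ft f \<xi> - ft f \<xi>)"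
      by (simp only: integral_mult_right_zero Bochner_Integration.integral_diff[OF integrable_cis[OF fi'] integrable_cis[OF fi]] tr)
        (simp add: ft_def)
    finally show ?thesis by (simp add: left_diff_distrib diff_divide_distrib)
  qed
  have L2: "(\<lambda>n. (cis (- s n * (\<xi> $ i)) - 1) / of_real (s n) * ft f \<xi>) \<longlonglongrightarrow> (- \<i> * of_real (\<xi> $ i)) * ft f \<xi>"
  proof (rule tendsto_mult_right)
    have 1: "norm ((cis (- s n * (\<xi> $ i)) - 1) / of_real (s n) - (- \<i> * of_real (\<xi> $ i))) \<le> s n * ((\<xi> $ i)\<^sup>2 / 2)" for n
    proof -
      have "(cis (- s n * (\<xi> $ i)) - 1) / of_real (s n) - (- \<i> * of_real (\<xi> $ i)) =
         (cis (- s n * (\<xi> $ i)) - 1 - \<i> * of_real (- s n * (\<xi> $ i))) / of_real (s n)"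
        using s(2)[of n] by (simp add: field_simps)
      also have "norm \<dots> \<le> ((- s n * (\<xi> $ i))\<^sup>2 / 2) / s n"
        unfolding norm_divide norm_of_real abs_of_pos[OF s(2)]
        by (rule divide_right_mono[OF cis_Taylor2]) (use s(2)[of n] in simp)
      also have "\<dots> = s n * ((\<xi> $ i)\<^sup>2 / 2)" using s(2)[of n] by (simp add: power2_eq_square)
      finally show ?thesis .
    qed
    have 2: "(\<lambda>n. s n * ((\<xi> $ i)\<^sup>2 / 2)) \<longlonglongrightarrow> 0" using tendsto_mult_left_zero[OF s(1)] by simp
    have "(\<lambda>n. (cis (- s n * (\<xi> $ i)) - 1) / of_real (s n) - (- \<i> * of_real (\<xi> $ i))) \<longlonglongrightarrow> 0"
      by (rule Lim_null_comparison[OF always_eventually[OF allI[OF 1]] 2])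
    then show "(\<lambda>n. (cis (- s n * (\<xi> $ i)) - 1) / of_real (s n)) \<longlonglongrightarrow> - \<i> * of_real (\<xi> $ i)" by (rule LIM_zero_cancel)
  qed
  show ?thesis using L1 L2 unfolding qn by (rule LIMSEQ_unique)
qed

text \<open>The second-order expansion of \<open>cis\<close> is integrated against \<open>f\<close>;
  the square of the inner product of x and v is paid by two powers of the weight, which
  \<open>f\<close> absorbs.\<close>

lemma has_derivative_ft:
  assumes f: "f \<in> schwartz"
  shows "(ft f has_derivative (\<lambda>v. \<Sum>i\<in>UNIV. v $ i *\<^sub>R ft (\<lambda>x. \<i> * (of_real (x $ i) * f x)) \<xi>)) (at \<xi>)"
proof (rule has_derivative_quadratic)
  fix v
  let ?g = "\<lambda>i x. \<i> * (of_real (x $ i) * f x)"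
  have fi: "integrable lborel f" using f by (rule schwartz_integrable)
  have gi: "integrable lborel (?g i)" for i
    by (intro schwartz_integrable schwartz_cmult schwartz_coord_mult f)
  have wi: "integrable lborel (\<lambda>x. (1 + norm x) ^ 2 * norm (f x))" using f by (rule schwartz_integrable_weight)
  have i1: "integrable lborel (\<lambda>x. cis (x \<bullet> \<xi>) * (\<Sum>i\<in>UNIV. v $ i *\<^sub>R ?g i x))"
    by (intro integrable_cis Bochner_Integration.integrable_sum integrable_scaleR_right gi)
  have "(\<Sum>i\<in>UNIV. v $ i *\<^sub>R ft (?g i) \<xi>) = (LINT x|lborel. cis (x \<bullet> \<xi>) * (\<Sum>i\<in>UNIV. v $ i *\<^sub>R ?g i x))"
    unfolding ft_def using integrable_cis[OF gi]
    by (simp add: sum_distrib_left Bochner_Integration.integral_sum)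
  then have "ft f (\<xi> + v) - ft f \<xi> - (\<Sum>i\<in>UNIV. v $ i *\<^sub>R ft (?g i) \<xi>) =
     (LINT x|lborel. cis (x \<bullet> (\<xi> + v)) * f x - cis (x \<bullet> \<xi>) * f x - cis (x \<bullet> \<xi>) * (\<Sum>i\<in>UNIV. v $ i *\<^sub>R ?g i x))"
    unfolding ft_def using integrable_cis[OF fi] i1 by simp
  also have "norm \<dots> \<le> (LINT x|lborel. (norm v)\<^sup>2 * ((1 + norm x) ^ 2 * norm (f x)))"
  proof (rule Bochner_Integration.integral_norm_bound_integral)
    show "integrable lborel (\<lambda>x. cis (x \<bullet> (\<xi> + v)) * f x - cis (x \<bullet> \<xi>) * f x - cis (x \<bullet> \<xi>) * (\<Sum>i\<in>UNIV. v $ i *\<^sub>R ?g i x))"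
      by (intro Bochner_Integration.integrable_diff integrable_cis fi i1)
    show "integrable lborel (\<lambda>x. (norm v)\<^sup>2 * ((1 + norm x) ^ 2 * norm (f x)))"
      using wi by (rule integrable_mult_right)
    fix x
    have "(\<Sum>i\<in>UNIV. v $ i *\<^sub>R ?g i x) = \<i> * of_real (x \<bullet> v) * f x"
      by (simp add: inner_vec_def sum_distrib_left sum_distrib_right scaleR_conv_of_real mult_ac)
    then have "cis (x \<bullet> (\<xi> + v)) * f x - cis (x \<bullet> \<xi>) * f x - cis (x \<bullet> \<xi>) * (\<Sum>i\<in>UNIV. v $ i *\<^sub>R ?g i x)
       = cis (x \<bullet> \<xi>) * (cis (x \<bullet> v) - 1 - \<i> * of_real (x \<bullet> v)) * f x"
      by (simp add: inner_add_right cis_mult[symmetric] algebra_simps)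
    also have "norm \<dots> \<le> (x \<bullet> v)\<^sup>2 / 2 * norm (f x)"
      using cis_Taylor2[of "x \<bullet> v"] by (simp only: norm_mult norm_cis mult_1_left) (rule mult_right_mono, auto)
    also have "\<dots> \<le> (norm v)\<^sup>2 * (1 + norm x) ^ 2 * norm (f x)"
    proof (rule mult_right_mono)
      have "(x \<bullet> v)\<^sup>2 \<le> (norm x * norm v)\<^sup>2"
        using Cauchy_Schwarz_ineq2[of x v] by (metis abs_ge_zero power2_abs power_mono)
      also have "\<dots> \<le> ((1 + norm x) * norm v)\<^sup>2" by (intro power_mono mult_right_mono) auto
      finally have "(x \<bullet> v)\<^sup>2 \<le> (norm v)\<^sup>2 * (1 + norm x) ^ 2" by (simp add: power_mult_distrib mult.commute)
      then show "(x \<bullet> v)\<^sup>2 / 2 \<le> (norm v)\<^sup>2 * (1 + norm x) ^ 2" using zero_le_power2[of "x \<bullet> v"] by linarith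
    qed simp
    finally show "norm (cis (x \<bullet> (\<xi> + v)) * f x - cis (x \<bullet> \<xi>) * f x - cis (x \<bullet> \<xi>) * (\<Sum>i\<in>UNIV. v $ i *\<^sub>R ?g i x))
       \<le> (norm v)\<^sup>2 * ((1 + norm x) ^ 2 * norm (f x))" by (simp only: mult.assoc)
  qed
  also have "\<dots> = (LINT x|lborel. (1 + norm x) ^ 2 * norm (f x)) * (norm v)\<^sup>2" by simp
  finally show "norm (ft f (\<xi> + v) - ft f \<xi> - (\<Sum>i\<in>UNIV. v $ i *\<^sub>R ft (?g i) \<xi>))
    \<le> (LINT x|lborel. (1 + norm x) ^ 2 * norm (f x)) * (norm v)\<^sup>2" .
qed

text \<open>A factor 1 + |xi| is at most 1 plus the sum of the |xi_i|, and multiplication by xi_i is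
  differentiation of \<open>f\<close> by \<open>ft_pd\<close>. The induction therefore ranges over
  all Schwartz functions at once.\<close>

lemma rapid_ft:
  assumes "f \<in> schwartz" shows "rapid (ft f)"
proof -
  have "\<forall>f \<in> schwartz. \<exists>C. \<forall>\<xi>::real^'a. (1 + norm \<xi>) ^ N * norm (ft f \<xi>) \<le> C" for N
  proof (induction N)
    case 0
    then show ?case using norm_ft_le[OF schwartz_integrable] by auto
  next
    case (Suc N)
    show ?case
    proof
      fix f :: "real^'a \<Rightarrow> complex" assume f: "f \<in> schwartz"
      obtain C where C: "\<And>\<xi>. (1 + norm \<xi>) ^ N * norm (ft f \<xi>) \<le> C" using Suc f by blast
      have "\<exists>D. \<forall>i. \<forall>\<xi>. (1 + norm \<xi>) ^ N * norm (ft (pd i f) \<xi>) \<le> D i"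
        using Suc schwartz_pd[OF f] by (intro choice) blast
      then obtain D where D: "\<And>i \<xi>. (1 + norm \<xi>) ^ N * norm (ft (pd i f) \<xi>) \<le> D i" by blast
      have "(1 + norm \<xi>) ^ Suc N * norm (ft f \<xi>) \<le> C + (\<Sum>i\<in>UNIV. D i)" for \<xi>
      proof -
        have "(1 + norm \<xi>) ^ Suc N * norm (ft f \<xi>) \<le> (1 + (\<Sum>i\<in>UNIV. \<bar>\<xi> $ i\<bar>)) * ((1 + norm \<xi>) ^ N * norm (ft f \<xi>))"
          using norm_le_l1_cart[of \<xi>] by (auto simp: mult.assoc intro!: mult_right_mono)
        also have "\<dots> = (1 + norm \<xi>) ^ N * norm (ft f \<xi>) + (\<Sum>i\<in>UNIV. (1 + norm \<xi>) ^ N * norm (ft (pd i f) \<xi>))"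
          unfolding ft_pd[OF f] distrib_right sum_distrib_right mult_1 by (simp add: norm_mult mult_ac)
        also have "\<dots> \<le> C + (\<Sum>i\<in>UNIV. D i)" by (intro add_mono sum_mono C D)
        finally show ?thesis .
      qed
      then show "\<exists>C. \<forall>\<xi>. (1 + norm \<xi>) ^ Suc N * norm (ft f \<xi>) \<le> C" by blast
    qed
  qed
  then show ?thesis using assms unfolding rapid_def by blast
qed

lemma schwartz_ft:
  assumes "f \<in> schwartz" shows "ft f \<in> schwartz"
proof (rule schwartz_coinduct)
  show "ft f \<in> ft ` schwartz" using assms by blast
  fix g :: "real^'a \<Rightarrow> complex" assume "g \<in> ft ` schwartz"
  then obtain u where u: "g = ft u" "u \<in> schwartz" by blast
  show "g differentiable (at x)" for x
    unfolding u(1) by (rule differentiableI[OF has_derivative_ft[OF u(2)]])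
  have "pd i g = ft (\<lambda>x. \<i> * (of_real (x $ i) * u x))" for i
    unfolding u(1) by (rule ext, subst pd_eqI[OF has_derivative_ft[OF u(2)]], subst axis_sum) (rule refl)
  then show "pd i g \<in> ft ` schwartz" for i
    using schwartz_cmult[OF schwartz_coord_mult[OF u(2)]] by blast
  show "rapid g" unfolding u(1) by (rule rapid_ft[OF u(2)])
qed

lemma schwartz_reflect: "f \<in> schwartz \<Longrightarrow> (\<lambda>x. f (- x)) \<in> schwartz"
  using schwartz_affine[of f "-1" 0] by simp

lemma schwartz_fourier: "f \<in> schwartz \<Longrightarrow> fourier f \<in> schwartz"
  using schwartz_reflect[OF schwartz_ft] unfolding fourier_ft[abs_def] .

subsection \<open>Convolution with a dilated kernel\<close>

text \<open>Convolution with the L1-normalised dilate of \<open>k\<close>, written with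
  \<open>h\<close> only in the argument of \<open>f\<close>. In this form \<open>h = 0\<close> makes
  sense and gives a multiple of \<open>f\<close>, and the dependence on \<open>h\<close> is
  Lipschitz there.\<close>

definition dconv :: "(real ^ 'n::finite \<Rightarrow> complex) \<Rightarrow> real \<Rightarrow> (real ^ 'n \<Rightarrow> complex) \<Rightarrow> real ^ 'n \<Rightarrow> complex" where
  "dconv k h f x = (LINT z|lborel. k z * f (x - h *\<^sub>R z))"

lemma integrable_dconv:
  assumes k: "k \<in> schwartz" and f: "f \<in> schwartz"
  shows "integrable lborel (\<lambda>z. k z * f (x - h *\<^sub>R z))"
proof -
  obtain C where C: "C \<ge> 0" "\<And>x. norm (f x) \<le> C" using schwartz_bounded[OF f] by blast
  have [measurable]: "k \<in> borel_measurable borel" "f \<in> borel_measurable borel" using k f by (auto intro: schwartz_borel)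
  show ?thesis
  proof (rule Bochner_Integration.integrable_bound)
    show "integrable lborel (\<lambda>z. C * norm (k z))" 
      by (intro integrable_mult_right integrable_norm schwartz_integrable k)
    show "AE z in lborel. norm (k z * f (x - h *\<^sub>R z)) \<le> norm (C * norm (k z))"
      using C mult_left_mono[OF C(2) norm_ge_zero] by (auto simp: norm_mult mult.commute[of C])
  qed simp
qed

lemma dconv_bound:
  assumes k: "k \<in> schwartz" "\<And>z. norm (u z) \<le> C * (1 + norm z) ^ M" "integrable lborel (\<lambda>z. k z * u z)"
  shows "norm (LINT z|lborel. k z * u z) \<le> C * (LINT z|lborel. (1 + norm z) ^ M * norm (k z))"
proof -
  have "norm (LINT z|lborel. k z * u z) \<le> (LINT z|lborel. C * ((1 + norm z) ^ M * norm (k z)))"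
  proof (rule Bochner_Integration.integral_norm_bound_integral[OF k(3)])
    show "integrable lborel (\<lambda>z. C * ((1 + norm z) ^ M * norm (k z)))"
      by (intro integrable_mult_right schwartz_integrable_weight k)
    show "norm (k z * u z) \<le> C * ((1 + norm z) ^ M * norm (k z))" for z
      using mult_left_mono[OF k(2)[of z] norm_ge_zero[of "k z"]] by (simp add: norm_mult mult_ac)
  qed
  then show ?thesis by simp
qed

lemma dconv_bound':
  assumes k: "k \<in> schwartz" "\<And>z. w * norm (u z) \<le> C * (1 + norm z) ^ M" "w \<ge> 0" "integrable lborel (\<lambda>z. k z * u z)"
  shows "w * norm (LINT z|lborel. k z * u z) \<le> C * (LINT z|lborel. (1 + norm z) ^ M * norm (k z))"
proof -
  have i: "integrable lborel (\<lambda>z. k z * (of_real w * u z))"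
    using integrable_mult_right[OF k(4), of "of_real w"] by (simp add: mult_ac)
  have "norm (LINT z|lborel. k z * (of_real w * u z)) \<le> C * (LINT z|lborel. (1 + norm z) ^ M * norm (k z))"
    by (rule dconv_bound[OF k(1) _ i]) (use k in \<open>auto simp: norm_mult\<close>)
  moreover have "(LINT z|lborel. k z * (of_real w * u z)) = of_real w * (LINT z|lborel. k z * u z)"
    by (subst integral_mult_right_zero[symmetric]) (simp add: mult_ac)
  ultimately show ?thesis using k(3) by (simp add: norm_mult)
qed

lemma weight_dilate:
  fixes z :: "'a::real_normed_vector"
  shows "1 + \<bar>h\<bar> * norm z \<le> (1 + \<bar>h\<bar>) * (1 + norm z)"
  by (simp add: algebra_simps)

lemma rapid_dconv:
  assumes k: "k \<in> schwartz" and f: "f \<in> schwartz" shows "rapid (dconv k h f)"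
  unfolding rapid_def
proof
  fix N
  obtain C where C: "C \<ge> 0" "\<And>x. (1 + norm x) ^ N * norm (f x) \<le> C" using rapidE[OF schwartz_rapid[OF f]] by blast
  let ?I = "LINT z|lborel. (1 + norm z) ^ N * norm (k z)"
  have "(1 + norm x) ^ N * norm (dconv k h f x) \<le> (C * (1 + \<bar>h\<bar>) ^ N) * ?I" for x
    unfolding dconv_def
  proof (rule dconv_bound'[OF k _ _ integrable_dconv[OF k f]])
    fix z
    have "1 + norm x \<le> (1 + norm (x - h *\<^sub>R z)) * (1 + norm (h *\<^sub>R z))"
      using weight_shift[of "x - h *\<^sub>R z" "h *\<^sub>R z"] by simp
    also have "\<dots> \<le> (1 + norm (x - h *\<^sub>R z)) * ((1 + \<bar>h\<bar>) * (1 + norm z))"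
      using weight_dilate[of h z] by (intro mult_left_mono) auto
    finally have "(1 + norm x) ^ N \<le> ((1 + norm (x - h *\<^sub>R z)) * ((1 + \<bar>h\<bar>) * (1 + norm z))) ^ N"
      by (intro power_mono) auto
    then have "(1 + norm x) ^ N * norm (f (x - h *\<^sub>R z)) \<le>
       ((1 + \<bar>h\<bar>) * (1 + norm z)) ^ N * ((1 + norm (x - h *\<^sub>R z)) ^ N * norm (f (x - h *\<^sub>R z)))"
      using mult_right_mono[of "(1 + norm x) ^ N" "((1 + norm (x - h *\<^sub>R z)) * ((1 + \<bar>h\<bar>) * (1 + norm z))) ^ N" "norm (f (x - h *\<^sub>R z))"]
      by (simp add: power_mult_distrib mult_ac)
    also have "\<dots> \<le> ((1 + \<bar>h\<bar>) * (1 + norm z)) ^ N * C" by (intro mult_left_mono C(2)) auto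
    finally show "(1 + norm x) ^ N * norm (f (x - h *\<^sub>R z)) \<le> C * (1 + \<bar>h\<bar>) ^ N * (1 + norm z) ^ N"
      by (simp add: power_mult_distrib mult_ac)
  qed simp
  then show "\<exists>C. \<forall>x. (1 + norm x) ^ N * norm (dconv k h f x) \<le> C" by blast
qed

lemma dconv_Lipschitz:
  assumes k: "k \<in> schwartz" and f: "f \<in> schwartz"
  obtains C where "C \<ge> 0"
    "\<And>x h h'. \<bar>h\<bar> \<le> R \<Longrightarrow> \<bar>h'\<bar> \<le> R \<Longrightarrow> (1 + norm x) ^ N * norm (dconv k h f x - dconv k h' f x) \<le> C * \<bar>h - h'\<bar>"
proof -
  obtain C where C: "C \<ge> 0" "\<And>x u v. (1 + norm x) ^ N * norm (f (x + u) - f (x + v)) \<le> C * norm (u - v) * (1 + max (norm u) (norm v)) ^ N"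
    using schwartz_mean_value[OF f] by blast
  \<comment> \<open>One power more than \<open>N\<close>: besides the \<open>N\<close>-th power of
    the weight, the mean value estimate contributes |h - h'| times the norm of z.\<close>
  define I where "I = (LINT z|lborel. (1 + norm z) ^ Suc N * norm (k z))"
  have I0: "I \<ge> 0" unfolding I_def by (intro integral_nonneg_AE) auto
  show thesis
  proof
    show "C * (1 + \<bar>R\<bar>) ^ N * I \<ge> 0" using C(1) I0 by simp
    fix x :: "real^'a" and h h' assume h: "\<bar>h\<bar> \<le> R" "\<bar>h'\<bar> \<le> R"
    have "dconv k h f x - dconv k h' f x = (LINT z|lborel. k z * (f (x - h *\<^sub>R z) - f (x - h' *\<^sub>R z)))"
      unfolding dconv_def by (simp add: right_diff_distrib integrable_dconv[OF k f])
    also have "(1 + norm x) ^ N * norm \<dots> \<le> (C * (1 + \<bar>R\<bar>) ^ N * \<bar>h - h'\<bar>) * I"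
      unfolding I_def
    proof (rule dconv_bound'[OF k])
      fix z :: "real^'a"
      have "norm ((- h) *\<^sub>R z - (- h') *\<^sub>R z) = norm ((h - h') *\<^sub>R z)"
        by (simp add: scaleR_diff_left norm_minus_commute)
      then have n: "norm ((- h) *\<^sub>R z - (- h') *\<^sub>R z) = \<bar>h - h'\<bar> * norm z" by simp
      have "max (norm ((- h) *\<^sub>R z)) (norm ((- h') *\<^sub>R z)) \<le> \<bar>R\<bar> * norm z"
        using h by (auto intro!: mult_right_mono)
      then have m: "1 + max (norm ((- h) *\<^sub>R z)) (norm ((- h') *\<^sub>R z)) \<le> (1 + \<bar>R\<bar>) * (1 + norm z)"
        using weight_dilate[of R z] by linarith
      have "(1 + norm x) ^ N * norm (f (x - h *\<^sub>R z) - f (x - h' *\<^sub>R z))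
         \<le> C * (\<bar>h - h'\<bar> * norm z) * (1 + max (norm ((- h) *\<^sub>R z)) (norm ((- h') *\<^sub>R z))) ^ N"
        using C(2)[of x "(- h) *\<^sub>R z" "(- h') *\<^sub>R z"] unfolding n by simp
      also have "\<dots> \<le> C * (\<bar>h - h'\<bar> * (1 + norm z)) * ((1 + \<bar>R\<bar>) * (1 + norm z)) ^ N"
        using C(1) m by (intro mult_mono power_mono mult_left_mono) (auto simp: le_max_iff_disj)
      finally show "(1 + norm x) ^ N * norm (f (x - h *\<^sub>R z) - f (x - h' *\<^sub>R z))
         \<le> C * (1 + \<bar>R\<bar>) ^ N * \<bar>h - h'\<bar> * (1 + norm z) ^ Suc N" by (simp add: power_mult_distrib mult_ac)
    qed (auto simp: right_diff_distrib integrable_dconv[OF k f])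
    finally show "(1 + norm x) ^ N * norm (dconv k h f x - dconv k h' f x) \<le> C * (1 + \<bar>R\<bar>) ^ N * I * \<bar>h - h'\<bar>"
      by (simp add: mult_ac)
  qed
qed

lemma has_derivative_dconv:
  assumes k: "k \<in> schwartz" and f: "f \<in> schwartz"
  shows "(dconv k h f has_derivative (\<lambda>v. \<Sum>i\<in>UNIV. v $ i *\<^sub>R dconv k h (pd i f) x)) (at x)"
proof -
  obtain C where C: "C \<ge> 0" "\<And>x v. norm (f (x + v) - f x - (\<Sum>i\<in>UNIV. v $ i *\<^sub>R pd i f x)) \<le> C * (norm v)\<^sup>2"
    using schwartz_Taylor[OF f] by blast
  show ?thesis
  proof (rule has_derivative_quadratic)
    fix v
    let ?u = "\<lambda>z. f (x + v - h *\<^sub>R z) - f (x - h *\<^sub>R z) - (\<Sum>i\<in>UNIV. v $ i *\<^sub>R pd i f (x - h *\<^sub>R z))"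
    note i = integrable_dconv[OF k f] integrable_dconv[OF k schwartz_pd[OF f]]
    have isum: "integrable lborel (\<lambda>z. k z * (\<Sum>i\<in>UNIV. v $ i *\<^sub>R pd i f (x - h *\<^sub>R z)))"
      using i(2) by (simp add: sum_distrib_left)
    have "(\<Sum>i\<in>UNIV. v $ i *\<^sub>R dconv k h (pd i f) x) = (LINT z|lborel. k z * (\<Sum>i\<in>UNIV. v $ i *\<^sub>R pd i f (x - h *\<^sub>R z)))"
      unfolding dconv_def using i(2) by (simp add: sum_distrib_left Bochner_Integration.integral_sum)
    then have "dconv k h f (x + v) - dconv k h f x - (\<Sum>i\<in>UNIV. v $ i *\<^sub>R dconv k h (pd i f) x) = (LINT z|lborel. k z * ?u z)"
      using i(1) isum by (simp add: dconv_def right_diff_distrib)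
    also have "norm \<dots> \<le> C * (norm v)\<^sup>2 * (LINT z|lborel. (1 + norm z) ^ 0 * norm (k z))"
    proof (rule dconv_bound[OF k])
      show "norm (?u z) \<le> C * (norm v)\<^sup>2 * (1 + norm z) ^ 0" for z
        using C(2)[of "x - h *\<^sub>R z" v] by (simp add: algebra_simps)
      show "integrable lborel (\<lambda>z. k z * ?u z)" using i(1) isum by (simp add: right_diff_distrib)
    qed
    finally show "norm (dconv k h f (x + v) - dconv k h f x - (\<Sum>i\<in>UNIV. v $ i *\<^sub>R dconv k h (pd i f) x))
       \<le> C * (LINT z|lborel. (1 + norm z) ^ 0 * norm (k z)) * (norm v)\<^sup>2" by (simp add: mult_ac)
  qed
qed

lemma pd_dconv: "k \<in> schwartz \<Longrightarrow> f \<in> schwartz \<Longrightarrow> pd i (dconv k h f) = dconv k h (pd i f)"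
  by (rule ext, subst pd_eqI[OF has_derivative_dconv], assumption, assumption, subst axis_sum) (rule refl)

lemma schwartz_dconv:
  assumes k: "k \<in> schwartz" and f: "f \<in> schwartz" shows "dconv k h f \<in> schwartz"
proof (rule schwartz_coinduct)
  show "dconv k h f \<in> dconv k h ` schwartz" using f by blast
  fix g :: "real^'a \<Rightarrow> complex" assume "g \<in> dconv k h ` schwartz"
  then obtain u where u: "g = dconv k h u" "u \<in> schwartz" by blast
  show "g differentiable (at x)" for x
    unfolding u(1) by (rule differentiableI[OF has_derivative_dconv[OF k u(2)]])
  show "pd i g \<in> dconv k h ` schwartz" for i unfolding u(1) pd_dconv[OF k u(2)] using schwartz_pd[OF u(2)] by blast
  show "rapid g" unfolding u(1) by (rule rapid_dconv[OF k u(2)])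
qed

lemma partials_dconv:
  "k \<in> schwartz \<Longrightarrow> f \<in> schwartz \<Longrightarrow> partials is (dconv k h f) = dconv k h (partials is f)"
  by (induction "is") (simp_all add: partials_Cons pd_dconv schwartz_partials del: partials.simps(2))

lemma dconv_add:
  "k \<in> schwartz \<Longrightarrow> f \<in> schwartz \<Longrightarrow> g \<in> schwartz \<Longrightarrow> dconv k h (\<lambda>x. f x + g x) = (\<lambda>x. dconv k h f x + dconv k h g x)"
  unfolding dconv_def by (simp add: distrib_left integrable_dconv)

lemma dconv_cmult: "dconv k h (\<lambda>x. c * f x) = (\<lambda>x. c * dconv k h f x)"
  unfolding dconv_def by (simp add: mult.left_commute[of _ c])

lemma integrable_dconv_pair:
  assumes k: "k \<in> schwartz" and f: "f \<in> schwartz"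
  shows "integrable (lborel \<Otimes>\<^sub>M lborel) (\<lambda>(z, x). k z * f (x - h *\<^sub>R z))"
proof -
  have [measurable]: "k \<in> borel_measurable borel" "f \<in> borel_measurable borel" using k f by (auto intro: schwartz_borel)
  have fi: "integrable lborel f" using f by (rule schwartz_integrable)
  have tr: "(LINT x|lborel. norm (f (x - h *\<^sub>R z))) = L1 f" for z
    unfolding L1_def using lborel_integral_translate[of "\<lambda>x. norm (f x)" "- h *\<^sub>R z"] by simp
  have tri: "integrable lborel (\<lambda>x. f (x - h *\<^sub>R z))" for z
    using lborel_integrable_translate[of f "- h *\<^sub>R z"] fi by simp
  show ?thesis
  proof (rule lborel_pair.Fubini_integrable)
    show "integrable lborel (\<lambda>z. LINT x|lborel. norm (case (z, x) of (z, x) \<Rightarrow> k z * f (x - h *\<^sub>R z)))"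
      using schwartz_integrable[OF k] by (simp add: norm_mult tr)
    show "AE z in lborel. integrable lborel (\<lambda>x. case (z, x) of (z, x) \<Rightarrow> k z * f (x - h *\<^sub>R z))"
      using tri by simp
  qed measurable
qed

text \<open>Young's inequality in L1. The bound does not see \<open>h\<close>, and this alone makes
  the block estimates uniform in the frequency scale and in time.\<close>

lemma L1_dconv_le:
  assumes k: "k \<in> schwartz" and f: "f \<in> schwartz"
  shows "L1 (dconv k h f) \<le> L1 k * L1 f"
proof -
  have [measurable]: "k \<in> borel_measurable borel" "f \<in> borel_measurable borel" using k f by (auto intro: schwartz_borel)
  have tr: "(LINT x|lborel. norm (f (x - h *\<^sub>R z))) = L1 f" for z
    unfolding L1_def using lborel_integral_translate[of "\<lambda>x. norm (f x)" "- h *\<^sub>R z"] by simp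
  have i: "integrable (lborel \<Otimes>\<^sub>M lborel) (\<lambda>(z, x). norm (k z * f (x - h *\<^sub>R z)))"
    using integrable_norm[OF integrable_dconv_pair[OF k f]] by (simp add: case_prod_unfold)
  have "L1 (dconv k h f) \<le> (LINT x|lborel. (LINT z|lborel. norm (k z * f (x - h *\<^sub>R z))))"
    unfolding L1_def
  proof (rule integral_mono)
    show "integrable lborel (\<lambda>x. norm (dconv k h f x))"
      by (intro integrable_norm schwartz_integrable schwartz_dconv k f)
    show "integrable lborel (\<lambda>x. LINT z|lborel. norm (k z * f (x - h *\<^sub>R z)))"
      by (rule lborel_pair.integrable_snd[OF i])
    show "norm (dconv k h f x) \<le> (LINT z|lborel. norm (k z * f (x - h *\<^sub>R z)))" for x
      unfolding dconv_def by (rule integral_norm_bound)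
  qed
  also have "\<dots> = (LINT z|lborel. (LINT x|lborel. norm (k z * f (x - h *\<^sub>R z))))"
    by (rule lborel_pair.Fubini_integral[OF i])
  also have "\<dots> = L1 k * L1 f" by (simp add: norm_mult tr) (simp add: L1_def)
  finally show ?thesis .
qed

lemma ft_dconv:
  assumes k: "k \<in> schwartz" and f: "f \<in> schwartz"
  shows "ft (dconv k h f) \<xi> = ft k (h *\<^sub>R \<xi>) * ft f \<xi>"
proof -
  have [measurable]: "k \<in> borel_measurable borel" "f \<in> borel_measurable borel" using k f by (auto intro: schwartz_borel)
  have i: "integrable (lborel \<Otimes>\<^sub>M lborel) (\<lambda>(z, x). cis (x \<bullet> \<xi>) * (k z * f (x - h *\<^sub>R z)))"
    by (rule Bochner_Integration.integrable_bound[OF integrable_dconv_pair[OF k f, of h]]) (auto simp: norm_mult)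
  have "ft (dconv k h f) \<xi> = (LINT x|lborel. (LINT z|lborel. cis (x \<bullet> \<xi>) * (k z * f (x - h *\<^sub>R z))))"
    unfolding ft_def dconv_def by simp
  also have "\<dots> = (LINT z|lborel. (LINT x|lborel. cis (x \<bullet> \<xi>) * (k z * f (x - h *\<^sub>R z))))"
    by (rule lborel_pair.Fubini_integral[OF i])
  also have "\<dots> = (LINT z|lborel. cis (z \<bullet> (h *\<^sub>R \<xi>)) * k z * ft f \<xi>)"
  proof (intro Bochner_Integration.integral_cong refl)
    fix z
    have "(LINT x|lborel. cis (x \<bullet> \<xi>) * (k z * f (x - h *\<^sub>R z))) =
      (LINT x|lborel. cis (((x - h *\<^sub>R z) + h *\<^sub>R z) \<bullet> \<xi>) * (k z * f (x - h *\<^sub>R z)))" by simp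
    also have "\<dots> = (LINT x|lborel. cis ((x + h *\<^sub>R z) \<bullet> \<xi>) * (k z * f x))"
      using lborel_integral_translate[of "\<lambda>x. cis ((x + h *\<^sub>R z) \<bullet> \<xi>) * (k z * f x)" "- h *\<^sub>R z"] by simp
    also have "\<dots> = (LINT x|lborel. (cis (z \<bullet> (h *\<^sub>R \<xi>)) * k z) * (cis (x \<bullet> \<xi>) * f x))"
      by (intro Bochner_Integration.integral_cong) (auto simp: inner_add_left cis_mult[symmetric] mult_ac)
    finally show "(LINT x|lborel. cis (x \<bullet> \<xi>) * (k z * f (x - h *\<^sub>R z))) = cis (z \<bullet> (h *\<^sub>R \<xi>)) * k z * ft f \<xi>"
      by (simp add: ft_def)
  qed
  also have "\<dots> = ft k (h *\<^sub>R \<xi>) * ft f \<xi>" by (simp add: ft_def)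
  finally show ?thesis .
qed

subsection \<open>Gaussians and Fourier inversion\<close>

text \<open>The density is normal with variance 2. The substitution t = sqrt 2 x turns the integral
  into the characteristic function of the standard normal distribution at sqrt 2 s.\<close>

lemma gauss_ft_real:
  fixes s :: real
  shows "integrable lborel (\<lambda>t. cis (t * s) * of_real (exp (- (t\<^sup>2 / 4)) / sqrt (4 * pi)))"
    and "(LINT t|lborel. cis (t * s) * of_real (exp (- (t\<^sup>2 / 4)) / sqrt (4 * pi))) = of_real (exp (- s\<^sup>2))"
proof -
  have d: "exp (- (t\<^sup>2 / 4)) / sqrt (4 * pi) = normal_density 0 (sqrt 2) t" for t
    by (simp add: normal_density_def)
  have "integrable lborel (\<lambda>t. complex_of_real (normal_density 0 (sqrt 2) t))"
    by (intro integrable_of_real integrable_normal_density) simp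
  from integrable_cis[OF this, of s]
  show "integrable lborel (\<lambda>t. cis (t * s) * of_real (exp (- (t\<^sup>2 / 4)) / sqrt (4 * pi)))" unfolding d by simp
  have sq: "sqrt 2 / sqrt (4 * pi) = 1 / sqrt (2 * pi)" by (simp add: real_sqrt_mult real_sqrt_divide[symmetric] field_simps)
  have "(LINT t|lborel. cis (t * s) * of_real (exp (- (t\<^sup>2 / 4)) / sqrt (4 * pi))) =
      sqrt 2 *\<^sub>R (LINT x|lborel. cis ((sqrt 2 * x) * s) * of_real (exp (- ((sqrt 2 * x)\<^sup>2 / 4)) / sqrt (4 * pi)))"
    using lborel_integral_real_affine[of "sqrt 2" "\<lambda>t. cis (t * s) * complex_of_real (exp (- (t\<^sup>2 / 4)) / sqrt (4 * pi))" 0] by simp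
  also have "\<dots> = (LINT x|lborel. sqrt 2 *\<^sub>R (cis ((sqrt 2 * x) * s) * of_real (exp (- ((sqrt 2 * x)\<^sup>2 / 4)) / sqrt (4 * pi))))"
    by simp
  also have "\<dots> = (LINT x|lborel. std_normal_density x *\<^sub>R cis ((sqrt 2 * s) * x))"
  proof (intro Bochner_Integration.integral_cong refl)
    fix x
    have "sqrt 2 * (exp (- ((sqrt 2 * x)\<^sup>2 / 4)) / sqrt (4 * pi)) = (sqrt 2 / sqrt (4 * pi)) * exp (- x\<^sup>2 / 2)"
      by (simp add: power_mult_distrib)
    also have "\<dots> = std_normal_density x" unfolding sq by (simp add: std_normal_density_def)
    finally show "sqrt 2 *\<^sub>R (cis ((sqrt 2 * x) * s) * of_real (exp (- ((sqrt 2 * x)\<^sup>2 / 4)) / sqrt (4 * pi))) =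
      std_normal_density x *\<^sub>R cis ((sqrt 2 * s) * x)"
    proof -
      assume e: "sqrt 2 * (exp (- ((sqrt 2 * x)\<^sup>2 / 4)) / sqrt (4 * pi)) = std_normal_density x"
      have "sqrt 2 *\<^sub>R (c * complex_of_real y) = (sqrt 2 * y) *\<^sub>R c" for c y
        by (simp add: scaleR_conv_of_real)
      then have "sqrt 2 *\<^sub>R (cis ((sqrt 2 * x) * s) * of_real (exp (- ((sqrt 2 * x)\<^sup>2 / 4)) / sqrt (4 * pi)))
        = std_normal_density x *\<^sub>R cis ((sqrt 2 * x) * s)" by (simp only: e)
      then show ?thesis by (simp only: mult_ac)
    qed
  qed
  also have "\<dots> = char std_normal_distribution (sqrt 2 * s)"
    unfolding char_def by (subst integral_density) (auto simp: cis_conv_exp mult_ac)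
  also have "\<dots> = of_real (exp (- s\<^sup>2))"
    unfolding char_std_normal_distribution by (simp add: power_mult_distrib)
  finally show "(LINT t|lborel. cis (t * s) * of_real (exp (- (t\<^sup>2 / 4)) / sqrt (4 * pi))) = of_real (exp (- s\<^sup>2))" .
qed

text \<open>Time 1 suffices: by parabolic scaling, the heat operator at time r is
  \<open>dconv gk (sqrt r)\<close>, see \<open>heat_eq_dconv\<close>.\<close>

definition gk :: "real ^ 'n::finite \<Rightarrow> complex" where
  "gk x = of_real (heat_kernel 1 x)"

lemma gk_eq: "gk (x::real^'n::finite) = of_real ((4 * pi) powr (- (real CARD('n) / 2)) * exp (- ((norm x)\<^sup>2 / 4)))"
  by (simp add: gk_def heat_kernel_def)

lemma powr_neg_half: "(4 * pi) powr (- (real n / 2)) = (1 / sqrt (4 * pi)) ^ n"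
proof -
  have "sqrt (4 * pi) = exp (ln (4 * pi) / 2)"
    using powr_half_sqrt[of "4 * pi"] by (simp add: powr_def)
  then have "1 / sqrt (4 * pi) = exp (- (ln (4 * pi) / 2))" by (simp add: exp_minus inverse_eq_divide)
  then have "(1 / sqrt (4 * pi)) ^ n = exp (real n * (- (ln (4 * pi) / 2)))" by (simp only: exp_of_nat_mult)
  then show ?thesis by (simp add: powr_def)
qed

text \<open>Polynomials times the Gaussian. Closed under \<open>pd\<close>, they form the invariant
  set that puts \<open>gk\<close> into the Schwartz class.\<close>

inductive_set gpoly :: "(real ^ 'n::finite \<Rightarrow> complex) set" where
  gk: "gk \<in> gpoly"
| add: "f \<in> gpoly \<Longrightarrow> g \<in> gpoly \<Longrightarrow> (\<lambda>x. f x + g x) \<in> gpoly"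
| cmult: "f \<in> gpoly \<Longrightarrow> (\<lambda>x. c * f x) \<in> gpoly"
| coord: "f \<in> gpoly \<Longrightarrow> (\<lambda>x. of_real (x $ i) * f x) \<in> gpoly"

lemma has_derivative_gk: "(gk has_derivative (\<lambda>v. of_real (- (x \<bullet> v) / 2) * gk x)) (at (x::real^'n::finite))"
proof -
  let ?c = "(4 * pi) powr (- (real CARD('n) / 2))"
  have "((\<lambda>y::real^'n. ?c * exp (- ((norm y)\<^sup>2 / 4))) has_derivative
    (\<lambda>v. ?c * (exp (- ((norm x)\<^sup>2 / 4)) * (- (2 * (x \<bullet> v) / 4))))) (at x)"
    unfolding power2_norm_eq_inner by (auto intro!: derivative_eq_intros simp: inner_commute)
  from bounded_linear.has_derivative[OF bounded_linear_of_real[where 'a=complex] this]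
  show ?thesis unfolding gk_eq[abs_def] by (simp add: mult_ac)
qed

lemma rapid_gk: "rapid (gk :: real^'n::finite \<Rightarrow> complex)"
  unfolding rapid_def
proof
  fix N
  \<comment> \<open>The successor keeps the divisor nonzero in (1 + y / M)^M <= exp y, also for N =
    0.\<close>
  define M where "M = Suc N"
  let ?c = "(4 * pi) powr (- (real CARD('n) / 2))"
  have "(1 + norm x) ^ N * norm (gk x) \<le> ?c * (8 * real M) ^ M" for x :: "real^'n"
  proof -
    let ?r = "norm x"
    have "(1 + ?r)\<^sup>2 \<le> 2 * (1 + ?r\<^sup>2)" using zero_le_power2[of "1 - ?r"] by (simp add: power2_eq_square algebra_simps)
    also have "\<dots> \<le> 8 * real M * (1 + ?r\<^sup>2 / 4 / real M)" by (simp add: M_def field_simps)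
    finally have "((1 + ?r)\<^sup>2) ^ M \<le> (8 * real M * (1 + ?r\<^sup>2 / 4 / real M)) ^ M" by (intro power_mono) auto
    also have "\<dots> = (8 * real M) ^ M * (1 + ?r\<^sup>2 / 4 / real M) ^ M" by (rule power_mult_distrib)
    also have "\<dots> \<le> (8 * real M) ^ M * exp (?r\<^sup>2 / 4 / real M) ^ M"
      by (intro mult_left_mono power_mono exp_ge_add_one_self) auto
    also have "exp (?r\<^sup>2 / 4 / real M) ^ M = exp (?r\<^sup>2 / 4)" by (subst exp_of_nat_mult[symmetric]) (simp add: M_def del: of_nat_Suc)
    finally have 1: "(1 + ?r) ^ (2 * M) \<le> (8 * real M) ^ M * exp (?r\<^sup>2 / 4)" by (simp add: power_mult)
    have "(1 + ?r) ^ N \<le> (1 + ?r) ^ (2 * M)" by (rule power_increasing) (auto simp: M_def)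
    with 1 have 2: "(1 + ?r) ^ N \<le> (8 * real M) ^ M * exp (?r\<^sup>2 / 4)" by linarith
    have "(1 + ?r) ^ N * norm (gk x) = ?c * ((1 + ?r) ^ N * exp (- (?r\<^sup>2 / 4)))"
      by (simp add: gk_eq norm_mult)
    also have "\<dots> \<le> ?c * ((8 * real M) ^ M * exp (?r\<^sup>2 / 4) * exp (- (?r\<^sup>2 / 4)))"
      using 2 by (intro mult_left_mono mult_right_mono) auto
    also have "\<dots> = ?c * (8 * real M) ^ M" by (simp add: exp_minus field_simps)
    finally show ?thesis .
  qed
  then show "\<exists>C. \<forall>x::real^'n. (1 + norm x) ^ N * norm (gk x) \<le> C" by blast
qed

lemma gpoly_props:
  fixes f :: "real^'n::finite \<Rightarrow> complex"
  assumes "f \<in> gpoly"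
  shows "(\<forall>x. f differentiable (at x)) \<and> (\<forall>i. pd i f \<in> gpoly) \<and> rapid f"
  using assms
proof induction
  case gk
  have "pd i gk = (\<lambda>x::real^'n. (- 1/2) * (of_real (x $ i) * gk x))" for i :: 'n
    by (rule ext, subst pd_eqI[OF has_derivative_gk]) (simp add: inner_axis)
  then have "pd i gk \<in> gpoly" for i :: 'n
    by (simp only:) (intro gpoly.cmult gpoly.coord gpoly.gk)
  then show ?case
    using has_derivative_gk rapid_gk by (auto intro: differentiableI)
next
  case (add f g)
  then have D: "((\<lambda>x. f x + g x) has_derivative (\<lambda>w. (\<Sum>i\<in>UNIV. w $ i *\<^sub>R pd i f x) + (\<Sum>i\<in>UNIV. w $ i *\<^sub>R pd i g x))) (at x)" for x
    by (intro has_derivative_add has_derivative_pd) auto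
  have "pd i (\<lambda>x. f x + g x) = (\<lambda>x. pd i f x + pd i g x)" for i
    by (rule ext, subst pd_eqI[OF D], unfold axis_sum) (rule refl)
  with D add show ?case by (auto intro: differentiableI gpoly.add rapid_add)
next
  case (cmult f c)
  then have D: "((\<lambda>x. c * f x) has_derivative (\<lambda>w. c * (\<Sum>i\<in>UNIV. w $ i *\<^sub>R pd i f x))) (at x)" for x
    by (intro has_derivative_mult_right has_derivative_pd) auto
  have "pd i (\<lambda>x. c * f x) = (\<lambda>x. c * pd i f x)" for i
    by (rule ext, subst pd_eqI[OF D], unfold axis_sum) (rule refl)
  with D cmult show ?case by (auto intro: differentiableI gpoly.cmult rapid_cmult)
next
  case (coord f i)
  have "((\<lambda>x. complex_of_real (x $ i)) has_derivative (\<lambda>w. of_real (w $ i))) (at x)" for x :: "real^'n"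
    by (intro bounded_linear.has_derivative[OF bounded_linear_of_real] bounded_linear.has_derivative[OF bounded_linear_vec_nth] has_derivative_ident)
  from has_derivative_mult[OF this has_derivative_pd[of f]] coord
  have D: "((\<lambda>x. of_real (x $ i) * f x) has_derivative (\<lambda>w. of_real (x $ i) * (\<Sum>k\<in>UNIV. w $ k *\<^sub>R pd k f x) + of_real (w $ i) * f x)) (at x)" for x
    by blast
  have "pd k (\<lambda>x. of_real (x $ i) * f x) = (\<lambda>x. of_real (x $ i) * pd k f x + (if k = i then 1 else 0) * f x)" for k
    by (rule ext, subst pd_eqI[OF D], unfold axis_sum) (simp add: axis_def)
  moreover have "(\<lambda>x. of_real (x $ i) * pd k f x + c * f x) \<in> gpoly" for k c
    using coord by (intro gpoly.add gpoly.coord gpoly.cmult) auto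
  ultimately have "pd k (\<lambda>x. of_real (x $ i) * f x) \<in> gpoly" for k by simp
  moreover have "(\<lambda>x. of_real (x $ i) * f x) differentiable (at x)" for x using D by (rule differentiableI)
  ultimately show ?case using coord rapid_coord_mult by blast
qed

lemma schwartz_gk: "gk \<in> schwartz"
  by (rule schwartz_coinduct[where A = gpoly]) (use gpoly_props in \<open>auto intro: gpoly.gk\<close>)

lemma ft_gk: "ft gk \<xi> = of_real (exp (- (norm \<xi>)\<^sup>2))" for \<xi> :: "real^'n::finite"
proof -
  let ?f = "\<lambda>b t. cis (t * (\<xi> \<bullet> b)) * of_real (exp (- (t\<^sup>2 / 4)) / sqrt (4 * pi))"
  have card: "card (Basis :: (real^'n) set) = CARD('n)" by simp
  have "cis (x \<bullet> \<xi>) * gk x = (\<Prod>b\<in>Basis. ?f b (x \<bullet> b))" for x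
  proof -
    have "(\<Prod>b\<in>Basis. cis (x \<bullet> b * (\<xi> \<bullet> b))) = cis (x \<bullet> \<xi>)"
      by (subst euclidean_inner) (simp add: cis_conv_exp exp_sum sum_distrib_left)
    moreover have "(\<Prod>b\<in>(Basis :: (real^'n) set). exp (- ((x \<bullet> b)\<^sup>2 / 4)) / sqrt (4 * pi)) =
       (4 * pi) powr (- (real CARD('n) / 2)) * exp (- ((norm x)\<^sup>2 / 4))"
    proof -
      have "(norm x)\<^sup>2 = (\<Sum>b\<in>Basis. (x \<bullet> b)\<^sup>2)"
        unfolding power2_norm_eq_inner by (subst euclidean_inner) (simp add: power2_eq_square)
      then have "exp (- ((norm x)\<^sup>2 / 4)) = (\<Prod>b\<in>Basis. exp (- ((x \<bullet> b)\<^sup>2 / 4)))"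
        by (simp add: exp_sum[symmetric] sum_divide_distrib sum_negf)
      moreover have "(\<Prod>b\<in>(Basis :: (real^'n) set). 1 / sqrt (4 * pi)) = (4 * pi) powr (- (real CARD('n) / 2))"
        unfolding powr_neg_half prod_constant card ..
      moreover have "(\<Prod>b\<in>(Basis :: (real^'n) set). exp (- ((x \<bullet> b)\<^sup>2 / 4)) / sqrt (4 * pi)) =
         (\<Prod>b\<in>(Basis :: (real^'n) set). 1 / sqrt (4 * pi) * exp (- ((x \<bullet> b)\<^sup>2 / 4)))" by simp
      ultimately show ?thesis by (simp only: prod.distrib)
    qed
    ultimately show ?thesis unfolding gk_eq by (simp only: prod.distrib of_real_prod[symmetric])
  qed
  then have "ft gk \<xi> = (LINT x|lborel. (\<Prod>b\<in>Basis. ?f b (x \<bullet> b)))" unfolding ft_def by simp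
  also have "\<dots> = (\<Prod>b\<in>Basis. (LINT t|lborel. ?f b t))"
    by (rule lborel_integral_prod(2)) (rule gauss_ft_real(1))
  also have "\<dots> = (\<Prod>b\<in>(Basis :: (real^'n) set). of_real (exp (- (\<xi> \<bullet> b)\<^sup>2)))" unfolding gauss_ft_real(2) ..
  also have "\<dots> = of_real (exp (- (norm \<xi>)\<^sup>2))"
    unfolding power2_norm_eq_inner by (subst euclidean_inner) (simp add: exp_sum[symmetric] power2_eq_square sum_negf flip: of_real_prod)
  finally show ?thesis .
qed

text \<open>This fixes the constant of Fourier inversion. \<open>gk (2 x)\<close> is a multiple of
  \<open>ft gk x\<close>, so rescaling the identity \<open>ft gk 0 = 1\<close> evaluates the
  integral; the rest is arithmetic with powers of 4 pi.\<close>

lemma integral_ft_gk: "(LINT \<xi>|lborel. ft gk (\<xi>::real^'n::finite)) = (2 * pi) ^ CARD('n) * gk (0::real^'n)"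
proof -
  let ?c = "(4 * pi) powr (- (real CARD('n) / 2))"
  have c: "?c > 0" by simp
  have "ft gk (0::real^'n) = (LINT x|lborel. gk (x::real^'n))" by (simp add: ft_def)
  also have "\<dots> = 2 ^ CARD('n) *\<^sub>R (LINT x|lborel. gk (2 *\<^sub>R (x::real^'n)))"
    using lborel_integral_affine[of 2 "gk :: real^'n \<Rightarrow> complex" 0] schwartz_borel[OF schwartz_gk] by simp
  also have "(\<lambda>x::real^'n. gk (2 *\<^sub>R x)) = (\<lambda>x. of_real ?c * ft gk x)"
    unfolding ft_gk gk_eq by (simp add: power_mult_distrib)
  finally have "1 = 2 ^ CARD('n) * (of_real ?c * (LINT \<xi>|lborel. ft gk (\<xi>::real^'n)))"
    unfolding ft_gk by (simp add: scaleR_conv_of_real)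
  moreover have g0: "of_real ?c = gk (0::real^'n)" by (simp add: gk_eq)
  moreover have cc1: "(2 * pi) ^ CARD('n) * ?c * (2 ^ CARD('n) * ?c) = 1"
  proof -
    have "?c * ?c = (1 / sqrt (4 * pi) * (1 / sqrt (4 * pi))) ^ CARD('n)"
      unfolding powr_neg_half power_mult_distrib ..
    also have "1 / sqrt (4 * pi) * (1 / sqrt (4 * pi)) = 1 / (4 * pi)" by (simp add: real_sqrt_mult_self)
    finally have cc: "?c * ?c = (1 / (4 * pi)) ^ CARD('n)" .
    have "(2 * pi) ^ CARD('n) * ?c * (2 ^ CARD('n) * ?c) = (2 * pi) ^ CARD('n) * 2 ^ CARD('n) * (?c * ?c)"
      by (simp only: mult_ac)
    also have "\<dots> = ((2 * pi) * 2 * (1 / (4 * pi))) ^ CARD('n)" by (simp only: cc power_mult_distrib)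
    also have "\<dots> = 1" by simp
    finally show ?thesis .
  qed
  moreover have "(2 * pi) ^ CARD('n) * gk (0::real^'n) * (2 ^ CARD('n) * of_real ?c) = 1"
    using arg_cong[OF cc1, of complex_of_real] by (simp add: g0)
  ultimately have "(LINT \<xi>|lborel. ft gk (\<xi>::real^'n)) * (2 ^ CARD('n) * of_real ?c) = (2 * pi) ^ CARD('n) * gk (0::real^'n) * (2 ^ CARD('n) * of_real ?c)"
    by (simp add: mult_ac)
  moreover have "2 ^ CARD('n) * complex_of_real ?c \<noteq> 0" using c by simp
  ultimately show ?thesis by (metis mult_right_cancel)
qed

text \<open>Fourier inversion by Gaussian damping. The integral \<open>I n\<close> carries the
  factor \<open>gk (s n xi)\<close>. Dominated convergence sends it to \<open>gk 0\<close> times the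
  left-hand side; Fubini and a substitution rewrite it as \<open>dconv (ft gk) (s n) f x\<close>,
  which is continuous in the dilation down to 0, where it is the integral of \<open>ft gk\<close>
  times \<open>f x\<close>.\<close>

lemma ft_ft_reflect:
  fixes f :: "real^'n::finite \<Rightarrow> complex"
  assumes f: "f \<in> schwartz"
  shows "ft (\<lambda>\<xi>. ft f (- \<xi>)) x = (2 * pi) ^ CARD('n) * f (x::real^'n::finite)"
proof -
  define s where "s n = 1 / real (Suc n)" for n
  have s: "s \<longlonglongrightarrow> 0" "\<And>n. s n > 0" "\<And>n. s n \<le> 1" unfolding s_def
    using LIMSEQ_inverse_real_of_nat by (auto simp: divide_simps)
  define F where "F \<xi> = ft f (- \<xi>)" for \<xi>
  have F: "F \<in> schwartz" unfolding F_def by (intro schwartz_reflect schwartz_ft f)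
  have G: "ft (gk :: real^'n \<Rightarrow> complex) \<in> schwartz" by (intro schwartz_ft schwartz_gk)
  have [measurable]: "f \<in> borel_measurable borel" "F \<in> borel_measurable borel" "(gk :: real^'n \<Rightarrow> complex) \<in> borel_measurable borel"
     "ft (gk :: real^'n \<Rightarrow> complex) \<in> borel_measurable borel"
    using f F G schwartz_gk by (auto intro: schwartz_borel)
  define I where "I n = (LINT \<xi>|lborel. cis (\<xi> \<bullet> x) * F \<xi> * gk (s n *\<^sub>R \<xi>))" for n
  have "I \<longlonglongrightarrow> (LINT \<xi>|lborel. cis (\<xi> \<bullet> x) * F \<xi> * gk (0::real^'n))"
    unfolding I_def
  proof (rule integral_dominated_convergence)
    show "integrable lborel (\<lambda>\<xi>. norm (gk (0::real^'n)) * norm (F \<xi>))"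
      by (intro integrable_mult_right integrable_norm schwartz_integrable F)
    show "AE \<xi> in lborel. (\<lambda>n. cis (\<xi> \<bullet> x) * F \<xi> * gk (s n *\<^sub>R \<xi>)) \<longlonglongrightarrow> cis (\<xi> \<bullet> x) * F \<xi> * gk (0::real^'n)"
    proof (rule AE_I2, rule tendsto_mult_left)
      fix \<xi> :: "real^'n"
      have "(\<lambda>n. s n *\<^sub>R \<xi>) \<longlonglongrightarrow> 0" using tendsto_scaleR[OF s(1) tendsto_const[of \<xi>]] by simp
      moreover have "isCont gk (0::real^'n)"
        using schwartz_continuous_on[OF schwartz_gk, of "UNIV :: (real^'n) set"] by (simp add: continuous_on_eq_continuous_at)
      ultimately show "(\<lambda>n. gk (s n *\<^sub>R \<xi>)) \<longlonglongrightarrow> gk (0::real^'n)" using isCont_tendsto_compose by blast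
    qed
    show "AE \<xi> in lborel. norm (cis (\<xi> \<bullet> x) * F \<xi> * gk (s n *\<^sub>R \<xi>)) \<le> norm (gk (0::real^'n)) * norm (F \<xi>)" for n
    proof (rule AE_I2)
      fix \<xi> :: "real^'n"
      have "norm (gk (s n *\<^sub>R \<xi>)) \<le> norm (gk (0::real^'n))" by (simp add: gk_eq norm_mult mult_left_le)
      then show "norm (cis (\<xi> \<bullet> x) * F \<xi> * gk (s n *\<^sub>R \<xi>)) \<le> norm (gk (0::real^'n)) * norm (F \<xi>)"
        by (simp add: norm_mult mult.commute mult_left_mono)
    qed
  qed measurable
  also have "(LINT \<xi>|lborel. cis (\<xi> \<bullet> x) * F \<xi> * gk (0::real^'n)) = gk (0::real^'n) * ft F x"
    by (simp add: ft_def mult.commute)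
  finally have lim1: "I \<longlonglongrightarrow> gk (0::real^'n) * ft F x" .
  have I_eq: "I n = dconv (ft gk) (s n) f x" for n
  proof -
    have gi: "integrable lborel (\<lambda>\<xi>::real^'n. gk (s n *\<^sub>R \<xi>))"
      using schwartz_integrable[OF schwartz_affine[OF schwartz_gk, of "s n" 0]] s(2)[of n] by simp
    have fub: "integrable (lborel \<Otimes>\<^sub>M lborel) (\<lambda>(\<xi>, y). cis ((x - y) \<bullet> \<xi>) * (f y * gk (s n *\<^sub>R \<xi>)))"
    proof (rule lborel_pair.Fubini_integrable)
      show "integrable lborel (\<lambda>\<xi>. LINT y|lborel. norm (case (\<xi>, y) of (\<xi>, y) \<Rightarrow> cis ((x - y) \<bullet> \<xi>) * (f y * gk (s n *\<^sub>R \<xi>))))"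
        using gi by (simp add: norm_mult)
      show "AE \<xi> in lborel. integrable lborel (\<lambda>y. case (\<xi>, y) of (\<xi>, y) \<Rightarrow> cis ((x - y) \<bullet> \<xi>) * (f y * gk (s n *\<^sub>R \<xi>)))"
      proof (rule AE_I2)
        fix \<xi>
        show "integrable lborel (\<lambda>y. case (\<xi>, y) of (\<xi>, y) \<Rightarrow> cis ((x - y) \<bullet> \<xi>) * (f y * gk (s n *\<^sub>R \<xi>)))"
          by (rule Bochner_Integration.integrable_bound[where f = "\<lambda>y. gk (s n *\<^sub>R \<xi>) * f y"])
            (auto simp: norm_mult intro!: schwartz_integrable schwartz_cmult f)
      qed
    qed measurable
    have "I n = (LINT \<xi>|lborel. (LINT y|lborel. cis ((x - y) \<bullet> \<xi>) * (f y * gk (s n *\<^sub>R \<xi>))))"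
      unfolding I_def
    proof (intro Bochner_Integration.integral_cong refl)
      fix \<xi> :: "real^'n"
      have "(LINT y|lborel. cis ((x - y) \<bullet> \<xi>) * (f y * gk (s n *\<^sub>R \<xi>))) =
         (LINT y|lborel. (cis (\<xi> \<bullet> x) * gk (s n *\<^sub>R \<xi>)) * (cis (y \<bullet> (- \<xi>)) * f y))"
      proof (intro Bochner_Integration.integral_cong refl)
        fix y
        have "cis ((x - y) \<bullet> \<xi>) = cis (\<xi> \<bullet> x) * cis (y \<bullet> (- \<xi>))"
          by (simp add: cis_mult inner_diff_left inner_commute[of \<xi>])
        then show "cis ((x - y) \<bullet> \<xi>) * (f y * gk (s n *\<^sub>R \<xi>)) = (cis (\<xi> \<bullet> x) * gk (s n *\<^sub>R \<xi>)) * (cis (y \<bullet> (- \<xi>)) * f y)"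
          by (simp add: mult_ac)
      qed
      also have "\<dots> = cis (\<xi> \<bullet> x) * F \<xi> * gk (s n *\<^sub>R \<xi>)" by (simp add: F_def ft_def)
      finally show "cis (\<xi> \<bullet> x) * F \<xi> * gk (s n *\<^sub>R \<xi>) = (LINT y|lborel. cis ((x - y) \<bullet> \<xi>) * (f y * gk (s n *\<^sub>R \<xi>)))" ..
    qed
    also have "\<dots> = (LINT y|lborel. (LINT \<xi>|lborel. cis ((x - y) \<bullet> \<xi>) * (f y * gk (s n *\<^sub>R \<xi>))))"
      by (rule lborel_pair.Fubini_integral[OF fub, symmetric])
    also have "\<dots> = (LINT y|lborel. f y * ((1 / s n) ^ CARD('n) *\<^sub>R ft gk ((1 / s n) *\<^sub>R (x - y))))"
    proof (intro Bochner_Integration.integral_cong refl)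
      fix y
      have "ft gk ((1 / s n) *\<^sub>R (x - y)) = (LINT \<xi>|lborel. cis (\<xi> \<bullet> ((1 / s n) *\<^sub>R (x - y))) * gk \<xi>)" by (simp add: ft_def)
      also have "\<dots> = s n ^ CARD('n) *\<^sub>R (LINT \<xi>|lborel. cis ((x - y) \<bullet> \<xi>) * gk (s n *\<^sub>R \<xi>))"
        using lborel_integral_affine[of "s n" "\<lambda>\<xi>::real^'n. cis (\<xi> \<bullet> ((1 / s n) *\<^sub>R (x - y))) * gk \<xi>" 0] s(2)[of n]
        by (simp add: inner_commute)
      finally show "(LINT \<xi>|lborel. cis ((x - y) \<bullet> \<xi>) * (f y * gk (s n *\<^sub>R \<xi>))) = f y * ((1 / s n) ^ CARD('n) *\<^sub>R ft gk ((1 / s n) *\<^sub>R (x - y)))"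
        using s(2)[of n] by (simp add: mult.left_commute[of _ "f y"] power_divide)
    qed
    also have "\<dots> = s n ^ CARD('n) *\<^sub>R (LINT z|lborel. f (x + (- s n) *\<^sub>R z) * ((1 / s n) ^ CARD('n) *\<^sub>R ft gk ((1 / s n) *\<^sub>R (x - (x + (- s n) *\<^sub>R z)))))"
      using lborel_integral_affine[of "- s n" "\<lambda>y. f y * ((1 / s n) ^ CARD('n) *\<^sub>R ft gk ((1 / s n) *\<^sub>R (x - y)))" x] s(2)[of n]
      by simp
    also have "\<dots> = dconv (ft gk) (s n) f x"
      using s(2)[of n] by (simp add: dconv_def mult.commute power_divide)
    finally show ?thesis .
  qed
  obtain C where C: "C \<ge> 0" "\<And>y h h'. \<bar>h\<bar> \<le> 1 \<Longrightarrow> \<bar>h'\<bar> \<le> 1 \<Longrightarrow> (1 + norm y) ^ 0 * norm (dconv (ft gk) h f y - dconv (ft gk) h' f y) \<le> C * \<bar>h - h'\<bar>"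
    using dconv_Lipschitz[OF G f, of 1 0] by blast
  have 1: "norm (I n - dconv (ft gk) 0 f x) \<le> C * s n" for n
    using C(2)[of "s n" 0 x] s(2,3)[of n] unfolding I_eq by simp
  have 2: "(\<lambda>n. C * s n) \<longlonglongrightarrow> 0" using tendsto_mult_right_zero[OF s(1)] by simp
  have "(\<lambda>n. I n - dconv (ft gk) 0 f x) \<longlonglongrightarrow> 0"
    by (rule Lim_null_comparison[OF always_eventually[OF allI[OF 1]] 2])
  then have "I \<longlonglongrightarrow> dconv (ft gk) 0 f x" by (rule LIM_zero_cancel)
  from LIMSEQ_unique[OF lim1 this] have "gk (0::real^'n) * ft F x = dconv (ft gk) 0 f x" .
  also have "\<dots> = (2 * pi) ^ CARD('n) * gk (0::real^'n) * f x"
    unfolding dconv_def by (simp add: integral_ft_gk)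
  finally have "gk (0::real^'n) * ft F x = gk (0::real^'n) * ((2 * pi) ^ CARD('n) * f x)" by (simp add: mult_ac)
  moreover have "gk (0::real^'n) \<noteq> 0" by (simp add: gk_eq)
  ultimately show ?thesis unfolding F_def by (metis mult_left_cancel)
qed

section \<open>Inversion formulas and Fourier multipliers\<close>

lemma ft_reflect:
  fixes h :: "real^'n::finite \<Rightarrow> complex"
  assumes "h \<in> borel_measurable borel"
  shows "ft (\<lambda>\<xi>. h (- \<xi>)) x = ft h (- x)"
  unfolding ft_def using lborel_integral_affine[of "-1" "\<lambda>\<xi>. cis (\<xi> \<bullet> (- x)) * h \<xi>" 0] assms by simp

lemma fourier_inv_fourier:
  assumes f: "f \<in> schwartz" shows "fourier (inv_fourier f) = f"
proof
  fix x :: "real^'a"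
  have "fourier (inv_fourier f) x = of_real (1 / (2 * pi) ^ CARD('a)) * ft (ft f) (- x)"
    unfolding fourier_ft inv_fourier_ft[abs_def] ft_cmult ..
  also have "ft (ft f) (- x) = (2 * pi) ^ CARD('a) * f x"
    using ft_ft_reflect[OF f, of x] ft_reflect[OF schwartz_borel[OF schwartz_ft[OF f]], of x] by simp
  finally show "fourier (inv_fourier f) x = f x" by simp
qed

text \<open>Reduces the operator identities below (commutation, reproduction, telescoping) to
  multiplication of symbols.\<close>

lemma ft_inject:
  assumes "f \<in> schwartz" "g \<in> schwartz" "\<And>\<xi>. ft f \<xi> = ft g \<xi>" shows "f = g"
proof -
  have "inv_fourier f = inv_fourier g" unfolding inv_fourier_ft[abs_def] assms(3) ..
  then show ?thesis using fourier_inv_fourier assms(1,2) by metis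
qed

text \<open>Convolution with \<open>kern b\<close>, dilated by \<open>h\<close>, is the Fourier multiplier with symbol \<open>b(h\<xi>)\<close>.\<close>

definition kern :: "(real ^ 'n::finite \<Rightarrow> complex) \<Rightarrow> real ^ 'n \<Rightarrow> complex" where
  "kern b x = of_real (1 / (2 * pi) ^ CARD('n)) * fourier b x"

lemma schwartz_kern: "b \<in> schwartz \<Longrightarrow> kern b \<in> schwartz"
  unfolding kern_def[abs_def] by (intro schwartz_cmult schwartz_fourier)

lemma ft_kern: "b \<in> schwartz \<Longrightarrow> ft (kern b) \<xi> = b \<xi>"
  unfolding kern_def[abs_def] ft_cmult fourier_ft[abs_def] by (simp add: ft_ft_reflect)

text \<open>By transposition a block of a distribution acts on test functions as inverse transform,
  multiplication, transform, in this order; the composite is recognised by its symbol.\<close>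

lemma fourier_multiplier_eqI:
  assumes "\<psi> \<in> schwartz" "\<And>\<xi>. ft \<psi> \<xi> = b \<xi> * ft \<phi> \<xi>"
  shows "fourier (\<lambda>\<xi>. b \<xi> * inv_fourier \<phi> \<xi>) = \<psi>"
proof -
  have "(\<lambda>\<xi>. b \<xi> * inv_fourier \<phi> \<xi>) = inv_fourier \<psi>"
    unfolding inv_fourier_ft[abs_def] assms(2) by (simp add: mult_ac)
  then show ?thesis using fourier_inv_fourier[OF assms(1)] by simp
qed

text \<open>Substitute y = x - sqrt r z. Time 0 is excluded: there \<open>heat_kernel\<close> is 0,
  whereas \<open>dconv gk 0\<close> is the identity.\<close>

lemma heat_eq_dconv:
  fixes u :: "'n::finite distr"
  assumes r: "r > 0" and \<phi>: "\<phi> \<in> schwartz"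
  shows "heat r u \<phi> = u (dconv gk (sqrt r) \<phi>)"
proof -
  have [measurable]: "\<phi> \<in> borel_measurable borel" using \<phi> by (rule schwartz_borel)
  have [measurable]: "heat_kernel r \<in> borel_measurable (borel :: (real^'n) measure)"
    unfolding heat_kernel_def[abs_def] by measurable
  have "(LINT y|lborel. of_real (heat_kernel r (y - x)) * \<phi> y) = dconv gk (sqrt r) \<phi> x" for x :: "real^'n"
  proof -
    have hk: "sqrt r ^ CARD('n) * heat_kernel r (- (sqrt r *\<^sub>R z)) = heat_kernel 1 z" for z :: "real^'n"
    proof -
      have e1: "(4 * pi * r) powr (- (real CARD('n) / 2)) = (4 * pi) powr (- (real CARD('n) / 2)) * r powr (- (real CARD('n) / 2))"
        using r by (simp add: powr_mult)
      have e2: "sqrt r ^ CARD('n) * r powr (- (real CARD('n) / 2)) = 1"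
      proof -
        have "sqrt r ^ CARD('n) = r powr (real CARD('n) / 2)"
          using r by (simp add: powr_half_sqrt[symmetric] powr_realpow[symmetric] powr_powr)
        then show ?thesis using r by (simp add: powr_add[symmetric])
      qed
      have e3: "(norm (- (sqrt r *\<^sub>R z)))\<^sup>2 / (4 * r) = (norm z)\<^sup>2 / 4"
        using r by (simp add: power_mult_distrib)
      have "a * (b * c * d) = a * c * (b * d)" for a b c d :: real by (simp only: mult_ac)
      then show ?thesis unfolding heat_kernel_def e1 e3 using e2 by simp
    qed
    have "(LINT y|lborel. of_real (heat_kernel r (y - x)) * \<phi> y) =
       sqrt r ^ CARD('n) *\<^sub>R (LINT z|lborel. of_real (heat_kernel r (- (sqrt r *\<^sub>R z))) * \<phi> (x - sqrt r *\<^sub>R z))"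
      using lborel_integral_affine[of "- sqrt r" "\<lambda>y. of_real (heat_kernel r (y - x)) * \<phi> y" x] r by simp
    also have "\<dots> = (LINT z|lborel. of_real (sqrt r ^ CARD('n) * heat_kernel r (- (sqrt r *\<^sub>R z))) * \<phi> (x - sqrt r *\<^sub>R z))"
      by (subst integral_scaleR_right[symmetric]) (simp add: scaleR_conv_of_real mult.assoc)
    also have "\<dots> = dconv gk (sqrt r) \<phi> x" unfolding hk by (simp add: dconv_def gk_def)
    finally show ?thesis .
  qed
  then show ?thesis unfolding heat_def conv_distr_def by simp
qed

subsection \<open>Seminorms and tempered distributions\<close>

lemma schwartz_seminorm_bound:
  fixes f :: "real^'n::finite \<Rightarrow> complex"
  assumes f: "f \<in> schwartz" and "length is \<le> N"
  shows "(1 + norm x) ^ N * norm (partials is f x) \<le> schwartz_seminorm N f"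
proof -
  have "finite {is :: 'n list. length is \<le> N}" using finite_lists_length_le[of "UNIV :: 'n set" N] by simp
  moreover have "\<exists>C. \<forall>is. \<forall>x. (1 + norm x) ^ N * norm (partials is f x) \<le> C is"
    using schwartz_rapid[OF schwartz_partials[OF f]] unfolding rapid_def by (intro choice) blast
  then obtain C where C: "\<And>is x. (1 + norm x) ^ N * norm (partials is f x) \<le> C is" by blast
  ultimately have "bdd_above ((\<lambda>(is, x). (1 + norm x) ^ N * norm (partials is f x)) ` ({is. length is \<le> N} \<times> UNIV))"
    by (intro bdd_aboveI[of _ "Max (C ` {is. length is \<le> N})"]) (auto intro!: order.trans[OF C] Max_ge)
  then have "(case (is, x) of (is, x) \<Rightarrow> (1 + norm x) ^ N * norm (partials is f x)) \<le> schwartz_seminorm N f"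
    unfolding schwartz_seminorm_def by (rule cSUP_upper[rotated]) (use assms in auto)
  then show ?thesis by simp
qed

lemma schwartz_seminorm_leI:
  fixes f :: "real^'n::finite \<Rightarrow> complex"
  assumes "\<And>is x. length is \<le> N \<Longrightarrow> (1 + norm x) ^ N * norm (partials is f x) \<le> C"
  shows "schwartz_seminorm N f \<le> C"
  unfolding schwartz_seminorm_def
proof (rule cSUP_least)
  have "([], 0) \<in> {is :: 'n list. length is \<le> N} \<times> (UNIV :: (real^'n) set)" by simp
  then show "{is :: 'n list. length is \<le> N} \<times> (UNIV :: (real^'n) set) \<noteq> {}" by blast
qed (use assms in auto)

lemma schwartz_seminorm_nonneg: "f \<in> schwartz \<Longrightarrow> schwartz_seminorm N f \<ge> 0"
  using schwartz_seminorm_bound[of f "[]" N 0] order.trans[OF norm_ge_zero[of "f 0"]] by simp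

lemma pd_schwartz_add: "f \<in> schwartz \<Longrightarrow> g \<in> schwartz \<Longrightarrow> pd i (\<lambda>x. f x + g x) = (\<lambda>x. pd i f x + pd i g x)"
  unfolding schwartz_eq_dclass by (rule pd_add)

lemma pd_schwartz_cmult: "f \<in> schwartz \<Longrightarrow> pd i (\<lambda>x. c * f x) = (\<lambda>x. c * pd i f x)"
  unfolding schwartz_eq_dclass by (rule pd_cmult)

lemma partials_add: "f \<in> schwartz \<Longrightarrow> g \<in> schwartz \<Longrightarrow> partials is (\<lambda>x. f x + g x) = (\<lambda>x. partials is f x + partials is g x)"
  by (induction "is") (simp_all add: partials_Cons pd_schwartz_add schwartz_partials del: partials.simps(2))

lemma partials_cmult: "f \<in> schwartz \<Longrightarrow> partials is (\<lambda>x. c * f x) = (\<lambda>x. c * partials is f x)"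
  by (induction "is") (simp_all add: partials_Cons pd_schwartz_cmult schwartz_partials del: partials.simps(2))

lemma partials_diff: "f \<in> schwartz \<Longrightarrow> g \<in> schwartz \<Longrightarrow> partials is (\<lambda>x. f x - g x) = (\<lambda>x. partials is f x - partials is g x)"
  using partials_add[of f "\<lambda>x. (-1) * g x" "is"] by (simp only: partials_cmult schwartz_cmult) simp

lemma partials_zero: "partials is (\<lambda>x. 0 :: complex) = (\<lambda>x. 0)"
  using partials_cmult[OF schwartz_zero, of "is" 0] by simp

lemma partials_sum:
  "(\<And>i. i \<in> I \<Longrightarrow> f i \<in> schwartz) \<Longrightarrow> partials is (\<lambda>x. \<Sum>i\<in>I. f i x) = (\<lambda>x. \<Sum>i\<in>I. partials is (f i) x)"
  by (induction I rule: infinite_finite_induct) (auto simp: partials_zero partials_add schwartz_sum)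

lemma tempered_add: "tempered u \<Longrightarrow> \<phi> \<in> schwartz \<Longrightarrow> \<psi> \<in> schwartz \<Longrightarrow> u (\<lambda>x. \<phi> x + \<psi> x) = u \<phi> + u \<psi>"
  unfolding tempered_def by blast

lemma tempered_cmult: "tempered u \<Longrightarrow> \<phi> \<in> schwartz \<Longrightarrow> u (\<lambda>x. c * \<phi> x) = c * u \<phi>"
  unfolding tempered_def by blast

lemma tempered_diff: "tempered u \<Longrightarrow> \<phi> \<in> schwartz \<Longrightarrow> \<psi> \<in> schwartz \<Longrightarrow> u (\<lambda>x. \<phi> x - \<psi> x) = u \<phi> - u \<psi>"
  using tempered_add[of u \<phi> "\<lambda>x. (-1) * \<psi> x"] tempered_cmult[of u \<psi> "-1"] schwartz_cmult[of \<psi> "-1"] by simp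

lemma tempered_zero: "tempered u \<Longrightarrow> u (\<lambda>x. 0) = 0"
  using tempered_cmult[of u "\<lambda>x. 0" 0] schwartz_zero by simp

lemma tempered_sum:
  assumes "tempered u" "\<And>i. i \<in> I \<Longrightarrow> f i \<in> schwartz"
  shows "u (\<lambda>x. \<Sum>i\<in>I. f i x) = (\<Sum>i\<in>I. u (f i))"
  using assms(2)
  by (induction I rule: infinite_finite_induct) (auto simp: tempered_zero[OF assms(1)] tempered_add[OF assms(1)] schwartz_sum)

lemma seminorm_dconv_Lipschitz:
  fixes f :: "real^'n::finite \<Rightarrow> complex"
  assumes k: "k \<in> schwartz" and f: "f \<in> schwartz"
  obtains C where "C \<ge> 0" "\<And>h h'. \<bar>h\<bar> \<le> R \<Longrightarrow> \<bar>h'\<bar> \<le> R \<Longrightarrow> schwartz_seminorm N (\<lambda>x. dconv k h f x - dconv k h' f x) \<le> C * \<bar>h - h'\<bar>"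
proof -
  have "\<exists>C. \<forall>is. C is \<ge> 0 \<and> (\<forall>x h h'. \<bar>h\<bar> \<le> R \<longrightarrow> \<bar>h'\<bar> \<le> R \<longrightarrow>
      (1 + norm x) ^ N * norm (dconv k h (partials is f) x - dconv k h' (partials is f) x) \<le> C is * \<bar>h - h'\<bar>)"
  proof (intro choice allI)
    fix "is"
    show "\<exists>C\<ge>0. \<forall>x h h'. \<bar>h\<bar> \<le> R \<longrightarrow> \<bar>h'\<bar> \<le> R \<longrightarrow>
      (1 + norm x) ^ N * norm (dconv k h (partials is f) x - dconv k h' (partials is f) x) \<le> C * \<bar>h - h'\<bar>"
      by (rule dconv_Lipschitz[OF k schwartz_partials[OF f], where R = R and N = N]) blast
  qed
  then obtain C where C: "\<And>is. C is \<ge> 0" "\<And>is x h h'. \<bar>h\<bar> \<le> R \<Longrightarrow> \<bar>h'\<bar> \<le> R \<Longrightarrow>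
      (1 + norm x) ^ N * norm (dconv k h (partials is f) x - dconv k h' (partials is f) x) \<le> C is * \<bar>h - h'\<bar>" by blast
  have fin: "finite {is :: 'n list. length is \<le> N}" using finite_lists_length_le[of "UNIV :: 'n set" N] by simp
  define M where "M = (\<Sum>is\<in>{is :: 'n list. length is \<le> N}. C is)"
  show thesis
  proof
    show "M \<ge> 0" unfolding M_def by (intro sum_nonneg C)
    fix h h' assume h: "\<bar>h\<bar> \<le> R" "\<bar>h'\<bar> \<le> R"
    show "schwartz_seminorm N (\<lambda>x. dconv k h f x - dconv k h' f x) \<le> M * \<bar>h - h'\<bar>"
    proof (rule schwartz_seminorm_leI)
      fix "is" :: "'n list" and x assume l: "length is \<le> N"
      have "C is \<le> M" unfolding M_def using l fin C(1) by (intro member_le_sum) auto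
      then have "C is * \<bar>h - h'\<bar> \<le> M * \<bar>h - h'\<bar>" by (intro mult_right_mono) auto
      then show "(1 + norm x) ^ N * norm (partials is (\<lambda>x. dconv k h f x - dconv k h' f x) x) \<le> M * \<bar>h - h'\<bar>"
        using C(2)[OF h, of x "is"] by (simp add: partials_diff schwartz_dconv k f partials_dconv)
    qed
  qed
qed

text \<open>Serves twice: at dilation 0 it gives convergence of the Littlewood-Paley sums, and at
  all dilations it is the continuity half of the joint measurability in time.\<close>

lemma tempered_dconv_isCont:
  assumes u: "tempered u" and k: "k \<in> schwartz" and f: "f \<in> schwartz"
  shows "isCont (\<lambda>h. u (dconv k h f)) h0"
proof -
  obtain N K where K: "\<And>\<phi>. \<phi> \<in> schwartz \<Longrightarrow> norm (u \<phi>) \<le> K * schwartz_seminorm N \<phi>"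
    using u unfolding tempered_def by blast
  obtain C where C: "C \<ge> 0" "\<And>h h'. \<bar>h\<bar> \<le> \<bar>h0\<bar> + 1 \<Longrightarrow> \<bar>h'\<bar> \<le> \<bar>h0\<bar> + 1 \<Longrightarrow>
      schwartz_seminorm N (\<lambda>x. dconv k h f x - dconv k h' f x) \<le> C * \<bar>h - h'\<bar>"
    using seminorm_dconv_Lipschitz[OF k f] by blast
  have est: "norm (u (dconv k h f) - u (dconv k h0 f)) \<le> \<bar>K\<bar> * C * \<bar>h - h0\<bar>" if "\<bar>h - h0\<bar> < 1" for h
  proof -
    let ?d = "\<lambda>x. dconv k h f x - dconv k h0 f x"
    have d: "?d \<in> schwartz" by (intro schwartz_diff schwartz_dconv k f)
    have "norm (u (dconv k h f) - u (dconv k h0 f)) = norm (u ?d)"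
      using tempered_diff[OF u schwartz_dconv[OF k f] schwartz_dconv[OF k f]] by simp
    also have "\<dots> \<le> \<bar>K\<bar> * schwartz_seminorm N ?d"
      by (rule order.trans[OF K[OF d]]) (intro mult_right_mono schwartz_seminorm_nonneg d abs_ge_self)
    also have "\<dots> \<le> \<bar>K\<bar> * (C * \<bar>h - h0\<bar>)" using that by (intro mult_left_mono C) auto
    finally show ?thesis by (simp add: mult.assoc)
  qed
  have "((\<lambda>h. u (dconv k h f) - u (dconv k h0 f)) \<longlongrightarrow> 0) (at h0)"
  proof (rule Lim_null_comparison)
    have "\<forall>\<^sub>F h in at h0. dist h h0 < 1" by (metis eventually_at zero_less_one)
    then show "\<forall>\<^sub>F h in at h0. norm (u (dconv k h f) - u (dconv k h0 f)) \<le> \<bar>K\<bar> * C * \<bar>h - h0\<bar>"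
      by eventually_elim (rule est, simp add: dist_real_def)
    show "((\<lambda>h. \<bar>K\<bar> * C * \<bar>h - h0\<bar>) \<longlongrightarrow> 0) (at h0)" by (auto intro!: tendsto_eq_intros)
  qed
  then show ?thesis unfolding isCont_def by (rule LIM_zero_cancel)
qed

subsection \<open>The Laplacian\<close>

definition lap :: "(real ^ 'n::finite \<Rightarrow> complex) \<Rightarrow> real ^ 'n \<Rightarrow> complex" where
  "lap f x = (\<Sum>i\<in>UNIV. pd i (pd i f) x)"

lemma schwartz_lap: "f \<in> schwartz \<Longrightarrow> lap f \<in> schwartz"
  unfolding lap_def[abs_def] by (intro schwartz_sum schwartz_pd)

lemma schwartz_lap_pow: "f \<in> schwartz \<Longrightarrow> (lap ^^ n) f \<in> schwartz"
  by (induction n) (auto intro: schwartz_lap)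

lemma ft_lap: "f \<in> schwartz \<Longrightarrow> ft (lap f) \<xi> = - of_real ((norm \<xi>)\<^sup>2) * ft f \<xi>"
proof -
  assume f: "f \<in> schwartz"
  have "ft (lap f) \<xi> = (\<Sum>i\<in>UNIV. ft (pd i (pd i f)) \<xi>)"
    unfolding lap_def[abs_def] by (intro ft_sum schwartz_integrable schwartz_pd f)
  also have "\<dots> = (\<Sum>i\<in>UNIV. - (of_real (\<xi> $ i * \<xi> $ i) * ft f \<xi>))"
    by (intro sum.cong refl) (simp add: ft_pd schwartz_pd f algebra_simps)
  also have "\<dots> = - of_real (\<Sum>i\<in>UNIV. \<xi> $ i * \<xi> $ i) * ft f \<xi>"
    by (simp add: sum_negf sum_distrib_right)
  also have "(\<Sum>i\<in>UNIV. \<xi> $ i * \<xi> $ i) = (norm \<xi>)\<^sup>2"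
    by (simp only: power2_norm_eq_inner inner_vec_def inner_real_def)
  finally show ?thesis .
qed

lemma ft_lap_pow: "f \<in> schwartz \<Longrightarrow> ft ((lap ^^ n) f) \<xi> = (- 1) ^ n * of_real ((norm \<xi>)\<^sup>2 ^ n) * ft f \<xi>"
  by (induction n) (auto simp: ft_lap schwartz_lap_pow)

lemma seminorm_lap:
  fixes f :: "real^'n::finite \<Rightarrow> complex"
  assumes f: "f \<in> schwartz"
  shows "schwartz_seminorm N (lap f) \<le> CARD('n) * schwartz_seminorm (N + 2) f"
proof (rule schwartz_seminorm_leI)
  fix "is" :: "'n list" and x assume l: "length is \<le> N"
  have "partials is (lap f) = (\<lambda>x. \<Sum>i\<in>UNIV. partials is (pd i (pd i f)) x)"
    unfolding lap_def[abs_def] by (intro partials_sum schwartz_pd f)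
  moreover have "partials is (pd i (pd i f)) = partials (is @ [i, i]) f" for i
    by (simp only: partials_append partials_Cons partials.simps(1))
  ultimately have "norm (partials is (lap f) x) \<le> (\<Sum>i\<in>UNIV. norm (partials (is @ [i, i]) f x))"
    by (simp only:) (rule norm_sum)
  then have "(1 + norm x) ^ N * norm (partials is (lap f) x) \<le> (1 + norm x) ^ N * (\<Sum>i\<in>UNIV. norm (partials (is @ [i, i]) f x))"
    by (intro mult_left_mono) auto
  also have "\<dots> = (\<Sum>i\<in>UNIV. (1 + norm x) ^ N * norm (partials (is @ [i, i]) f x))" by (rule sum_distrib_left)
  also have "\<dots> \<le> (\<Sum>i\<in>(UNIV::'n set). schwartz_seminorm (N + 2) f)"
  proof (rule sum_mono)
    fix i
    have "(1 + norm x) ^ N * norm (partials (is @ [i, i]) f x) \<le> (1 + norm x) ^ (N + 2) * norm (partials (is @ [i, i]) f x)"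
      by (intro mult_right_mono power_increasing) auto
    also have "\<dots> \<le> schwartz_seminorm (N + 2) f" using l by (intro schwartz_seminorm_bound f) simp
    finally show "(1 + norm x) ^ N * norm (partials (is @ [i, i]) f x) \<le> schwartz_seminorm (N + 2) f" .
  qed
  finally show "(1 + norm x) ^ N * norm (partials is (lap f) x) \<le> CARD('n) * schwartz_seminorm (N + 2) f" by simp
qed

text \<open>Origin of the index: integrability takes a weight of order twice the dimension, and each
  Laplacian raises the seminorm by two.\<close>

lemma L1_lap_pow_le:
  "\<exists>C\<ge>0. \<forall>f\<in>schwartz. L1 ((lap ^^ n) f) \<le> C * schwartz_seminorm (2 * CARD('n) + 2 * n) (f :: real^'n::finite \<Rightarrow> complex)"
proof -
  have sn: "schwartz_seminorm N ((lap ^^ n) f) \<le> real CARD('n) ^ n * schwartz_seminorm (N + 2 * n) f"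
    if f: "f \<in> schwartz" for N and f :: "real^'n \<Rightarrow> complex"
  proof (induction n arbitrary: N)
    case (Suc n)
    have "schwartz_seminorm N ((lap ^^ Suc n) f) \<le> CARD('n) * schwartz_seminorm (N + 2) ((lap ^^ n) f)"
      using seminorm_lap[OF schwartz_lap_pow[OF f, of n]] by simp
    also have "\<dots> \<le> CARD('n) * (real CARD('n) ^ n * schwartz_seminorm (N + 2 + 2 * n) f)"
      by (intro mult_left_mono Suc) auto
    finally show ?case by (simp add: mult_ac)
  qed simp
  have "L1 ((lap ^^ n) f) \<le> (real CARD('n) ^ n * wint TYPE('n)) * schwartz_seminorm (2 * CARD('n) + 2 * n) f"
    if f: "f \<in> schwartz" for f :: "real^'n \<Rightarrow> complex"
  proof -
    have g: "(lap ^^ n) f \<in> schwartz" using f by (rule schwartz_lap_pow)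
    have "L1 ((lap ^^ n) f) \<le> schwartz_seminorm (2 * CARD('n)) ((lap ^^ n) f) * wint TYPE('n)"
      unfolding L1_def using schwartz_seminorm_bound[OF g, of "[]"]
      by (intro integrable_of_weighted_bound(2) schwartz_borel g) auto
    also have "\<dots> \<le> (real CARD('n) ^ n * schwartz_seminorm (2 * CARD('n) + 2 * n) f) * wint TYPE('n)"
      by (intro mult_right_mono sn f wint_nonneg)
    finally show ?thesis by (simp add: mult_ac)
  qed
  then show ?thesis using wint_nonneg[where 'n='n] by (intro exI[of _ "real CARD('n) ^ n * wint TYPE('n)"]) auto
qed

subsection \<open>Littlewood--Paley operators\<close>

locale littlewood_paley =
  fixes \<chi>\<^sub>0 :: "real ^ 'n::finite \<Rightarrow> real"
  assumes cutoff: "lp_cutoff \<chi>\<^sub>0"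
begin

definition c0 :: "real ^ 'n \<Rightarrow> complex" where "c0 \<xi> = of_real (\<chi>\<^sub>0 \<xi>)"

definition chi :: "nat \<Rightarrow> real ^ 'n \<Rightarrow> complex" where "chi j \<xi> = of_real (lp_chi \<chi>\<^sub>0 j \<xi>)"

text \<open>Equal to 1 for 1/3 <= |xi| < 2 and to 0 for |xi| < 1/4 or |xi| > 8/3. The first annulus
  contains 1/2 <= |xi| < 4/3, outside of which a rescaled \<open>chi\<close> with positive index
  vanishes.\<close>

definition eta :: "real ^ 'n \<Rightarrow> complex" where "eta \<xi> = c0 ((1/2) *\<^sub>R \<xi>) - c0 (4 *\<^sub>R \<xi>)"

text \<open>\<open>fat j\<close> is \<open>1\<close> on the support of \<open>chi j\<close>, and for \<open>j > 0\<close> it vanishes near the origin.\<close>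

fun fat :: "nat \<Rightarrow> real ^ 'n \<Rightarrow> complex" where
  "fat 0 \<xi> = c0 ((1/2) *\<^sub>R \<xi>)"
| "fat (Suc j) \<xi> = eta ((1 / 2 ^ Suc j) *\<^sub>R \<xi>)"

definition blk :: "nat \<Rightarrow> (real ^ 'n \<Rightarrow> complex) \<Rightarrow> real ^ 'n \<Rightarrow> complex" where
  "blk j = dconv (kern (chi j)) 1"

definition fatblk :: "nat \<Rightarrow> (real ^ 'n \<Rightarrow> complex) \<Rightarrow> real ^ 'n \<Rightarrow> complex" where
  "fatblk j = dconv (kern (fat j)) 1"

section \<open>The cutoffs and their operators on test functions\<close>

lemma c0_smooth: "smooth c0"
  unfolding c0_def[abs_def] using cutoff by (intro smooth_of_real) (simp add: lp_cutoff_def)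

lemma c0_one: "norm \<xi> < 1 \<Longrightarrow> c0 \<xi> = 1"
  unfolding c0_def using cutoff by (simp add: lp_cutoff_def)

lemma c0_zero: "norm \<xi> \<ge> 4 / 3 \<Longrightarrow> c0 \<xi> = 0"
  unfolding c0_def using cutoff by (simp add: lp_cutoff_def)

lemma c0_schwartz: "c0 \<in> schwartz"
  by (rule schwartz_compact_support[OF c0_smooth, of "4/3"]) (simp add: c0_zero)

lemma c0_dilate_schwartz: "h \<noteq> 0 \<Longrightarrow> (\<lambda>\<xi>. c0 (h *\<^sub>R \<xi>)) \<in> schwartz"
  using schwartz_affine[OF c0_schwartz, of h 0] by simp

lemma chi_0: "chi 0 = c0"
  by (simp add: chi_def c0_def fun_eq_iff)

lemma chi_Suc: "chi (Suc j) = (\<lambda>\<xi>. c0 ((1 / 2 ^ Suc j) *\<^sub>R \<xi>) - c0 ((1 / 2 ^ j) *\<^sub>R \<xi>))"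
  by (simp add: chi_def c0_def fun_eq_iff)

lemma chi_schwartz: "chi j \<in> schwartz"
  by (cases j) (auto simp: chi_0 chi_Suc c0_schwartz intro!: schwartz_diff c0_dilate_schwartz)

lemma eta_schwartz: "eta \<in> schwartz"
  unfolding eta_def[abs_def] by (intro schwartz_diff c0_dilate_schwartz) auto

lemma eta_smooth: "smooth eta"
  using eta_schwartz by (simp add: schwartz_def)

lemma eta_zero: "norm \<xi> < 1 / 4 \<Longrightarrow> eta \<xi> = 0"
  by (simp add: eta_def c0_one)

lemma eta_zero': "norm \<xi> > 8 / 3 \<Longrightarrow> eta \<xi> = 0"
  by (simp add: eta_def c0_zero)

lemma fat_schwartz: "fat j \<in> schwartz"
proof (cases j)
  case 0
  have "fat 0 = (\<lambda>\<xi>. c0 ((1/2) *\<^sub>R \<xi>))" by (simp add: fun_eq_iff)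
  then show ?thesis using 0 c0_dilate_schwartz[of "1/2"] by simp
next
  case (Suc i)
  have "fat (Suc i) = (\<lambda>\<xi>. eta ((1 / 2 ^ Suc i) *\<^sub>R \<xi>))" by (simp add: fun_eq_iff)
  then show ?thesis using Suc schwartz_affine[OF eta_schwartz, of "1 / 2 ^ Suc i" 0] by simp
qed

lemma chi_fat: "chi j \<xi> * fat j \<xi> = chi j \<xi>"
proof (cases j)
  case 0
  then show ?thesis using c0_zero[of \<xi>] c0_one[of "(1/2) *\<^sub>R \<xi>"] by (cases "norm \<xi> \<ge> 4/3") (auto simp: chi_0)
next
  case (Suc i)
  define \<zeta> where "\<zeta> = (1 / 2 ^ Suc i) *\<^sub>R \<xi>"
  have \<zeta>2: "(1 / 2 ^ i) *\<^sub>R \<xi> = 2 *\<^sub>R \<zeta>" by (simp add: \<zeta>_def)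
  have chi: "chi j \<xi> = c0 \<zeta> - c0 (2 *\<^sub>R \<zeta>)" unfolding Suc chi_Suc \<zeta>2 by (simp add: \<zeta>_def)
  have fat: "fat j \<xi> = c0 ((1/2) *\<^sub>R \<zeta>) - c0 (4 *\<^sub>R \<zeta>)" unfolding Suc \<zeta>_def by (simp add: eta_def)
  consider "norm \<zeta> < 1/2" | "norm \<zeta> \<ge> 1/2" "norm \<zeta> < 4/3" | "norm \<zeta> \<ge> 4/3" by linarith
  then show ?thesis
  proof cases
    case 1 then have "chi j \<xi> = 0" by (simp add: chi c0_one)
    then show ?thesis by simp
  next
    case 2 then have "fat j \<xi> = 1" by (simp add: fat c0_one c0_zero)
    then show ?thesis by simp
  next
    case 3 then have "chi j \<xi> = 0" by (simp add: chi c0_zero)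
    then show ?thesis by simp
  qed
qed

lemma blk_schwartz: "\<phi> \<in> schwartz \<Longrightarrow> blk j \<phi> \<in> schwartz"
  unfolding blk_def by (intro schwartz_dconv schwartz_kern chi_schwartz)

lemma fatblk_schwartz: "\<phi> \<in> schwartz \<Longrightarrow> fatblk j \<phi> \<in> schwartz"
  unfolding fatblk_def by (intro schwartz_dconv schwartz_kern fat_schwartz)

lemma ft_blk: "\<phi> \<in> schwartz \<Longrightarrow> ft (blk j \<phi>) \<xi> = chi j \<xi> * ft \<phi> \<xi>"
  unfolding blk_def by (simp add: ft_dconv schwartz_kern chi_schwartz ft_kern)

lemma ft_fatblk: "\<phi> \<in> schwartz \<Longrightarrow> ft (fatblk j \<phi>) \<xi> = fat j \<xi> * ft \<phi> \<xi>"
  unfolding fatblk_def by (simp add: ft_dconv schwartz_kern fat_schwartz ft_kern)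

text \<open>The reproducing identity: a fattened block can be inserted for free, so that bounds in
  terms of the L1 norm of the test function profit from its frequency localisation.\<close>

lemma blk_fatblk: "\<phi> \<in> schwartz \<Longrightarrow> blk j (fatblk j \<phi>) = blk j \<phi>"
  by (rule ft_inject) (simp_all add: blk_schwartz fatblk_schwartz ft_blk ft_fatblk mult.assoc[symmetric] chi_fat)

lemma dconv_blk_commute: "k \<in> schwartz \<Longrightarrow> \<phi> \<in> schwartz \<Longrightarrow> dconv k h (blk j \<phi>) = blk j (dconv k h \<phi>)"
  by (rule ft_inject) (simp_all add: blk_schwartz schwartz_dconv ft_blk ft_dconv mult_ac)

lemma dconv_fatblk_commute: "k \<in> schwartz \<Longrightarrow> \<phi> \<in> schwartz \<Longrightarrow> dconv k h (fatblk j \<phi>) = fatblk j (dconv k h \<phi>)"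
  by (rule ft_inject) (simp_all add: fatblk_schwartz schwartz_dconv ft_fatblk ft_dconv mult_ac)

lemma lp_block_eq:
  assumes \<phi>: "\<phi> \<in> schwartz" shows "lp_block \<chi>\<^sub>0 j u \<phi> = u (blk j \<phi>)"
proof -
  have "fourier (\<lambda>\<xi>. chi j \<xi> * inv_fourier \<phi> \<xi>) = blk j \<phi>"
    by (rule fourier_multiplier_eqI) (simp_all add: blk_schwartz \<phi> ft_blk)
  then show ?thesis
    by (simp add: lp_block_def inv_fourier_distr_def mult_distr_def fourier_distr_def chi_def)
qed

section \<open>Reconstruction from the blocks\<close>

lemma sum_chi: "(\<Sum>j\<le>J. chi j \<xi>) = c0 ((1 / 2 ^ J) *\<^sub>R \<xi>)"
  by (induction J) (simp_all add: chi_0 chi_Suc)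

lemma sum_blk:
  assumes \<phi>: "\<phi> \<in> schwartz" shows "(\<lambda>x. \<Sum>j\<le>J. blk j \<phi> x) = dconv (kern c0) (1 / 2 ^ J) \<phi>"
proof (rule ft_inject)
  show "(\<lambda>x. \<Sum>j\<le>J. blk j \<phi> x) \<in> schwartz" by (intro schwartz_sum blk_schwartz \<phi>)
  show "dconv (kern c0) (1 / 2 ^ J) \<phi> \<in> schwartz" by (intro schwartz_dconv schwartz_kern c0_schwartz \<phi>)
  show "ft (\<lambda>x. \<Sum>j\<le>J. blk j \<phi> x) \<xi> = ft (dconv (kern c0) (1 / 2 ^ J) \<phi>) \<xi>" for \<xi>
    by (simp add: ft_sum schwartz_integrable blk_schwartz \<phi> ft_blk sum_distrib_right[symmetric] sum_chi
        ft_dconv schwartz_kern c0_schwartz ft_kern)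
qed

lemma dconv_c0_zero: "\<phi> \<in> schwartz \<Longrightarrow> dconv (kern c0) 0 \<phi> = \<phi>"
  by (rule ft_inject) (simp_all add: schwartz_dconv schwartz_kern c0_schwartz ft_dconv ft_kern c0_one)

text \<open>The partial sums telescope to a low-pass operator with dilation 1/2^J, so this is
  continuity in the dilation at 0, where that operator is the identity.\<close>

lemma tempered_sum_blk_tendsto:
  assumes u: "tempered u" and \<phi>: "\<phi> \<in> schwartz"
  shows "(\<lambda>J. \<Sum>j\<le>J. u (blk j \<phi>)) \<longlonglongrightarrow> u \<phi>"
proof -
  have "(\<lambda>J::nat. 1 / 2 ^ J :: real) \<longlonglongrightarrow> 0"
    using LIMSEQ_realpow_zero[of "1/2"] by (simp add: power_one_over)
  from isCont_tendsto_compose[OF tempered_dconv_isCont[OF u schwartz_kern[OF c0_schwartz] \<phi>] this]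
  have "(\<lambda>J. u (dconv (kern c0) (1 / 2 ^ J) \<phi>)) \<longlonglongrightarrow> u \<phi>" by (simp add: dconv_c0_zero \<phi>)
  moreover have "u (dconv (kern c0) (1 / 2 ^ J) \<phi>) = (\<Sum>j\<le>J. u (blk j \<phi>))" for J
    unfolding sum_blk[OF \<phi>, symmetric] by (intro tempered_sum u blk_schwartz \<phi>)
  ultimately show ?thesis by simp
qed

text \<open>The symbol of the n-th inverse power of minus the Laplacian, cut off to the annulus.
  Since \<open>eta\<close> vanishes near the origin, the convention for division by zero gives the
  correct value 0 there.\<close>

definition etad :: "nat \<Rightarrow> real ^ 'n \<Rightarrow> complex" where
  "etad n \<xi> = eta \<xi> / of_real ((norm \<xi>)\<^sup>2 ^ n)"

lemma etad_schwartz: "etad n \<in> schwartz"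
proof (rule schwartz_compact_support)
  show "smooth (etad n)" unfolding etad_def[abs_def]
    by (rule smooth_div_norm_power[OF eta_smooth, of "1/4"]) (auto simp: eta_zero)
  show "norm x > 8/3 \<Longrightarrow> etad n x = 0" for x by (simp add: etad_def eta_zero')
qed

lemma etad_mult: "etad n \<xi> * of_real ((norm \<xi>)\<^sup>2 ^ n) = eta \<xi>"
  by (cases "\<xi> = 0") (auto simp: etad_def eta_zero)

text \<open>Up to dilation there are only two kernels, one for block 0 and one for all the others;
  hence an L1 bound independent of \<open>j\<close>.\<close>

lemma fatblk_dilate:
  "\<exists>k\<in>schwartz. \<exists>h>0. L1 k \<le> L1 (kern c0) + L1 (kern eta) \<and> (\<forall>\<phi>\<in>schwartz. fatblk j \<phi> = dconv k h \<phi>)"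
proof (cases j)
  case 0
  have "fatblk j \<phi> = dconv (kern c0) (1/2) \<phi>" if "\<phi> \<in> schwartz" for \<phi>
    by (rule ft_inject) (simp_all add: 0 fatblk_schwartz schwartz_dconv schwartz_kern c0_schwartz that ft_fatblk ft_dconv ft_kern)
  then show ?thesis
    by (intro bexI[OF _ schwartz_kern[OF c0_schwartz]] exI[of _ "1/2"]) auto
next
  case (Suc i)
  have "fatblk j \<phi> = dconv (kern eta) (1 / 2 ^ Suc i) \<phi>" if "\<phi> \<in> schwartz" for \<phi>
    by (rule ft_inject) (simp_all add: Suc fatblk_schwartz schwartz_dconv schwartz_kern eta_schwartz that ft_fatblk ft_dconv ft_kern)
  then show ?thesis
    by (intro bexI[OF _ schwartz_kern[OF eta_schwartz]] exI[of _ "1 / 2 ^ Suc i"]) auto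
qed

lemma L1_fatblk_le: "\<exists>C\<ge>0. \<forall>j. \<forall>\<phi>\<in>schwartz. L1 (fatblk j \<phi>) \<le> C * L1 \<phi>"
proof (intro exI conjI allI ballI)
  let ?C = "L1 (kern c0) + L1 (kern eta)"
  show "?C \<ge> 0" by simp
  fix j and \<phi> :: "real^'n \<Rightarrow> complex" assume \<phi>: "\<phi> \<in> schwartz"
  obtain k h where k: "k \<in> schwartz" "L1 k \<le> ?C" "\<And>\<phi>. \<phi> \<in> schwartz \<Longrightarrow> fatblk j \<phi> = dconv k h \<phi>"
    using fatblk_dilate[of j] by blast
  have "L1 (fatblk j \<phi>) \<le> L1 k * L1 \<phi>" unfolding k(3)[OF \<phi>] by (rule L1_dconv_le[OF k(1) \<phi>])
  also have "\<dots> \<le> ?C * L1 \<phi>" using k(2) by (intro mult_right_mono) auto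
  finally show "L1 (fatblk j \<phi>) \<le> ?C * L1 \<phi>" .
qed

lemma L1_fatblk_heat_le: "\<exists>C\<ge>0. \<forall>j h. \<forall>\<phi>\<in>schwartz. L1 (fatblk j (dconv gk h \<phi>)) \<le> C * L1 \<phi>"
proof -
  obtain C where C: "C \<ge> 0" "\<And>j \<phi>. \<phi> \<in> schwartz \<Longrightarrow> L1 (fatblk j \<phi>) \<le> C * L1 \<phi>" using L1_fatblk_le by blast
  have "L1 (fatblk j (dconv gk h \<phi>)) \<le> (C * L1 (gk :: real^'n \<Rightarrow> complex)) * L1 \<phi>" if \<phi>: "\<phi> \<in> schwartz" for j h \<phi>
  proof -
    have "L1 (fatblk j (dconv gk h \<phi>)) \<le> C * L1 (dconv gk h \<phi>)" by (intro C schwartz_dconv schwartz_gk \<phi>)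
    also have "\<dots> \<le> C * (L1 (gk :: real^'n \<Rightarrow> complex) * L1 \<phi>)" by (intro mult_left_mono L1_dconv_le schwartz_gk \<phi> C)
    finally show ?thesis by (simp add: mult.assoc)
  qed
  then show ?thesis using C(1) by (intro exI[of _ "C * L1 (gk :: real^'n \<Rightarrow> complex)"]) auto
qed

text \<open>With h = sqrt r the fourth power is (4^j r)^2. The symbol |xi|^4 exp(-|xi|^2) belongs to
  two Laplacians of the Gaussian, and the compensating |xi|^-4 goes into \<open>etad 2\<close>. That
  is possible only for j >= 1, where the fattened cutoff avoids the origin.\<close>

lemma L1_fatblk_heat_decay:
  "\<exists>C\<ge>0. \<forall>j\<ge>1. \<forall>h>0. \<forall>\<phi>\<in>schwartz. L1 (fatblk j (dconv gk h \<phi>)) \<le> C / (2 ^ j * h) ^ 4 * L1 \<phi>"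
proof (intro exI conjI allI ballI impI)
  define q where "q = (lap ^^ 2) (gk :: real^'n \<Rightarrow> complex)"
  have q: "q \<in> schwartz" unfolding q_def by (intro schwartz_lap_pow schwartz_gk)
  have fq: "ft q \<zeta> = of_real ((norm \<zeta>)\<^sup>2 ^ 2) * ft gk \<zeta>" for \<zeta>
    unfolding q_def ft_lap_pow[OF schwartz_gk] by simp
  have K: "kern (etad 2) \<in> schwartz" by (intro schwartz_kern etad_schwartz)
  let ?C = "L1 (kern (etad 2)) * L1 q"
  show "?C \<ge> 0" by simp
  fix j :: nat and h :: real and \<phi> :: "real^'n \<Rightarrow> complex" assume j: "j \<ge> 1" and h: "h > 0" and \<phi>: "\<phi> \<in> schwartz"
  obtain i where i: "j = Suc i" using j by (cases j) auto
  let ?\<psi> = "dconv (kern (etad 2)) (1 / 2 ^ j) (dconv q h \<phi>)"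
  have \<psi>: "?\<psi> \<in> schwartz" by (intro schwartz_dconv K q \<phi>)
  have "fatblk j (dconv gk h \<phi>) = (\<lambda>x. of_real (1 / (2 ^ j * h) ^ 4) * ?\<psi> x)"
  proof (rule ft_inject)
    fix \<xi> :: "real^'n"
    define \<zeta> where "\<zeta> = (1 / 2 ^ j) *\<^sub>R \<xi>"
    have "(norm (h *\<^sub>R \<xi>))\<^sup>2 ^ 2 = (2 ^ j * h) ^ 4 * (norm \<zeta>)\<^sup>2 ^ 2"
      using h by (simp add: \<zeta>_def power_mult_distrib power_divide flip: power_mult) (simp add: mult.commute)
    then have s: "etad 2 \<zeta> * complex_of_real ((norm (h *\<^sub>R \<xi>))\<^sup>2 ^ 2) = of_real ((2 ^ j * h) ^ 4) * eta \<zeta>"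
      by (simp only: of_real_mult mult.left_commute[of "etad 2 \<zeta>"] etad_mult)
    have "ft ?\<psi> \<xi> = etad 2 \<zeta> * (of_real ((norm (h *\<^sub>R \<xi>))\<^sup>2 ^ 2) * ft gk (h *\<^sub>R \<xi>)) * ft \<phi> \<xi>"
      unfolding ft_dconv[OF K schwartz_dconv[OF q \<phi>]] ft_dconv[OF q \<phi>] ft_kern[OF etad_schwartz] fq \<zeta>_def
      by (simp only: mult.assoc)
    also have "\<dots> = (etad 2 \<zeta> * of_real ((norm (h *\<^sub>R \<xi>))\<^sup>2 ^ 2)) * ft gk (h *\<^sub>R \<xi>) * ft \<phi> \<xi>" by (simp only: mult.assoc)
    also have "\<dots> = of_real ((2 ^ j * h) ^ 4) * (eta \<zeta> * ft gk (h *\<^sub>R \<xi>) * ft \<phi> \<xi>)" unfolding s by (simp only: mult.assoc)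
    finally have "ft (\<lambda>x. of_real (1 / (2 ^ j * h) ^ 4) * ?\<psi> x) \<xi> =
       of_real (1 / (2 ^ j * h) ^ 4) * (of_real ((2 ^ j * h) ^ 4) * (eta \<zeta> * ft gk (h *\<^sub>R \<xi>) * ft \<phi> \<xi>))" 
      by (simp only: ft_cmult)
    also have "\<dots> = of_real (1 / (2 ^ j * h) ^ 4 * (2 ^ j * h) ^ 4) * (eta \<zeta> * ft gk (h *\<^sub>R \<xi>) * ft \<phi> \<xi>)"
      by (simp only: of_real_mult mult.assoc)
    also have "1 / (2 ^ j * h) ^ 4 * (2 ^ j * h) ^ 4 = 1" using h by simp
    also have "of_real 1 * (eta \<zeta> * ft gk (h *\<^sub>R \<xi>) * ft \<phi> \<xi>) = ft (fatblk j (dconv gk h \<phi>)) \<xi>"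
      by (simp add: ft_fatblk schwartz_dconv schwartz_gk \<phi> ft_dconv i \<zeta>_def mult.assoc)
    finally show "ft (fatblk j (dconv gk h \<phi>)) \<xi> = ft (\<lambda>x. of_real (1 / (2 ^ j * h) ^ 4) * ?\<psi> x) \<xi>" ..
  qed (intro fatblk_schwartz schwartz_dconv schwartz_gk schwartz_cmult K q \<phi>)+
  then have "L1 (fatblk j (dconv gk h \<phi>)) = 1 / (2 ^ j * h) ^ 4 * L1 ?\<psi>"
    using h unfolding L1_def by (simp add: norm_mult norm_divide norm_power)
  also have "L1 ?\<psi> \<le> L1 (kern (etad 2)) * L1 (dconv q h \<phi>)" by (intro L1_dconv_le K schwartz_dconv q \<phi>)
  also have "\<dots> \<le> L1 (kern (etad 2)) * (L1 q * L1 \<phi>)" by (intro mult_left_mono L1_dconv_le q \<phi>) simp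
  finally show "L1 (fatblk j (dconv gk h \<phi>)) \<le> ?C / (2 ^ j * h) ^ 4 * L1 \<phi>"
    using h by (simp add: mult_left_mono divide_right_mono mult_ac)
qed

text \<open>Here the derivatives fall on the test function instead of the heat kernel: n Laplacians
  buy the factor 4^(-j n), enough for any exponential growth in \<open>j\<close> once n is
  large.\<close>

lemma L1_fatblk_smooth:
  assumes \<phi>: "\<phi> \<in> schwartz" and j: "j \<ge> 1"
  shows "L1 (fatblk j \<phi>) \<le> L1 (kern (etad n)) * (1 / 4 ^ j) ^ n * L1 ((lap ^^ n) \<phi>)"
proof -
  have K: "kern (etad n) \<in> schwartz" by (intro schwartz_kern etad_schwartz)
  have l: "(lap ^^ n) \<phi> \<in> schwartz" by (rule schwartz_lap_pow[OF \<phi>])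
  obtain i where i: "j = Suc i" using j by (cases j) auto
  let ?\<psi> = "dconv (kern (etad n)) (1 / 2 ^ j) ((lap ^^ n) \<phi>)"
  have \<psi>: "?\<psi> \<in> schwartz" by (intro schwartz_dconv K l)
  have "fatblk j \<phi> = (\<lambda>x. ((-1) ^ n * of_real ((1 / 4 ^ j) ^ n)) * ?\<psi> x)"
  proof (rule ft_inject)
    fix \<xi> :: "real^'n"
    define \<zeta> where "\<zeta> = (1 / 2 ^ j) *\<^sub>R \<xi>"
    have "(1 / 4 ^ j) ^ n * (norm \<xi>)\<^sup>2 ^ n = (norm \<zeta>)\<^sup>2 ^ n"
    proof -
      have "(4::real) ^ j = (2 ^ j)\<^sup>2" by (simp add: power2_eq_square flip: power_mult_distrib)
      then show ?thesis by (simp add: \<zeta>_def power_mult_distrib power_divide)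
    qed
    then have s: "of_real ((1 / 4 ^ j) ^ n) * (etad n \<zeta> * complex_of_real ((norm \<xi>)\<^sup>2 ^ n)) = eta \<zeta>"
      using etad_mult[of n \<zeta>] by (metis of_real_mult mult.left_commute)
    have "ft ?\<psi> \<xi> = etad n \<zeta> * ((-1) ^ n * of_real ((norm \<xi>)\<^sup>2 ^ n) * ft \<phi> \<xi>)"
      by (simp add: ft_dconv K l ft_kern etad_schwartz \<zeta>_def ft_lap_pow \<phi>)
    then have "ft (\<lambda>x. ((-1) ^ n * of_real ((1 / 4 ^ j) ^ n)) * ?\<psi> x) \<xi> =
       ((-1) ^ n * (-1) ^ n) * (of_real ((1 / 4 ^ j) ^ n) * (etad n \<zeta> * complex_of_real ((norm \<xi>)\<^sup>2 ^ n))) * ft \<phi> \<xi>"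
      unfolding ft_cmult by (simp only: mult_ac)
    also have "\<dots> = eta \<zeta> * ft \<phi> \<xi>" unfolding s by (simp flip: power_mult_distrib)
    also have "\<dots> = ft (fatblk j \<phi>) \<xi>" by (simp add: ft_fatblk \<phi> i \<zeta>_def)
    finally show "ft (fatblk j \<phi>) \<xi> = ft (\<lambda>x. ((-1) ^ n * of_real ((1 / 4 ^ j) ^ n)) * ?\<psi> x) \<xi>" ..
  qed (intro fatblk_schwartz schwartz_cmult \<phi> \<psi>)+
  then have "L1 (fatblk j \<phi>) = (1 / 4 ^ j) ^ n * L1 ?\<psi>"
    unfolding L1_def by (simp add: norm_mult norm_divide norm_power)
  also have "L1 ?\<psi> \<le> L1 (kern (etad n)) * L1 ((lap ^^ n) \<phi>)" by (intro L1_dconv_le K l)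
  finally show ?thesis by (simp add: mult_left_mono mult_ac)
qed

text \<open>The heat operator commutes with the fattened block and then costs only the L1 norm of
  \<open>gk\<close>, so the bound is uniform in \<open>h\<close>. Block 0, which gains nothing, is
  estimated by the same seminorm.\<close>

lemma L1_fatblk_heat_smooth:
  "\<exists>C\<ge>0. \<forall>j h. \<forall>\<phi>\<in>schwartz. L1 (fatblk j (dconv gk h \<phi>)) \<le> C * (1 / 4 ^ j) ^ n * schwartz_seminorm (2 * CARD('n) + 2 * n) \<phi>"
proof -
  let ?N = "2 * CARD('n) + 2 * n" and ?G = "L1 (gk :: real^'n \<Rightarrow> complex)"
  obtain C0 where C0: "C0 \<ge> 0" "\<And>j \<phi>. \<phi> \<in> schwartz \<Longrightarrow> L1 (fatblk j \<phi>) \<le> C0 * L1 \<phi>" using L1_fatblk_le by blast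
  obtain D where D: "D \<ge> 0" "\<And>f :: real^'n \<Rightarrow> complex. f \<in> schwartz \<Longrightarrow> L1 ((lap ^^ n) f) \<le> D * schwartz_seminorm ?N f"
    using L1_lap_pow_le[where n = n and 'n = 'n] by blast
  define C where "C = ?G * (C0 * wint TYPE('n) + L1 (kern (etad n)) * D)"
  have nn: "C0 * wint TYPE('n) \<ge> 0" "L1 (kern (etad n)) * D \<ge> 0" using C0(1) D(1) wint_nonneg[where 'n='n] by auto
  have "L1 (fatblk j (dconv gk h \<phi>)) \<le> C * (1 / 4 ^ j) ^ n * schwartz_seminorm ?N \<phi>" if \<phi>: "\<phi> \<in> schwartz" for j h \<phi>
  proof -
    let ?S = "schwartz_seminorm ?N \<phi>"
    have S: "?S \<ge> 0" using \<phi> by (rule schwartz_seminorm_nonneg)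
    have "L1 (fatblk j \<phi>) \<le> (C0 * wint TYPE('n) + L1 (kern (etad n)) * D) * ((1 / 4 ^ j) ^ n * ?S)"
    proof (cases "j = 0")
      case True
      have "L1 \<phi> \<le> ?S * wint TYPE('n)"
        unfolding L1_def
      proof (rule integrable_of_weighted_bound(2)[OF schwartz_borel[OF \<phi>]])
        fix x
        have "(1 + norm x) ^ (2 * CARD('n)) * norm (\<phi> x) \<le> (1 + norm x) ^ ?N * norm (\<phi> x)"
          by (intro mult_right_mono power_increasing) auto
        also have "\<dots> \<le> ?S" using schwartz_seminorm_bound[OF \<phi>, of "[]" ?N x] by simp
        finally show "(1 + norm x) ^ (2 * CARD('n)) * norm (\<phi> x) \<le> ?S" .
      qed
      then have "L1 (fatblk j \<phi>) \<le> C0 * (?S * wint TYPE('n))"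
        using C0 \<phi> by (meson mult_left_mono order.trans)
      also have "\<dots> \<le> (C0 * wint TYPE('n) + L1 (kern (etad n)) * D) * ?S"
        using mult_nonneg_nonneg[OF nn(2) S] by (simp add: algebra_simps)
      finally show ?thesis using True by simp
    next
      case False
      then have "L1 (fatblk j \<phi>) \<le> L1 (kern (etad n)) * (1 / 4 ^ j) ^ n * L1 ((lap ^^ n) \<phi>)"
        by (intro L1_fatblk_smooth \<phi>) simp
      also have "\<dots> \<le> L1 (kern (etad n)) * (1 / 4 ^ j) ^ n * (D * ?S)"
        by (intro mult_left_mono D \<phi>) simp
      also have "\<dots> = (L1 (kern (etad n)) * D) * ((1 / 4 ^ j) ^ n * ?S)" by simp
      also have "\<dots> \<le> (C0 * wint TYPE('n) + L1 (kern (etad n)) * D) * ((1 / 4 ^ j) ^ n * ?S)"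
        using nn S by (intro mult_right_mono) auto
      finally show ?thesis .
    qed
    then have "?G * L1 (fatblk j \<phi>) \<le> ?G * ((C0 * wint TYPE('n) + L1 (kern (etad n)) * D) * ((1 / 4 ^ j) ^ n * ?S))"
      by (intro mult_left_mono) auto
    moreover have "L1 (fatblk j (dconv gk h \<phi>)) \<le> ?G * L1 (fatblk j \<phi>)"
      unfolding dconv_fatblk_commute[OF schwartz_gk \<phi>, symmetric] by (intro L1_dconv_le schwartz_gk fatblk_schwartz \<phi>)
    ultimately show ?thesis by (simp add: C_def mult_ac)
  qed
  moreover have "C \<ge> 0" unfolding C_def using nn by auto
  ultimately show ?thesis by blast
qed

text \<open>The order and constant in \<open>tempered u\<close> depend on \<open>u\<close>; here
  they are replaced by ones depending only on beta and the block bound \<open>N\<close>. The value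
  of \<open>u\<close> is the limit of its block sums, and each term is made geometrically small by
  the smoothness of the test function.\<close>

lemma tempered_heat_bound:
  "\<exists>C\<ge>0. \<exists>M. \<forall>u N h. \<forall>\<phi>\<in>schwartz. tempered u \<longrightarrow> N \<ge> 0 \<longrightarrow>
     (\<forall>j. \<forall>\<psi>\<in>schwartz. norm (u (blk j \<psi>)) \<le> N * 2 powr (real j * \<beta>) * L1 \<psi>) \<longrightarrow>
     norm (u (dconv gk h \<phi>)) \<le> C * N * schwartz_seminorm M \<phi>"
proof -
  \<comment> \<open>Large enough that 2^(j beta) 4^(-j n) <= 2^(-j), that is, 2 n >= beta +
    1.\<close>
  define n where "n = nat \<lceil>\<bar>\<beta>\<bar> + 1\<rceil>"
  have n: "2 * real n \<ge> \<beta> + 1" unfolding n_def by linarith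
  let ?M = "2 * CARD('n) + 2 * n"
  obtain C where C: "C \<ge> 0" "\<And>j h \<phi>. \<phi> \<in> schwartz \<Longrightarrow> L1 (fatblk j (dconv gk h \<phi>)) \<le> C * (1 / 4 ^ j) ^ n * schwartz_seminorm ?M \<phi>"
    using L1_fatblk_heat_smooth[of n] by blast
  have p: "2 powr (real j * \<beta>) * (1 / 4 ^ j) ^ n \<le> (1 / 2) ^ j" for j
  proof -
    have "(1 / 4 ^ j) ^ n = 2 powr (- (real j * (2 * real n)))"
    proof -
      have "(1 / 4 ^ j) ^ n = inverse ((2::real) ^ (2 * j * n))"
        by (simp add: power_mult power_one_over inverse_eq_divide)
      moreover have "real j * (2 * real n) = real (2 * j * n)" by simp
      ultimately show ?thesis by (simp only: powr_minus powr_realpow zero_less_numeral)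
    qed
    then have "2 powr (real j * \<beta>) * (1 / 4 ^ j) ^ n = 2 powr (real j * (\<beta> - 2 * real n))"
      by (simp add: powr_add[symmetric] algebra_simps)
    also have "\<dots> \<le> 2 powr (real j * (-1))" using n by (intro powr_mono mult_left_mono) auto
    also have "\<dots> = (1 / 2) ^ j"
      by (simp only: mult_minus_right mult_1_right powr_minus powr_realpow zero_less_numeral) (simp add: power_one_over inverse_eq_divide)
    finally show ?thesis .
  qed
  have "norm (u (dconv gk h \<phi>)) \<le> (2 * C) * N * schwartz_seminorm ?M \<phi>"
    if \<phi>: "\<phi> \<in> schwartz" and u: "tempered u" and N: "N \<ge> 0"
    and b: "\<And>j \<psi>. \<psi> \<in> schwartz \<Longrightarrow> norm (u (blk j \<psi>)) \<le> N * 2 powr (real j * \<beta>) * L1 \<psi>" for u N h \<phi>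
  proof -
    let ?P = "dconv gk h \<phi>" and ?S = "schwartz_seminorm ?M \<phi>"
    have P: "?P \<in> schwartz" by (intro schwartz_dconv schwartz_gk \<phi>)
    have S: "?S \<ge> 0" using \<phi> by (rule schwartz_seminorm_nonneg)
    have t: "norm (u (blk j ?P)) \<le> N * C * ?S * (1 / 2) ^ j" for j
    proof -
      have "norm (u (blk j ?P)) \<le> N * 2 powr (real j * \<beta>) * L1 (fatblk j ?P)"
        using b[OF fatblk_schwartz[OF P], of j j] by (simp add: blk_fatblk[OF P])
      also have "\<dots> \<le> N * 2 powr (real j * \<beta>) * (C * (1 / 4 ^ j) ^ n * ?S)"
        using N by (intro mult_left_mono C \<phi>) auto
      also have "\<dots> = N * C * ?S * (2 powr (real j * \<beta>) * (1 / 4 ^ j) ^ n)" by (simp only: mult_ac)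
      also have "\<dots> \<le> N * C * ?S * (1 / 2) ^ j" using N C(1) S by (intro mult_left_mono p) auto
      finally show ?thesis .
    qed
    have "norm (\<Sum>j\<le>J. u (blk j ?P)) \<le> 2 * C * N * ?S" for J
    proof -
      have "norm (\<Sum>j\<le>J. u (blk j ?P)) \<le> (\<Sum>j\<le>J. N * C * ?S * (1 / 2) ^ j)"
        by (intro order.trans[OF norm_sum] sum_mono t)
      also have "\<dots> = N * C * ?S * (\<Sum>j\<le>J. (1 / 2) ^ j)" by (simp only: sum_distrib_left)
      also have "\<dots> \<le> N * C * ?S * 2"
      proof (rule mult_left_mono)
        have "(\<Sum>j\<le>J. (1 / 2 :: real) ^ j) \<le> (\<Sum>j. (1 / 2) ^ j)"
          by (intro sum_le_suminf summable_geometric) auto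
        then show "(\<Sum>j\<le>J. (1 / 2 :: real) ^ j) \<le> 2" by (simp add: suminf_geometric)
      qed (use N C(1) S in auto)
      finally show ?thesis by (simp only: mult_ac)
    qed
    moreover have "(\<lambda>J. norm (\<Sum>j\<le>J. u (blk j ?P))) \<longlonglongrightarrow> norm (u ?P)"
      by (intro tendsto_norm tempered_sum_blk_tendsto u P)
    ultimately show ?thesis by (intro LIMSEQ_le_const2) auto
  qed
  then show ?thesis using C(1) by (intro exI[of _ "2 * C"] conjI exI[of _ ?M]) auto
qed

end

subsection \<open>Representing bounded band-limited functionals\<close>

lemma schwartz_translate: "k \<in> schwartz \<Longrightarrow> (\<lambda>y. k (y - x)) \<in> schwartz"
  using schwartz_affine[of k 1 "- x"] by simp

lemma L1_translate: "k \<in> schwartz \<Longrightarrow> L1 (\<lambda>y. k (y - x)) = L1 k"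
  unfolding L1_def using lborel_integral_translate[of "\<lambda>y. norm (k y)" "- x"] schwartz_borel[of k] by simp

text \<open>Continuity of translation in L1, made quantitative by the weighted mean value estimate
  with the integrable weight.\<close>

lemma L1_translate_diff_tendsto:
  fixes k :: "real^'n::finite \<Rightarrow> complex"
  assumes k: "k \<in> schwartz" and X: "X \<longlonglongrightarrow> x"
  shows "(\<lambda>n. L1 (\<lambda>y. k (y - x) - k (y - X n))) \<longlonglongrightarrow> 0"
proof -
  obtain C where C: "C \<ge> 0" "\<And>y u v. (1 + norm y) ^ (2 * CARD('n)) * norm (k (y + u) - k (y + v)) \<le>
      C * norm (u - v) * (1 + max (norm u) (norm v)) ^ (2 * CARD('n))"
    using schwartz_mean_value[OF k] by blast
  define b where "b n = C * norm (x - X n) * (1 + max (norm x) (norm (X n))) ^ (2 * CARD('n)) * wint TYPE('n)" for n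
  have "(\<lambda>n. norm (x - X n)) \<longlonglongrightarrow> norm (x - x)" by (intro tendsto_intros X)
  then have 1: "(\<lambda>n. norm (x - X n)) \<longlonglongrightarrow> 0" by simp
  have 2: "(\<lambda>n. (1 + max (norm x) (norm (X n))) ^ (2 * CARD('n))) \<longlonglongrightarrow> (1 + max (norm x) (norm x)) ^ (2 * CARD('n))"
    by (intro tendsto_intros X)
  have "b \<longlonglongrightarrow> C * 0 * (1 + max (norm x) (norm x)) ^ (2 * CARD('n)) * wint TYPE('n)"
    unfolding b_def by (rule tendsto_mult[OF tendsto_mult[OF tendsto_mult[OF tendsto_const 1] 2] tendsto_const])
  then have b0: "b \<longlonglongrightarrow> 0" by simp
  have "norm (L1 (\<lambda>y. k (y - x) - k (y - X n))) \<le> b n" for n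
  proof -
    have "L1 (\<lambda>y. k (y - x) - k (y - X n)) \<le> C * norm (x - X n) * (1 + max (norm x) (norm (X n))) ^ (2 * CARD('n)) * wint TYPE('n)"
      unfolding L1_def
    proof (rule integrable_of_weighted_bound(2))
      show "(\<lambda>y. k (y - x) - k (y - X n)) \<in> borel_measurable borel"
        by (intro schwartz_borel schwartz_diff schwartz_translate k)
      show "(1 + norm y) ^ (2 * CARD('n)) * norm (k (y - x) - k (y - X n)) \<le> C * norm (x - X n) * (1 + max (norm x) (norm (X n))) ^ (2 * CARD('n))" for y
        using C(2)[of y "- x" "- X n"] by (simp add: norm_minus_commute)
    qed
    then show ?thesis by (simp add: b_def)
  qed
  then show ?thesis by (intro Lim_null_comparison[OF always_eventually b0]) auto
qed

text \<open>For \<open>h > 0\<close> the dilation moves into the kernel. The result is an ordinary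
  convolution, a superposition of translates of one fixed function.\<close>

lemma dconv_rescale:
  fixes k :: "real^'n::finite \<Rightarrow> complex"
  assumes k: "k \<in> schwartz" and h: "h > 0"
  obtains k' where "k' \<in> schwartz" "L1 k' = L1 k" "\<And>\<phi> y. \<phi> \<in> schwartz \<Longrightarrow> dconv k h \<phi> y = (LINT x|lborel. \<phi> x * k' (y - x))"
proof
  define k' where "k' x = of_real ((1 / h) ^ CARD('n)) * k ((1 / h) *\<^sub>R x)" for x
  have kh: "(\<lambda>x. k ((1 / h) *\<^sub>R x)) \<in> schwartz" using schwartz_affine[OF k, of "1/h" 0] h by simp
  show k': "k' \<in> schwartz" unfolding k'_def[abs_def] by (intro schwartz_cmult kh)
  have [measurable]: "k \<in> borel_measurable borel" "k' \<in> borel_measurable borel" using k k' by (auto intro: schwartz_borel)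
  show "L1 k' = L1 k"
    unfolding L1_def using h lborel_integral_affine[of h "\<lambda>x. norm (k' x)" 0]
    by (simp add: k'_def norm_mult norm_power norm_divide power_divide)
  fix \<phi> :: "real^'n \<Rightarrow> complex" and y assume \<phi>: "\<phi> \<in> schwartz"
  have [measurable]: "\<phi> \<in> borel_measurable borel" using \<phi> by (rule schwartz_borel)
  have m: "(\<lambda>x. \<phi> x * k' (y - x)) \<in> borel_measurable borel" by measurable
  have "(LINT x|lborel. \<phi> x * k' (y - x)) = h ^ CARD('n) *\<^sub>R (LINT z|lborel. of_real ((1 / h) ^ CARD('n)) * (k z * \<phi> (y - h *\<^sub>R z)))"
    using h lborel_integral_affine[OF _ m, of "- h" y] by (simp add: k'_def mult_ac)
  also have "\<dots> = of_real (h ^ CARD('n) * (1 / h) ^ CARD('n)) * dconv k h \<phi> y"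
    by (simp only: integral_mult_right_zero scaleR_conv_of_real of_real_mult mult.assoc dconv_def)
  also have "h ^ CARD('n) * (1 / h) ^ CARD('n) = 1" using h by (simp add: power_divide)
  finally show "dconv k h \<phi> y = (LINT x|lborel. \<phi> x * k' (y - x))" by simp
qed

text \<open>
  The simple functions \<open>F n \<longlonglongrightarrow> id\<close> turn the convolution into a finite linear combination of translates of
  the kernel, which converges in \<open>L\<^sup>1\<close>; there is no need for integrals with values in the Schwartz space.
\<close>

proposition represent_band_limited:
  fixes L :: "(real^'n::finite \<Rightarrow> complex) \<Rightarrow> complex"
  assumes add: "\<And>\<phi> \<psi>. \<phi> \<in> schwartz \<Longrightarrow> \<psi> \<in> schwartz \<Longrightarrow> L (\<lambda>x. \<phi> x + \<psi> x) = L \<phi> + L \<psi>"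
    and cmult: "\<And>c \<phi>. \<phi> \<in> schwartz \<Longrightarrow> L (\<lambda>x. c * \<phi> x) = c * L \<phi>"
    and bound: "\<And>\<phi>. \<phi> \<in> schwartz \<Longrightarrow> norm (L \<phi>) \<le> M * L1 \<phi>" and M: "M \<ge> 0"
    and k: "k \<in> schwartz" and h: "h > 0" and band: "\<And>\<phi>. \<phi> \<in> schwartz \<Longrightarrow> L (dconv k h \<phi>) = L \<phi>"
  obtains g where "g \<in> borel_measurable borel" "\<And>x. norm (g x) \<le> M * L1 k"
    "\<And>\<phi>. \<phi> \<in> schwartz \<Longrightarrow> integrable lborel (\<lambda>x. g x * \<phi> x)"
    "\<And>\<phi>. \<phi> \<in> schwartz \<Longrightarrow> L \<phi> = (LINT x|lborel. g x * \<phi> x)"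
proof -
  obtain e where e: "e \<in> schwartz" "L1 e = L1 k"
    "\<And>\<phi> y. \<phi> \<in> schwartz \<Longrightarrow> dconv k h \<phi> y = (LINT x|lborel. \<phi> x * e (y - x))" using dconv_rescale[OF k h] by metis
  have [measurable]: "e \<in> borel_measurable borel" using e(1) by (rule schwartz_borel)
  have diff: "L (\<lambda>x. \<phi> x - \<psi> x) = L \<phi> - L \<psi>" if "\<phi> \<in> schwartz" "\<psi> \<in> schwartz" for \<phi> \<psi>
    using add[OF that(1) schwartz_cmult[OF that(2), of "-1"]] cmult[OF that(2), of "-1"] by simp
  have zero: "L (\<lambda>x. 0) = 0" using cmult[OF schwartz_zero, of 0] by simp
  have sum: "L (\<lambda>x. \<Sum>i\<in>I. f i x) = (\<Sum>i\<in>I. L (f i))" if "\<And>i. i \<in> I \<Longrightarrow> f i \<in> schwartz" for I and f :: "real^'n \<Rightarrow> real^'n \<Rightarrow> complex"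
    using that by (induction I rule: infinite_finite_induct) (auto simp: zero add schwartz_sum)
  \<comment> \<open>Formally, \<open>L\<close> applied to the convolution of \<open>\<phi>\<close>
    with \<open>e\<close> is the integral of \<open>\<phi> x\<close> times \<open>L\<close> of the
    translate of \<open>e\<close> by \<open>x\<close>; the invariance \<open>band\<close> then makes
    this the only possible density.\<close>
  define g where "g x = L (\<lambda>y. e (y - x))" for x
  have gb: "norm (g x) \<le> M * L1 k" for x
    unfolding g_def using bound[OF schwartz_translate[OF e(1)], of x] by (simp add: L1_translate e)
  \<comment> \<open>Rounding points by \<open>F n\<close> leaves finitely many translates. It also
    makes \<open>g\<close> measurable, as a pointwise limit of the simple functions x to
    \<open>g (F n x)\<close>.\<close>
  have "id \<in> borel_measurable (lborel :: (real^'n) measure)" by simp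
  from borel_measurable_implies_sequence_metric[OF this, of 0] obtain F where
    F: "\<And>n. simple_function (lborel :: (real^'n) measure) (F n)" "\<And>x. (\<lambda>n. F n x) \<longlonglongrightarrow> x" by auto
  have Fm [measurable]: "F n \<in> borel_measurable borel" for n
    using borel_measurable_simple_function[OF F(1)[of n]] by simp
  have fin: "finite (range (F n))" for n using simple_functionD(1)[OF F(1)[of n]] by simp
  have gF: "(\<lambda>n. g (F n x)) \<longlonglongrightarrow> g x" for x
  proof -
    have "norm (g (F n x) - g x) \<le> M * L1 (\<lambda>y. e (y - x) - e (y - F n x))" for n
    proof -
      have "norm (g (F n x) - g x) = norm (L (\<lambda>y. e (y - x) - e (y - F n x)))"
        unfolding g_def by (subst diff) (auto intro: schwartz_translate e(1) simp: norm_minus_commute)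
      then show ?thesis using bound[OF schwartz_diff[OF schwartz_translate[OF e(1)] schwartz_translate[OF e(1)]]] by simp
    qed
    note 1 = this
    have 2: "(\<lambda>n. M * L1 (\<lambda>y. e (y - x) - e (y - F n x))) \<longlonglongrightarrow> 0"
      using tendsto_mult_right_zero[OF L1_translate_diff_tendsto[OF e(1) F(2)]] .
    show ?thesis
      by (rule LIM_zero_cancel, rule Lim_null_comparison[OF always_eventually[OF allI[OF 1]] 2])
  qed
  have gFm [measurable]: "(\<lambda>x. g (F n x)) \<in> borel_measurable borel" for n
    using borel_measurable_simple_function[OF simple_function_compose1[OF F(1)[of n], of g]] by simp
  have gm [measurable]: "g \<in> borel_measurable borel"
    by (rule borel_measurable_LIMSEQ_metric[of "\<lambda>n x. g (F n x)"]) (use gF gFm in auto)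
  have gi: "integrable lborel (\<lambda>x. g x * \<phi> x)" if \<phi>: "\<phi> \<in> schwartz" for \<phi>
  proof (rule Bochner_Integration.integrable_bound)
    show "integrable lborel (\<lambda>x. (M * L1 k) * norm (\<phi> x))"
      by (intro integrable_mult_right integrable_norm schwartz_integrable \<phi>)
    show "(\<lambda>x. g x * \<phi> x) \<in> borel_measurable lborel" using schwartz_borel[OF \<phi>] by simp
    show "AE x in lborel. norm (g x * \<phi> x) \<le> norm ((M * L1 k) * norm (\<phi> x))"
      using gb M by (auto simp: norm_mult intro!: mult_right_mono)
  qed
  have rep: "L \<phi> = (LINT x|lborel. g x * \<phi> x)" if \<phi>: "\<phi> \<in> schwartz" for \<phi>
  proof -
    have [measurable]: "\<phi> \<in> borel_measurable borel" using \<phi> by (rule schwartz_borel)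
    have \<phi>i: "integrable lborel \<phi>" using \<phi> by (rule schwartz_integrable)
    \<comment> \<open>Quadrature weights: the integral of \<open>\<phi>\<close> over the set that
      \<open>F n\<close> rounds to \<open>d\<close>.\<close>
    define c where "c n d = (LINT x|lborel. indicator {x. F n x = d} x *\<^sub>R \<phi> x)" for n d
    have ci: "integrable lborel (\<lambda>x. indicator {x. F n x = d} x *\<^sub>R \<phi> x)" for n d
      by (rule Bochner_Integration.integrable_bound[OF \<phi>i]) (auto simp: indicator_def)
    have csum: "(\<Sum>d\<in>range (F n). c n d * u d) = (LINT x|lborel. \<phi> x * u (F n x))" for n and u :: "real^'n \<Rightarrow> complex"
    proof -
      have "(\<Sum>d\<in>range (F n). c n d * u d) = (\<Sum>d\<in>range (F n). LINT x|lborel. indicator {x. F n x = d} x *\<^sub>R \<phi> x * u d)"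
        unfolding c_def by (intro sum.cong refl integral_mult_left_zero[symmetric])
      also have "\<dots> = (LINT x|lborel. (\<Sum>d\<in>range (F n). indicator {x. F n x = d} x *\<^sub>R \<phi> x * u d))"
        by (rule Bochner_Integration.integral_sum[symmetric]) (intro integrable_mult_left ci)
      also have "\<dots> = (LINT x|lborel. \<phi> x * u (F n x))"
      proof (intro Bochner_Integration.integral_cong refl)
        fix x
        have "(\<Sum>d\<in>range (F n). indicator {x. F n x = d} x *\<^sub>R \<phi> x * u d) = (\<Sum>d\<in>range (F n). if d = F n x then \<phi> x * u d else 0)"
          by (intro sum.cong) (auto simp: indicator_def)
        then show "(\<Sum>d\<in>range (F n). indicator {x. F n x = d} x *\<^sub>R \<phi> x * u d) = \<phi> x * u (F n x)"
          using fin by simp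
      qed
      finally show ?thesis .
    qed
    define \<psi> where "\<psi> n y = (\<Sum>d\<in>range (F n). c n d * e (y - d))" for n y
    have \<psi>: "\<psi> n \<in> schwartz" for n
      unfolding \<psi>_def[abs_def] by (intro schwartz_sum schwartz_cmult schwartz_translate e(1))
    have L\<psi>: "L (\<psi> n) = (LINT x|lborel. \<phi> x * g (F n x))" for n
    proof -
      have "L (\<psi> n) = (\<Sum>d\<in>range (F n). L (\<lambda>y. c n d * e (y - d)))"
        unfolding \<psi>_def[abs_def] by (rule sum) (intro schwartz_cmult schwartz_translate e(1))
      also have "\<dots> = (\<Sum>d\<in>range (F n). c n d * g d)"
        unfolding g_def by (intro sum.cong refl cmult schwartz_translate e(1))
      finally show ?thesis by (simp only: csum)
    qed
    have lim1: "(\<lambda>n. L (\<psi> n)) \<longlonglongrightarrow> (LINT x|lborel. \<phi> x * g x)"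
      unfolding L\<psi>
    proof (rule integral_dominated_convergence)
      show "integrable lborel (\<lambda>x. (M * L1 k) * norm (\<phi> x))" using \<phi>i by simp
      show "AE x in lborel. (\<lambda>n. \<phi> x * g (F n x)) \<longlonglongrightarrow> \<phi> x * g x" using gF by (auto intro!: tendsto_intros)
      show "AE x in lborel. norm (\<phi> x * g (F n x)) \<le> (M * L1 k) * norm (\<phi> x)" for n
        using gb by (auto simp: norm_mult mult.commute[of "norm (\<phi> _)"] intro!: mult_right_mono)
    qed measurable
    let ?D = "dconv k h \<phi>"
    have D: "?D \<in> schwartz" by (rule schwartz_dconv[OF k \<phi>])
    \<comment> \<open>The L1 error of replacing the translate by \<open>x\<close> with the one by
      \<open>F n x\<close>. Averaged against \<open>\<phi>\<close>, it controls the distance of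
      \<open>\<psi> n\<close> from the convolution, and it is at most twice the L1 norm of
      \<open>e\<close>, which permits dominated convergence.\<close>
    define W where "W n x = L1 (\<lambda>y. e (y - x) - e (y - F n x))" for n x
    have W: "0 \<le> W n x" "W n x \<le> 2 * L1 e" for n x
    proof -
      show "0 \<le> W n x" by (simp add: W_def)
      have i: "integrable lborel (\<lambda>y. e (y - z))" for z by (intro schwartz_integrable schwartz_translate e(1))
      have "W n x \<le> (LINT y|lborel. norm (e (y - x)) + norm (e (y - F n x)))"
        unfolding W_def L1_def using i by (intro integral_mono) (auto intro: norm_triangle_ineq4)
      also have "\<dots> = L1 (\<lambda>y. e (y - x)) + L1 (\<lambda>y. e (y - F n x))" unfolding L1_def using i by simp
      finally show "W n x \<le> 2 * L1 e" by (simp add: L1_translate e(1))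
    qed
    have Wm [measurable]: "W n \<in> borel_measurable borel" for n
      unfolding W_def[abs_def] L1_def by measurable
    have L1b: "L1 (\<lambda>y. ?D y - \<psi> n y) \<le> (LINT x|lborel. norm (\<phi> x) * W n x)" for n
    proof -
      have Wi: "integrable lborel (\<lambda>x. norm (\<phi> x) * W n x)"
      proof (rule Bochner_Integration.integrable_bound)
        show "integrable lborel (\<lambda>x. (2 * L1 e) * norm (\<phi> x))" using \<phi>i by simp
        show "AE x in lborel. norm (norm (\<phi> x) * W n x) \<le> norm ((2 * L1 e) * norm (\<phi> x))"
          using W by (auto simp: mult.commute[of "norm (\<phi> _)"] intro!: mult_right_mono)
      qed measurable
      have i: "integrable lborel (\<lambda>y. e (y - z))" for z by (intro schwartz_integrable schwartz_translate e(1))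
      have pair: "integrable (lborel \<Otimes>\<^sub>M lborel) (\<lambda>(x, y). norm (\<phi> x * (e (y - x) - e (y - F n x))))"
      proof (rule lborel_pair.Fubini_integrable)
        show "integrable lborel (\<lambda>x. LINT y|lborel. norm (case (x, y) of (x, y) \<Rightarrow> norm (\<phi> x * (e (y - x) - e (y - F n x)))))"
          using Wi by (simp add: norm_mult W_def L1_def)
        show "AE x in lborel. integrable lborel (\<lambda>y. case (x, y) of (x, y) \<Rightarrow> norm (\<phi> x * (e (y - x) - e (y - F n x))))"
          using i by simp
      qed measurable
      have ei: "integrable lborel (\<lambda>x. \<phi> x * e (y - v x))" if "v \<in> borel_measurable borel" for y and v :: "real^'n \<Rightarrow> real^'n"
      proof -
        obtain C where C: "C \<ge> 0" "\<And>x. norm (e x) \<le> C" using schwartz_bounded[OF e(1)] by blast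
        have [measurable]: "v \<in> borel_measurable borel" by fact
        show ?thesis
        proof (rule Bochner_Integration.integrable_bound)
          show "integrable lborel (\<lambda>x. C * norm (\<phi> x))" using \<phi>i by simp
          show "AE x in lborel. norm (\<phi> x * e (y - v x)) \<le> norm (C * norm (\<phi> x))"
            using C by (auto simp: norm_mult mult.commute[of "norm (\<phi> _)"] intro!: mult_right_mono)
        qed measurable
      qed
      have Dpsi: "?D y - \<psi> n y = (LINT x|lborel. \<phi> x * (e (y - x) - e (y - F n x)))" for y
      proof -
        have "?D y - \<psi> n y = (LINT x|lborel. \<phi> x * e (y - x)) - (LINT x|lborel. \<phi> x * e (y - F n x))"
          unfolding e(3)[OF \<phi>] \<psi>_def csum ..
        also have "\<dots> = (LINT x|lborel. \<phi> x * e (y - x) - \<phi> x * e (y - F n x))"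
          using ei[of "\<lambda>x. x" y] ei[of "F n" y] by simp
        finally show ?thesis by (simp add: right_diff_distrib)
      qed
      have "L1 (\<lambda>y. ?D y - \<psi> n y) \<le> (LINT y|lborel. (LINT x|lborel. norm (\<phi> x * (e (y - x) - e (y - F n x)))))"
        unfolding L1_def
      proof (rule integral_mono)
        show "integrable lborel (\<lambda>y. norm (?D y - \<psi> n y))"
          by (intro integrable_norm schwartz_integrable schwartz_diff D \<psi>)
        show "integrable lborel (\<lambda>y. LINT x|lborel. norm (\<phi> x * (e (y - x) - e (y - F n x))))"
          by (rule lborel_pair.integrable_snd[OF pair])
        show "norm (?D y - \<psi> n y) \<le> (LINT x|lborel. norm (\<phi> x * (e (y - x) - e (y - F n x))))" for y
          unfolding Dpsi by (rule integral_norm_bound)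
      qed
      also have "\<dots> = (LINT x|lborel. (LINT y|lborel. norm (\<phi> x * (e (y - x) - e (y - F n x)))))"
        by (rule lborel_pair.Fubini_integral[OF pair])
      also have "\<dots> = (LINT x|lborel. norm (\<phi> x) * W n x)" by (simp add: norm_mult W_def L1_def)
      finally show ?thesis .
    qed
    have lim0: "(\<lambda>n. LINT x|lborel. norm (\<phi> x) * W n x) \<longlonglongrightarrow> (LINT x|(lborel :: (real^'n) measure). 0)"
    proof (rule integral_dominated_convergence)
      show "integrable lborel (\<lambda>x. (2 * L1 e) * norm (\<phi> x))" using \<phi>i by simp
      have "(\<lambda>n. norm (\<phi> x) * W n x) \<longlonglongrightarrow> 0" for x
        unfolding W_def by (rule tendsto_mult_right_zero[OF L1_translate_diff_tendsto[OF e(1) F(2)]])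
      then show "AE x in lborel. (\<lambda>n. norm (\<phi> x) * W n x) \<longlonglongrightarrow> 0" by simp
      show "AE x in lborel. norm (norm (\<phi> x) * W n x) \<le> (2 * L1 e) * norm (\<phi> x)" for n
        using W by (auto simp: mult.commute[of "norm (\<phi> _)"] intro!: mult_right_mono)
    qed measurable
    have 1: "norm (L (\<psi> n) - L \<phi>) \<le> M * (LINT x|lborel. norm (\<phi> x) * W n x)" for n
    proof -
      have "norm (L (\<psi> n) - L \<phi>) = norm (L (\<lambda>y. ?D y - \<psi> n y))"
        unfolding diff[OF D \<psi>] band[OF \<phi>] by (rule norm_minus_commute)
      also have "\<dots> \<le> M * L1 (\<lambda>y. ?D y - \<psi> n y)" by (intro bound schwartz_diff D \<psi>)
      also have "\<dots> \<le> M * (LINT x|lborel. norm (\<phi> x) * W n x)" by (intro mult_left_mono L1b M)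
      finally show ?thesis .
    qed
    have 2: "(\<lambda>n. M * (LINT x|lborel. norm (\<phi> x) * W n x)) \<longlonglongrightarrow> 0"
      using tendsto_mult_right_zero[of _ sequentially M] lim0 by simp
    have "(\<lambda>n. L (\<psi> n)) \<longlonglongrightarrow> L \<phi>"
      by (rule LIM_zero_cancel, rule Lim_null_comparison[OF always_eventually[OF allI[OF 1]] 2])
    then have "L \<phi> = (LINT x|lborel. \<phi> x * g x)" using lim1 by (rule LIMSEQ_unique)
    then show ?thesis by (simp add: mult.commute)
  qed
  show thesis by (rule that[OF gm gb gi rep])
qed

subsection \<open>Weights\<close>

lemma ln_exp1_add_ge1: "x \<ge> 0 \<Longrightarrow> 1 \<le> ln (exp 1 + x)" for x :: real
  by (subst ln_ge_iff) (auto simp: add_pos_nonneg)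

lemma ell_ge1: "r \<ge> 0 \<Longrightarrow> 1 \<le> ell k r"
proof (induction k r rule: ell.induct)
  case (3 k r)
  then show ?case using ln_exp1_add_ge1[of "ell (Suc k) r"] by simp
qed (auto intro: ln_exp1_add_ge1)

lemma ln_exp1_Lipschitz: "0 \<le> x \<Longrightarrow> x \<le> y \<Longrightarrow> 0 \<le> ln (exp 1 + y) - ln (exp 1 + x) \<and> ln (exp 1 + y) - ln (exp 1 + x) \<le> y - x" for x y :: real
proof -
  assume x: "0 \<le> x" "x \<le> y"
  have p: "exp 1 + x > 0" "exp 1 + y > 0" using x by (auto intro: add_pos_nonneg)
  have "ln (exp 1 + y) - ln (exp 1 + x) \<le> ((exp 1 + y) - (exp 1 + x)) / (exp 1 + x)" using ln_diff_le[OF p(2) p(1)] .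
  also have "\<dots> \<le> y - x"
  proof -
    have "1 \<le> exp 1 + x" using x exp_ge_add_one_self[of 1] by linarith
    then have "(y - x) * 1 \<le> (y - x) * (exp 1 + x)" using x by (intro mult_left_mono) auto
    then show ?thesis using p by (simp add: divide_le_eq)
  qed
  finally show ?thesis using p x by simp
qed

text \<open>Monotonicity and the Lipschitz bound are proved together because the induction through
  the logarithm needs the order of the inner values as well as their distance.\<close>

lemma ell_Lipschitz: "0 \<le> r \<Longrightarrow> r \<le> s \<Longrightarrow> 0 \<le> ell k s - ell k r \<and> ell k s - ell k r \<le> s - r"
proof (induction k r arbitrary: s rule: ell.induct)
  case (2 r)
  then show ?case using ln_exp1_Lipschitz[of r s] by simp
next
  case (3 k r)
  have "0 \<le> ell (Suc k) r" using ell_ge1[of r "Suc k"] 3(2) by simp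
  then show ?case using ln_exp1_Lipschitz[of "ell (Suc k) r" "ell (Suc k) s"] 3(1)[of s] 3(2,3) by simp
qed simp

lemma weight_ge1:
  assumes "\<epsilon> > 0" shows "1 \<le> weight m \<epsilon> \<theta> j"
proof -
  have 1: "1 \<le> (\<Prod>i=0..m. ell i (real j))" by (rule prod_ge_1) (simp add: ell_ge1)
  have 2: "1 \<le> ell (m + 1) (real j) powr (1 + \<epsilon>)" using assms by (intro ge_one_powr_ge_zero ell_ge1) auto
  have 3: "1 \<le> ell (m + 2) (real j) ^ \<theta>" by (intro one_le_power ell_ge1) simp
  have "1 * 1 \<le> (\<Prod>i=0..m. ell i (real j)) * ell (m + 1) (real j) powr (1 + \<epsilon>)" using 1 2 by (intro mult_mono) auto
  then have "1 * 1 \<le> (\<Prod>i=0..m. ell i (real j)) * ell (m + 1) (real j) powr (1 + \<epsilon>) * ell (m + 2) (real j) ^ \<theta>"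
    using 3 by (intro mult_mono) auto
  then show ?thesis by (simp add: weight_def)
qed

text \<open>J is about half the binary logarithm of lambda, so 4^J <= 16 (e + lambda) <= 64 lambda
  by e <= 3 and lambda >= 1; this is the 64. Below J the Lipschitz bound gives a ratio of at most 1
  + (J - j) <= 4^(J - j), which the factor 4^j / lambda compensates; from J on, monotonicity is
  enough.\<close>

lemma ell_J_idx:
  assumes lam: "lam \<ge> 1"
  shows "ell k (real_of_int (J_idx lam)) * min (4 ^ j / lam) 1 \<le> 64 * ell k (real j)"
proof -
  define J where "J = real_of_int (J_idx lam)"
  have e: "exp 1 + lam \<ge> 1" using lam exp_ge_zero[of 1] by linarith
  have J2: "J \<ge> 0" unfolding J_def J_idx_def using e by (simp add: add_nonneg_nonneg)
  have ej: "1 \<le> ell k (real j)" "1 \<le> ell k J" using J2 by (auto intro: ell_ge1)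
  show ?thesis
  proof (cases "J \<le> real j")
    case True
    then have "ell k J \<le> ell k (real j)" using ell_Lipschitz[OF J2 True, of k] by simp
    moreover have "ell k J * min (4 ^ j / lam) 1 \<le> ell k J * 1" using ej by (intro mult_left_mono) auto
    ultimately show ?thesis using ej unfolding J_def[symmetric] by linarith
  next
    case False
    define n where "n = nat (J_idx lam) - j"
    have n: "J = real j + real n" using False J2 unfolding J_def n_def by linarith
    have "ell k J \<le> ell k (real j) + real n" using ell_Lipschitz[of "real j" J k] n by simp
    also have "\<dots> \<le> ell k (real j) + ell k (real j) * real n" using ej mult_right_mono[of 1 "ell k (real j)" "real n"] by simp
    also have "\<dots> = ell k (real j) * (1 + real n)" by (simp add: algebra_simps)
    also have "\<dots> \<le> ell k (real j) * 4 ^ n"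
    proof (rule mult_left_mono)
      have "1 + real n \<le> (1 + 1) ^ n" using Bernoulli_inequality[of 1 n] by simp
      also have "\<dots> \<le> 4 ^ n" by (intro power_mono) auto
      finally show "1 + real n \<le> 4 ^ n" .
    qed (use ej in simp)
    finally have 1: "ell k J \<le> ell k (real j) * 4 ^ n" .
    have 2: "4 ^ n * 4 ^ j \<le> 64 * lam"
    proof -
      define x where "x = log 2 (exp 1 + lam)"
      have "J \<le> 2 + 1 / 2 * x" unfolding J_def J_idx_def x_def by linarith
      then have "2 * J \<le> 4 + log 2 (exp 1 + lam)" unfolding x_def[symmetric] by simp
      then have "2 * (real j + real n) \<le> 4 + log 2 (exp 1 + lam)" unfolding n .
      then have "2 powr (2 * (real j + real n)) \<le> 2 powr (4 + log 2 (exp 1 + lam))" by (intro powr_mono) auto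
      also have "\<dots> = 16 * (exp 1 + lam)" using e by (simp add: powr_add)
      also have "\<dots> \<le> 64 * lam"
      proof -
        have "16 * (a + l) \<le> 64 * l" if "a \<le> 3" "1 \<le> l" for a l :: real
          unfolding distrib_left using that by linarith
        from this[OF exp_le lam] show ?thesis .
      qed
      also have "2 powr (2 * (real j + real n)) = 2 ^ (2 * (j + n))" by (subst powr_realpow[symmetric]) auto
      also have "(2::real) ^ (2 * (j + n)) = 4 ^ n * 4 ^ j" by (simp add: power_mult power_add)
      finally show ?thesis .
    qed
    have "ell k J * min (4 ^ j / lam) 1 \<le> (ell k (real j) * 4 ^ n) * (4 ^ j / lam)"
      using 1 ej lam by (intro mult_mono) auto
    also have "\<dots> = ell k (real j) * ((4 ^ n * 4 ^ j) / lam)" by simp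
    also have "\<dots> \<le> ell k (real j) * 64"
      using 2 lam ej by (intro mult_left_mono) (auto simp: divide_le_eq)
    finally show ?thesis unfolding J_def by (simp add: mult.commute)
  qed
qed

subsection \<open>Measurability\<close>

text \<open>Bridges weak measurability, which concerns one fixed test function, and the Duhamel
  integrand, whose test function moves with time. The second variable is rounded to a countable
  grid, and continuity passes to the limit.\<close>

lemma Caratheodory_measurable:
  fixes G :: "'a \<Rightarrow> real \<Rightarrow> complex"
  assumes m: "\<And>h. (\<lambda>s. G s h) \<in> borel_measurable M" and c: "\<And>s h. s \<in> space M \<Longrightarrow> isCont (G s) h"
  shows "(\<lambda>(s, h). G s h) \<in> borel_measurable (M \<Otimes>\<^sub>M borel)"
proof (rule borel_measurable_LIMSEQ_metric)
  let ?r = "\<lambda>n h. real_of_int \<lfloor>real (Suc n) * h\<rfloor> / real (Suc n)"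
  show "(\<lambda>p. G (fst p) (?r n (snd p))) \<in> borel_measurable (M \<Otimes>\<^sub>M borel)" for n
  proof (rule measurable_compose_countable[where g = "\<lambda>p. \<lfloor>real (Suc n) * snd p\<rfloor>" and f = "\<lambda>i p. G (fst p) (real_of_int i / real (Suc n))"])
    show "(\<lambda>p. G (fst p) (real_of_int i / real (Suc n))) \<in> borel_measurable (M \<Otimes>\<^sub>M borel)" for i
      by (rule measurable_compose[OF measurable_fst m])
    show "(\<lambda>p. \<lfloor>real (Suc n) * snd p\<rfloor>) \<in> measurable (M \<Otimes>\<^sub>M borel) (count_space UNIV)" by measurable
  qed
  fix p assume "p \<in> space (M \<Otimes>\<^sub>M (borel :: real measure))"
  then obtain s h where p: "p = (s, h)" "s \<in> space M" by (auto simp: space_pair_measure)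
  have 1: "norm (?r n h - h) \<le> 1 / real (Suc n)" for n
  proof -
    have "?r n h - h = (real_of_int \<lfloor>real (Suc n) * h\<rfloor> - real (Suc n) * h) / real (Suc n)" by (simp add: field_simps)
    moreover have "\<bar>real_of_int \<lfloor>real (Suc n) * h\<rfloor> - real (Suc n) * h\<bar> \<le> 1" by linarith
    ultimately show ?thesis by (simp add: divide_right_mono)
  qed
  have 2: "(\<lambda>n. 1 / real (Suc n)) \<longlonglongrightarrow> 0" using LIMSEQ_inverse_real_of_nat by (simp add: inverse_eq_divide)
  have "(\<lambda>n. ?r n h) \<longlonglongrightarrow> h"
    by (rule LIM_zero_cancel, rule Lim_null_comparison[OF always_eventually[OF allI[OF 1]] 2])
  then show "(\<lambda>n. G (fst p) (?r n (snd p))) \<longlonglongrightarrow> (case p of (s, h) \<Rightarrow> G s h)"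
    using isCont_tendsto_compose[OF c[OF p(2)]] by (simp add: p(1))
qed

subsection \<open>Norms of blocks\<close>

text \<open>The norm is an infimum over representing functions, so a representative is picked with
  slack. The slack \<open>\<delta> / (L1 \<psi> + 1)\<close> costs at most \<open>\<delta>\<close>
  in the end; the summand 1 covers a vanishing L1 norm.\<close>

lemma sup_norm_distr_bound:
  assumes fin: "sup_norm_distr v < \<infinity>" and \<psi>: "\<psi> \<in> schwartz"
  shows "norm (v \<psi>) \<le> enn2real (sup_norm_distr v) * L1 \<psi>"
proof -
  define S where "S = enn2real (sup_norm_distr v)"
  have S: "sup_norm_distr v = ennreal S" "S \<ge> 0" unfolding S_def using fin by (auto simp: ennreal_enn2real_if)
  have "norm (v \<psi>) \<le> S * L1 \<psi> + \<delta>" if \<delta>: "\<delta> > 0" for \<delta>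
  proof -
    define c where "c = S + \<delta> / (L1 \<psi> + 1)"
    have L: "L1 \<psi> + 1 > 0" using L1_nonneg[of \<psi>] by linarith
    have c: "c > S" "c \<ge> 0" unfolding c_def using S(2) \<delta> L by (auto intro: add_nonneg_nonneg)
    have "sup_norm_distr v < ennreal c" unfolding S(1) using c S(2) by (simp add: ennreal_less_iff)
    then obtain g where g: "represents g v" "esssup lborel (\<lambda>x. ennreal (norm (g x))) < ennreal c"
      unfolding sup_norm_distr_def INF_less_iff by auto
    have i: "integrable lborel (\<lambda>x. g x * \<psi> x)" "v \<psi> = (LINT x|lborel. g x * \<psi> x)"
      using g(1) \<psi> unfolding represents_def by auto
    have "AE x in lborel. ennreal (norm (g x)) \<le> esssup lborel (\<lambda>x. ennreal (norm (g x)))" by (rule esssup_AE)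
    then have ae: "AE x in lborel. norm (g x) \<le> c"
      by eventually_elim (metis c(2) dual_order.strict_trans1 ennreal_less_iff g(2) less_eq_real_def norm_ge_zero order_le_less_trans)
    have "norm (v \<psi>) \<le> (LINT x|lborel. norm (g x * \<psi> x))" unfolding i(2) by (rule integral_norm_bound)
    also have "\<dots> \<le> (LINT x|lborel. c * norm (\<psi> x))"
    proof (rule integral_mono_AE)
      show "integrable lborel (\<lambda>x. norm (g x * \<psi> x))" using i(1) by (rule integrable_norm)
      show "integrable lborel (\<lambda>x. c * norm (\<psi> x))" using schwartz_integrable[OF \<psi>] by simp
      show "AE x in lborel. norm (g x * \<psi> x) \<le> c * norm (\<psi> x)"
        using ae by eventually_elim (simp add: norm_mult mult_right_mono)
    qed
    also have "\<dots> = c * L1 \<psi>" by (simp add: L1_def)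
    also have "\<dots> = S * L1 \<psi> + \<delta> * (L1 \<psi> / (L1 \<psi> + 1))" unfolding c_def by (simp add: algebra_simps)
    also have "\<dots> \<le> S * L1 \<psi> + \<delta> * 1" using \<delta> L by (intro add_left_mono mult_left_mono) auto
    finally show ?thesis by simp
  qed
  then show ?thesis unfolding S_def[symmetric] by (rule field_le_epsilon)
qed

lemma sup_norm_distr_le:
  assumes "represents g v" "\<And>x. norm (g x) \<le> c"
  shows "sup_norm_distr v \<le> ennreal c"
  unfolding sup_norm_distr_def
proof (rule INF_lower2[of g])
  have "g \<in> borel_measurable lborel" using assms(1) by (simp add: represents_def)
  then show "esssup lborel (\<lambda>x. ennreal (norm (g x))) \<le> ennreal c"
    by (intro esssup_I) (auto intro!: ennreal_leI assms(2))
qed (use assms(1) in simp)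

text \<open>The infimum over almost everywhere bounds is itself such a bound, by intersecting the
  countably many full sets that belong to the slacks 1/(k + 1).\<close>

lemma AE_LinfC_norm:
  assumes fin: "LinfC_norm X m \<epsilon> \<theta> \<beta> T f < \<infinity>"
  shows "AE s in lebesgue_on {0..T}. C_norm X m \<epsilon> \<theta> \<beta> (f s) \<le> LinfC_norm X m \<epsilon> \<theta> \<beta> T f"
proof -
  let ?N = "LinfC_norm X m \<epsilon> \<theta> \<beta> T f"
  have "AE s in lebesgue_on {0..T}. C_norm X m \<epsilon> \<theta> \<beta> (f s) \<le> ?N + ennreal (1 / real (Suc k))" for k
  proof -
    have "?N < ?N + ennreal (1 / real (Suc k))" using fin by (simp add: ennreal_add_left_cancel_less)
    then obtain c where c: "AE s in lebesgue_on {0..T}. C_norm X m \<epsilon> \<theta> \<beta> (f s) \<le> c" "c < ?N + ennreal (1 / real (Suc k))"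
      unfolding LinfC_norm_def Inf_less_iff by auto
    from c(1) show ?thesis by eventually_elim (use c(2) in order)
  qed
  then have "AE s in lebesgue_on {0..T}. \<forall>k. C_norm X m \<epsilon> \<theta> \<beta> (f s) \<le> ?N + ennreal (1 / real (Suc k))"
    unfolding AE_all_countable by blast
  then show ?thesis
  proof eventually_elim
    fix s assume s: "\<forall>k. C_norm X m \<epsilon> \<theta> \<beta> (f s) \<le> ?N + ennreal (1 / real (Suc k))"
    show "C_norm X m \<epsilon> \<theta> \<beta> (f s) \<le> ?N"
    proof (rule ennreal_le_epsilon)
      fix e :: real assume "e > 0"
      then obtain k where "inverse (real (Suc k)) < e" using reals_Archimedean by blast
      then have "ennreal (1 / real (Suc k)) \<le> ennreal e" by (intro ennreal_leI) (simp add: inverse_eq_divide)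
      then have "?N + ennreal (1 / real (Suc k)) \<le> ?N + ennreal e" by (rule add_left_mono)
      then show "C_norm X m \<epsilon> \<theta> \<beta> (f s) \<le> ?N + ennreal e" using s order.trans by blast
    qed
  qed
qed

subsection \<open>Time integrals\<close>

text \<open>The number pi. The profile is the common majorant of exponential decay and of the decay
  of a block, so this constant serves both time integrals.\<close>

definition cauchy_mass :: real where
  "cauchy_mass = (LINT x|lborel. inverse (1 + (x::real)\<^sup>2))"

lemma cauchy_mass_nonneg: "cauchy_mass \<ge> 0"
  unfolding cauchy_mass_def by (intro integral_nonneg_AE) auto

text \<open>Enlarging the interval to the whole line removes \<open>T\<close> and \<open>t\<close>
  from the bound, and scaling leaves 1/c.\<close>

lemma cauchy_integral_bound:
  fixes c t T :: real
  assumes c: "c > 0"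
  shows "integrable (lebesgue_on {0..T}) (\<lambda>s. inverse (1 + (c * (t - s))\<^sup>2))" (is "integrable _ ?g")
    and "(LINT s|lebesgue_on {0..T}. inverse (1 + (c * (t - s))\<^sup>2)) \<le> cauchy_mass / c"
proof -
  let ?f = "\<lambda>x::real. inverse (1 + x\<^sup>2)"
  have g: "?g = (\<lambda>s. ?f (c * t + (- c) * s))" by (simp add: algebra_simps)
  have gi: "integrable lborel ?g"
    unfolding g using lborel_integrable_real_affine[OF integrable_inverse_1_plus_square_real, of "- c" "c * t"] c by simp
  have gm: "?g \<in> borel_measurable lborel" by measurable
  have gl: "integrable lebesgue ?g" using gi integrable_completion[OF gm] by simp
  have "integral\<^sup>L lebesgue ?g = integral\<^sup>L lborel ?g" by (rule integral_completion[OF gm])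
  also have "\<dots> = cauchy_mass / c"
    using lborel_integral_real_affine[of "- c" ?f "c * t"] c unfolding g cauchy_mass_def by simp
  finally have I: "integral\<^sup>L lebesgue ?g = cauchy_mass / c" .
  have S: "{0..T} \<inter> space lebesgue \<in> sets lebesgue" by simp
  have i: "integrable lebesgue (\<lambda>s. indicator {0..T} s *\<^sub>R ?g s)"
    using gl by (rule integrable_mult_indicator[rotated]) simp
  then show "integrable (lebesgue_on {0..T}) ?g" unfolding integrable_restrict_space[OF S] .
  have "(LINT s|lebesgue_on {0..T}. ?g s) = (LINT s|lebesgue. indicator {0..T} s *\<^sub>R ?g s)"
    by (rule integral_restrict_space[OF S])
  also have "\<dots> \<le> integral\<^sup>L lebesgue ?g"
    by (rule integral_mono[OF i gl]) (auto simp: indicator_def)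
  finally show "(LINT s|lebesgue_on {0..T}. ?g s) \<le> cauchy_mass / c" unfolding I .
qed

text \<open>exp x is the square of exp (x/2) >= 1 + x/2, and 4 (1 + x/2)^2 = 4 + 4 x + x^2 exceeds 1
  + x^2; hence the 4.\<close>

lemma exp_neg_le_cauchy: "x \<ge> 0 \<Longrightarrow> exp (- x) \<le> 4 * inverse (1 + x\<^sup>2)" for x :: real
proof -
  assume x: "x \<ge> 0"
  have "1 + x\<^sup>2 \<le> 4 * (1 + x / 2)\<^sup>2" using x by (simp add: power2_eq_square algebra_simps)
  also have "\<dots> \<le> 4 * (exp (x / 2))\<^sup>2" using x by (intro mult_left_mono power_mono exp_ge_add_one_self) auto
  also have "(exp (x / 2))\<^sup>2 = exp x" by (simp flip: exp_of_nat_mult)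
  finally have "exp (- x) * (1 + x\<^sup>2) \<le> exp (- x) * (4 * exp x)" by (intro mult_left_mono) auto
  also have "exp (- x) * (4 * exp x) = 4" by (simp add: exp_minus)
  finally have "exp (- x) * (1 + x\<^sup>2) \<le> 4" .
  moreover have "1 + x\<^sup>2 > 0" by (simp add: add_pos_nonneg)
  ultimately show ?thesis by (simp add: field_simps)
qed

subsection \<open>The resolvent\<close>

context littlewood_paley
begin

lemma C_norm_block:
  assumes C: "C_norm \<chi>\<^sub>0 m \<epsilon> \<theta> \<beta> v \<le> ennreal n" and n: "n \<ge> 0" and \<epsilon>: "\<epsilon> > 0" and \<psi>: "\<psi> \<in> schwartz"
  shows "norm (v (blk j \<psi>)) \<le> n / (weight m \<epsilon> \<theta> j * 2 powr (real j * \<beta>)) * L1 \<psi>"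
proof -
  define w where "w = weight m \<epsilon> \<theta> j * 2 powr (real j * \<beta>)"
  have w: "w > 0" unfolding w_def using weight_ge1[OF \<epsilon>, of m \<theta> j] by (intro mult_pos_pos) auto
  let ?S = "sup_norm_distr (lp_block \<chi>\<^sub>0 j v)"
  have "ennreal w * ?S \<le> C_norm \<chi>\<^sub>0 m \<epsilon> \<theta> \<beta> v" unfolding C_norm_def w_def by (rule SUP_upper) simp
  also note C
  finally have le: "ennreal w * ?S \<le> ennreal n" .
  have fin: "?S < \<infinity>"
  proof (rule ccontr)
    assume "\<not> ?S < \<infinity>"
    then have "?S = top" by (simp add: less_top[symmetric])
    then show False using le w by (simp add: ennreal_mult_top top_unique)
  qed
  then obtain s where s: "?S = ennreal s" "s \<ge> 0" by (cases ?S) auto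
  have "ennreal (w * s) \<le> ennreal n" using le w s by (simp add: ennreal_mult)
  then have "w * s \<le> n" using n by simp
  then have "s \<le> n / w" using w by (simp add: field_simps)
  moreover have "norm (v (blk j \<psi>)) \<le> s * L1 \<psi>"
    using sup_norm_distr_bound[OF fin \<psi>] s by (simp add: lp_block_eq[OF \<psi>])
  ultimately show ?thesis unfolding w_def[symmetric]
    using mult_right_mono[OF _ L1_nonneg] by (meson order.trans)
qed

text \<open>Up to constants the minimum of 1 and (4^j r)^-2, in a form whose integral is explicit.
  Index 0 is separate because \<open>fat 0\<close> does not vanish near the origin.\<close>

definition decay :: "nat \<Rightarrow> real \<Rightarrow> real" where
  "decay j r = (if j = 0 then 1 else inverse (1 + (4 ^ j * r)\<^sup>2))"

lemma decay_nonneg: "0 \<le> decay j r" by (simp add: decay_def add_nonneg_nonneg)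

lemma decay_le1: "decay j r \<le> 1"
  by (simp add: decay_def add_nonneg_nonneg inverse_le_1_iff)

text \<open>The two L1 bounds are switched at 4^j r = 1. On either side the better one is within a
  factor 2 of the Cauchy profile. Time 0 falls under the bound without gain.\<close>

lemma L1_fatblk_heat_decay_bound:
  "\<exists>D\<ge>0. \<forall>j. \<forall>r\<ge>0. \<forall>\<phi>\<in>schwartz. L1 (fatblk j (dconv gk (sqrt r) \<phi>)) \<le> D * decay j r * L1 \<phi>"
proof -
  obtain C where C: "C \<ge> 0" "\<And>j h \<phi>. \<phi> \<in> schwartz \<Longrightarrow> L1 (fatblk j (dconv gk h \<phi>)) \<le> C * L1 \<phi>"
    using L1_fatblk_heat_le by blast
  obtain E where E: "E \<ge> 0" "\<And>j h \<phi>. j \<ge> 1 \<Longrightarrow> h > 0 \<Longrightarrow> \<phi> \<in> schwartz \<Longrightarrow> L1 (fatblk j (dconv gk h \<phi>)) \<le> E / (2 ^ j * h) ^ 4 * L1 \<phi>"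
    using L1_fatblk_heat_decay by blast
  have "L1 (fatblk j (dconv gk (sqrt r) \<phi>)) \<le> (2 * (C + E)) * decay j r * L1 \<phi>" if r: "r \<ge> 0" and \<phi>: "\<phi> \<in> schwartz" for j r \<phi>
  proof (cases "j = 0 \<or> 4 ^ j * r \<le> 1")
    case True
    have "1 \<le> 2 * decay j r"
    proof (cases "j = 0")
      case False
      then have "4 ^ j * r \<le> 1" using True by simp
      then have "(4 ^ j * r)\<^sup>2 \<le> 1" using r by (simp add: power_le_one)
      moreover have "1 + (4 ^ j * r)\<^sup>2 > 0" by (simp add: add_pos_nonneg)
      ultimately show ?thesis using False by (simp add: decay_def field_simps)
    qed (simp add: decay_def)
    then have "C * 1 \<le> (C + E) * (2 * decay j r)" using C(1) E(1) by (intro mult_mono) auto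
    then have "C * L1 \<phi> \<le> (2 * (C + E)) * decay j r * L1 \<phi>" by (intro mult_right_mono) (auto simp: algebra_simps)
    then show ?thesis using C(2)[OF \<phi>, of j "sqrt r"] by linarith
  next
    case False
    then have j: "j \<ge> 1" and \<rho>: "4 ^ j * r > 1" by auto
    have r0: "r > 0" using \<rho> r by (cases "r = 0") auto
    have "(2 ^ j * sqrt r) ^ 4 = (4 ^ j * r)\<^sup>2"
    proof -
      have "(2 ^ j * sqrt r) ^ 4 = ((2 ^ j * sqrt r)\<^sup>2)\<^sup>2" by (simp flip: power_mult)
      also have "(2 ^ j * sqrt r)\<^sup>2 = (2 ^ j * 2 ^ j) * r" using r by (simp add: power_mult_distrib power2_eq_square)
      also have "(2::real) ^ j * 2 ^ j = 4 ^ j" by (simp flip: power_mult_distrib)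
      finally show ?thesis .
    qed
    then have 1: "L1 (fatblk j (dconv gk (sqrt r) \<phi>)) \<le> E / (4 ^ j * r)\<^sup>2 * L1 \<phi>"
      using E(2)[OF j _ \<phi>, of "sqrt r"] r0 by simp
    have "1 / (4 ^ j * r)\<^sup>2 \<le> 2 * decay j r"
    proof -
      have "(4 ^ j * r)\<^sup>2 \<ge> 1" using \<rho> by (simp add: one_le_power)
      moreover define y where "y = (4 ^ j * r)\<^sup>2"
      ultimately have "y \<ge> 1" by simp
      then have "1 / y \<le> 2 * inverse (1 + y)" by (simp add: field_simps)
      then show ?thesis using j by (simp add: decay_def y_def)
    qed
    then have "E * (1 / (4 ^ j * r)\<^sup>2) \<le> (C + E) * (2 * decay j r)" using C(1) E(1) by (intro mult_mono) auto
    then have "E / (4 ^ j * r)\<^sup>2 * L1 \<phi> \<le> (2 * (C + E)) * decay j r * L1 \<phi>" by (intro mult_right_mono) (auto simp: algebra_simps)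
    with 1 show ?thesis by linarith
  qed
  then show ?thesis using C(1) E(1) by (intro exI[of _ "2 * (C + E)"]) auto
qed

text \<open>The resolvent integrand with two changes: at s = t the heat operator is the identity,
  which makes the integrand continuous in the dilation, and extension by 0 gives one domain of
  integration for all \<open>t\<close>.\<close>

definition duhamel :: "real \<Rightarrow> (real \<Rightarrow> 'n distr) \<Rightarrow> (real ^ 'n \<Rightarrow> complex) \<Rightarrow> real \<Rightarrow> real \<Rightarrow> complex" where
  "duhamel lam f \<phi> t s = (if 0 \<le> s \<and> s \<le> t then of_real (exp (- lam * (t - s))) * f s (dconv gk (sqrt (t - s)) \<phi>) else 0)"

lemma id_measurable_lebesgue_on [measurable]: "(\<lambda>s::real. s) \<in> borel_measurable (lebesgue_on S)"
  by (intro measurable_restrict_space1 measurable_completion) simp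

lemma duhamel_measurable_pair:
  assumes f: "f \<in> LinfC \<chi>\<^sub>0 m \<epsilon> \<theta> \<beta> T" and \<phi>: "\<phi> \<in> schwartz"
  shows "(\<lambda>(t, s). duhamel lam f \<phi> t s) \<in> borel_measurable (borel \<Otimes>\<^sub>M lebesgue_on {0..T})"
proof -
  let ?\<mu> = "lebesgue_on {0..T}"
  have F: "(\<lambda>(s, h). f s (dconv gk h \<phi>)) \<in> borel_measurable (?\<mu> \<Otimes>\<^sub>M borel)"
  proof (rule Caratheodory_measurable)
    show "(\<lambda>s. f s (dconv gk h \<phi>)) \<in> borel_measurable ?\<mu>" for h
      using f schwartz_dconv[OF schwartz_gk \<phi>, of h] by (simp add: LinfC_def)
    show "isCont (\<lambda>h. f s (dconv gk h \<phi>)) h" if "s \<in> space ?\<mu>" for s h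
      using f that by (intro tempered_dconv_isCont schwartz_gk \<phi>) (simp add: LinfC_def C_space_def)
  qed
  \<comment> \<open>For s > t the odd function \<open>sqrt\<close> supplies a negative dilation;
    \<open>duhamel\<close> is 0 there.\<close>
  have "(\<lambda>p. (snd p, sqrt (fst p - snd p))) \<in> measurable (borel \<Otimes>\<^sub>M ?\<mu>) (?\<mu> \<Otimes>\<^sub>M borel)"
    by measurable
  from measurable_compose[OF this F]
  have [measurable]: "(\<lambda>p. f (snd p) (dconv gk (sqrt (fst p - snd p)) \<phi>)) \<in> borel_measurable (borel \<Otimes>\<^sub>M ?\<mu>)"
    by simp
  show ?thesis unfolding duhamel_def case_prod_unfold by measurable
qed

lemma duhamel_measurable:
  assumes f: "f \<in> LinfC \<chi>\<^sub>0 m \<epsilon> \<theta> \<beta> T" and \<phi>: "\<phi> \<in> schwartz"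
  shows "duhamel lam f \<phi> t \<in> borel_measurable (lebesgue_on {0..T})"
  using measurable_compose[OF measurable_Pair1'[of t borel] duhamel_measurable_pair[OF f \<phi>, of lam]] by simp

lemma resolvent_eq_duhamel:
  assumes f: "f \<in> LinfC \<chi>\<^sub>0 m \<epsilon> \<theta> \<beta> T" and \<phi>: "\<phi> \<in> schwartz" and t: "t \<in> {0..T}"
  shows "resolvent lam f t \<phi> = (LINT s|lebesgue_on {0..T}. duhamel lam f \<phi> t s)"
proof -
  have S: "{0..T} \<inter> space lebesgue \<in> sets lebesgue" by simp
  have HS: "indicator {0..T} s *\<^sub>R duhamel lam f \<phi> t s = duhamel lam f \<phi> t s" for s
    using t by (auto simp: duhamel_def indicator_def)
  have Hm [measurable]: "duhamel lam f \<phi> t \<in> borel_measurable lebesgue"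
    using duhamel_measurable[OF f \<phi>, of lam t] unfolding borel_measurable_restrict_space_iff[OF S] HS .
  \<comment> \<open>\<open>heat 0\<close> is not the identity, so the integrands differ at \<open>s = t\<close>.\<close>
  define R where "R s = indicator {0..t} s *\<^sub>R (of_real (exp (- lam * (t - s))) * heat (t - s) (f s) \<phi>)" for s
  have RH: "R s = (if s = t then R t else duhamel lam f \<phi> t s)" for s
  proof (cases "s = t \<or> s < 0 \<or> s > t")
    case True then show ?thesis by (auto simp: R_def duhamel_def)
  next
    case False
    then have "0 < t - s" "0 \<le> s" "s \<le> t" by auto
    then show ?thesis by (simp add: R_def duhamel_def heat_eq_dconv[OF _ \<phi>])
  qed
  have "(\<lambda>s. if s = t then R t else duhamel lam f \<phi> t s) \<in> borel_measurable lebesgue"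
  proof (rule measurable_If[OF _ Hm])
    show "{s \<in> space lebesgue. s = t} \<in> sets lebesgue" by simp
  qed simp
  then have Rm: "R \<in> borel_measurable lebesgue" by (simp only: RH[symmetric])
  have "AE s in lebesgue. s \<noteq> t" by (rule AE_completion) (rule AE_lborel_singleton)
  then have "AE s in lebesgue. R s = duhamel lam f \<phi> t s" by eventually_elim (subst RH, simp)
  then have "integral\<^sup>L lebesgue R = integral\<^sup>L lebesgue (duhamel lam f \<phi> t)"
    by (rule integral_cong_AE[OF Rm Hm])
  also have "\<dots> = (LINT s|lebesgue_on {0..T}. duhamel lam f \<phi> t s)"
    unfolding integral_restrict_space[OF S] HS ..
  finally show ?thesis by (simp add: resolvent_def set_lebesgue_integral_def R_def[abs_def])
qed

lemma resolvent_measurable: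
  assumes f: "f \<in> LinfC \<chi>\<^sub>0 m \<epsilon> \<theta> \<beta> T" and \<phi>: "\<phi> \<in> schwartz"
  shows "(\<lambda>t. resolvent lam f t \<phi>) \<in> borel_measurable (lebesgue_on {0..T})"
proof -
  interpret finite_measure "lebesgue_on {0..T}" by (rule finite_measure_lebesgue_on) simp
  have "(\<lambda>t. LINT s|lebesgue_on {0..T}. duhamel lam f \<phi> t s) \<in> borel_measurable borel"
    by (rule borel_measurable_lebesgue_integral) (rule duhamel_measurable_pair[OF f \<phi>])
  then have "(\<lambda>t. LINT s|lebesgue_on {0..T}. duhamel lam f \<phi> t s) \<in> borel_measurable (lebesgue_on {0..T})"
    by (intro measurable_restrict_space1 measurable_completion) simp
  then show ?thesis
    by (rule measurable_cong[THEN iffD1, rotated]) (simp add: resolvent_eq_duhamel[OF f \<phi>])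
qed

text \<open>Continuity needs one seminorm and one constant for almost every s.
  \<open>tempered_heat_bound\<close>, taken with exponent minus beta, supplies them from the block
  norms, and the time interval has finite measure.\<close>

lemma resolvent_tempered:
  assumes f: "f \<in> LinfC \<chi>\<^sub>0 m \<epsilon> \<theta> \<beta> T" and lam: "lam \<ge> 0" and t: "t \<in> {0..T}"
    and ae: "AE s in lebesgue_on {0..T}. C_norm \<chi>\<^sub>0 m \<epsilon> \<theta> \<beta> (f s) \<le> ennreal n"
    and n: "n \<ge> 0" and \<epsilon>: "\<epsilon> > 0"
  shows "tempered (resolvent lam f t)" "\<And>\<phi>. \<phi> \<in> schwartz \<Longrightarrow> integrable (lebesgue_on {0..T}) (duhamel lam f \<phi> t)"
proof -
  let ?\<mu> = "lebesgue_on {0..T}"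
  interpret finite_measure ?\<mu> by (rule finite_measure_lebesgue_on) simp
  have temp: "tempered (f s)" if "s \<in> {0..T}" for s using f that by (simp add: LinfC_def C_space_def)
  obtain C M where C: "C \<ge> 0" and CM: "\<And>u N h \<phi>. \<phi> \<in> schwartz \<Longrightarrow> tempered u \<Longrightarrow> N \<ge> 0 \<Longrightarrow>
     (\<And>j \<psi>. \<psi> \<in> schwartz \<Longrightarrow> norm (u (blk j \<psi>)) \<le> N * 2 powr (real j * (- \<beta>)) * L1 \<psi>) \<Longrightarrow>
     norm (u (dconv gk h \<phi>)) \<le> C * N * schwartz_seminorm M \<phi>"
    using tempered_heat_bound[of "- \<beta>"] by blast
  have Hb: "AE s in ?\<mu>. norm (duhamel lam f \<phi> t s) \<le> C * n * schwartz_seminorm M \<phi>" if \<phi>: "\<phi> \<in> schwartz" for \<phi>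
  proof -
    have "AE s in ?\<mu>. s \<in> {0..T}" by (rule AE_I2) simp
    with ae show ?thesis
    proof eventually_elim
      fix s assume s: "C_norm \<chi>\<^sub>0 m \<epsilon> \<theta> \<beta> (f s) \<le> ennreal n" "s \<in> {0..T}"
      have b: "norm (f s (dconv gk h \<phi>)) \<le> C * n * schwartz_seminorm M \<phi>" for h
      proof (rule CM[OF \<phi> temp[OF s(2)] n])
        fix j and \<psi> :: "real^'n \<Rightarrow> complex" assume \<psi>: "\<psi> \<in> schwartz"
        have w: "weight m \<epsilon> \<theta> j \<ge> 1" by (rule weight_ge1[OF \<epsilon>])
        have "norm (f s (blk j \<psi>)) \<le> n / (weight m \<epsilon> \<theta> j * 2 powr (real j * \<beta>)) * L1 \<psi>"
          by (rule C_norm_block[OF s(1) n \<epsilon> \<psi>])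
        also have "\<dots> \<le> n / (1 * 2 powr (real j * \<beta>)) * L1 \<psi>"
          using w n by (intro mult_right_mono divide_left_mono) auto
        also have "\<dots> = n * 2 powr (real j * (- \<beta>)) * L1 \<psi>" by (simp add: powr_minus divide_inverse)
        finally show "norm (f s (blk j \<psi>)) \<le> n * 2 powr (real j * (- \<beta>)) * L1 \<psi>" .
      qed
      show "norm (duhamel lam f \<phi> t s) \<le> C * n * schwartz_seminorm M \<phi>"
      proof (cases "0 \<le> s \<and> s \<le> t")
        case True
        then have "exp (- lam * (t - s)) \<le> 1" using lam by simp
        then have "exp (- lam * (t - s)) * norm (f s (dconv gk (sqrt (t - s)) \<phi>)) \<le> 1 * (C * n * schwartz_seminorm M \<phi>)"
          using b by (intro mult_mono) auto
        then show ?thesis using True by (simp add: duhamel_def norm_mult)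
      next
        case False
        then show ?thesis using C n schwartz_seminorm_nonneg[OF \<phi>] by (auto simp: duhamel_def)
      qed
    qed
  qed
  show Hi: "integrable ?\<mu> (duhamel lam f \<phi> t)" if "\<phi> \<in> schwartz" for \<phi>
    by (rule integrable_const_bound[OF Hb[OF that] duhamel_measurable[OF f that]])
  note req = resolvent_eq_duhamel[OF f _ t]
  show "tempered (resolvent lam f t)"
    unfolding tempered_def
  proof (intro conjI ballI allI exI)
    fix \<phi> \<psi> :: "real^'n \<Rightarrow> complex" assume \<phi>: "\<phi> \<in> schwartz" and \<psi>: "\<psi> \<in> schwartz"
    have "duhamel lam f (\<lambda>x. \<phi> x + \<psi> x) t s = duhamel lam f \<phi> t s + duhamel lam f \<psi> t s" if "s \<in> {0..T}" for s
      using \<phi> \<psi> by (simp add: duhamel_def dconv_add schwartz_gk tempered_add[OF temp[OF that]] schwartz_dconv distrib_left)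
    then have "(LINT s|?\<mu>. duhamel lam f (\<lambda>x. \<phi> x + \<psi> x) t s) = (LINT s|?\<mu>. duhamel lam f \<phi> t s + duhamel lam f \<psi> t s)"
      by (intro Bochner_Integration.integral_cong) auto
    then show "resolvent lam f t (\<lambda>x. \<phi> x + \<psi> x) = resolvent lam f t \<phi> + resolvent lam f t \<psi>"
      using \<phi> \<psi> by (simp add: req schwartz_add Hi)
  next
    fix c and \<phi> :: "real^'n \<Rightarrow> complex" assume \<phi>: "\<phi> \<in> schwartz"
    have "duhamel lam f (\<lambda>x. c * \<phi> x) t s = c * duhamel lam f \<phi> t s" if "s \<in> {0..T}" for s
      using \<phi> by (simp add: duhamel_def dconv_cmult tempered_cmult[OF temp[OF that]] schwartz_gk schwartz_dconv)
    then have "(LINT s|?\<mu>. duhamel lam f (\<lambda>x. c * \<phi> x) t s) = (LINT s|?\<mu>. c * duhamel lam f \<phi> t s)"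
      by (intro Bochner_Integration.integral_cong) auto
    then show "resolvent lam f t (\<lambda>x. c * \<phi> x) = c * resolvent lam f t \<phi>"
      using \<phi> by (simp add: req schwartz_cmult)
  next
    fix \<phi> :: "real^'n \<Rightarrow> complex" assume \<phi>: "\<phi> \<in> schwartz"
    have "norm (resolvent lam f t \<phi>) \<le> (LINT s|?\<mu>. norm (duhamel lam f \<phi> t s))"
      unfolding req[OF \<phi>] by (rule integral_norm_bound)
    also have "\<dots> \<le> (LINT s|?\<mu>. C * n * schwartz_seminorm M \<phi>)"
      by (rule integral_mono_AE[OF integrable_norm[OF Hi[OF \<phi>]] _ Hb[OF \<phi>]]) simp
    also have "\<dots> = (measure ?\<mu> (space ?\<mu>) * C * n) * schwartz_seminorm M \<phi>" by simp
    finally show "norm (resolvent lam f t \<phi>) \<le> (measure ?\<mu> (space ?\<mu>) * C * n) * schwartz_seminorm M \<phi>" .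
  qed
qed

text \<open>Stated as a predicate so that \<open>E\<close> is chosen before m, epsilon, theta, beta
  and T: the constant depends only on the cutoff and the dimension.\<close>

definition resolvent_gain :: "real \<Rightarrow> bool" where
  "resolvent_gain E \<longleftrightarrow> (\<forall>m \<epsilon> \<theta> \<beta> T f lam t n j. f \<in> LinfC \<chi>\<^sub>0 m \<epsilon> \<theta> \<beta> T \<longrightarrow> lam \<ge> 1 \<longrightarrow> t \<in> {0..T} \<longrightarrow>
     (AE s in lebesgue_on {0..T}. C_norm \<chi>\<^sub>0 m \<epsilon> \<theta> \<beta> (f s) \<le> ennreal n) \<longrightarrow> n \<ge> 0 \<longrightarrow> \<epsilon> > 0 \<longrightarrow>
     sup_norm_distr (lp_block \<chi>\<^sub>0 j (resolvent lam f t)) \<le>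
       ennreal (E * min (1 / lam) (1 / 4 ^ j) * (n / (weight m \<epsilon> \<theta> j * 2 powr (real j * \<beta>)))))"

lemma resolvent_gain: "\<exists>E\<ge>0. resolvent_gain E"
proof -
  obtain D where D: "D \<ge> 0" "\<And>j r \<phi>. r \<ge> 0 \<Longrightarrow> \<phi> \<in> schwartz \<Longrightarrow> L1 (fatblk j (dconv gk (sqrt r) \<phi>)) \<le> D * decay j r * L1 \<phi>"
    using L1_fatblk_heat_decay_bound by blast
  \<comment> \<open>\<open>K\<close> bounds the L1 norm of the kernel of any fattened block; it
    enters when the functional is turned into a function.\<close>
  define K where "K = L1 (kern c0) + L1 (kern eta)"
  define P where "P = 4 * cauchy_mass"
  have K: "K \<ge> 0" and P: "P \<ge> 0" using cauchy_mass_nonneg by (auto simp: K_def P_def)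
  show ?thesis
    unfolding resolvent_gain_def
  proof (intro exI conjI allI impI)
    show "P * D * K \<ge> 0" using P D(1) K by simp
    fix m \<epsilon> \<theta> \<beta> T and f :: "real \<Rightarrow> 'n distr" and lam t n :: real and j
    assume f: "f \<in> LinfC \<chi>\<^sub>0 m \<epsilon> \<theta> \<beta> T" and lam: "lam \<ge> 1" and t: "t \<in> {0..T}"
      and ae: "AE s in lebesgue_on {0..T}. C_norm \<chi>\<^sub>0 m \<epsilon> \<theta> \<beta> (f s) \<le> ennreal n"
      and n: "n \<ge> 0" and \<epsilon>: "\<epsilon> > 0"
    let ?\<mu> = "lebesgue_on {0..T}" and ?R = "resolvent lam f t"
    have lam0: "lam \<ge> 0" "lam > 0" using lam by auto
    note temp = resolvent_tempered[OF f lam0(1) t ae n \<epsilon>]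
    define a where "a = n / (weight m \<epsilon> \<theta> j * 2 powr (real j * \<beta>))"
    have w: "weight m \<epsilon> \<theta> j \<ge> 1" by (rule weight_ge1[OF \<epsilon>])
    have a: "a \<ge> 0" unfolding a_def using n w by simp
    let ?q = "min (1 / lam) (1 / 4 ^ j)"
    have key: "norm (?R (blk j \<phi>)) \<le> (P * D * a * ?q) * L1 \<phi>" if \<phi>: "\<phi> \<in> schwartz" for \<phi>
    proof -
      have blk\<phi>: "blk j \<phi> \<in> schwartz" by (rule blk_schwartz[OF \<phi>])
      note Hi = temp(2)[OF blk\<phi>]
      define b where "b s = (a * D * L1 \<phi>) * ((if 0 \<le> s \<and> s \<le> t then exp (- lam * (t - s)) * decay j (t - s) else 0))" for s
      have aDL: "a * D * L1 \<phi> \<ge> 0" using a D(1) by simp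
      have Hb: "AE s in ?\<mu>. norm (duhamel lam f (blk j \<phi>) t s) \<le> b s"
        using ae
      proof eventually_elim
        fix s assume s: "C_norm \<chi>\<^sub>0 m \<epsilon> \<theta> \<beta> (f s) \<le> ennreal n"
        show "norm (duhamel lam f (blk j \<phi>) t s) \<le> b s"
        proof (cases "0 \<le> s \<and> s \<le> t")
          case True
          let ?P = "dconv gk (sqrt (t - s)) \<phi>"
          have P: "?P \<in> schwartz" by (intro schwartz_dconv schwartz_gk \<phi>)
          have "norm (f s (dconv gk (sqrt (t - s)) (blk j \<phi>))) = norm (f s (blk j (fatblk j ?P)))"
            unfolding dconv_blk_commute[OF schwartz_gk \<phi>] blk_fatblk[OF P] ..
          also have "\<dots> \<le> a * L1 (fatblk j ?P)" unfolding a_def by (rule C_norm_block[OF s n \<epsilon> fatblk_schwartz[OF P]])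
          also have "\<dots> \<le> a * (D * decay j (t - s) * L1 \<phi>)" using True by (intro mult_left_mono D(2) \<phi> a) auto
          finally have "exp (- lam * (t - s)) * norm (f s (dconv gk (sqrt (t - s)) (blk j \<phi>))) \<le> exp (- lam * (t - s)) * (a * (D * decay j (t - s) * L1 \<phi>))"
            by (intro mult_left_mono) auto
          then show ?thesis using True by (simp add: duhamel_def b_def norm_mult mult_ac)
        qed (auto simp: duhamel_def b_def)
      qed
      have est: "norm (?R (blk j \<phi>)) \<le> (LINT s|?\<mu>. g s)" if g: "integrable ?\<mu> g" "\<And>s. b s \<le> g s" for g
      proof -
        have "norm (?R (blk j \<phi>)) \<le> (LINT s|?\<mu>. norm (duhamel lam f (blk j \<phi>) t s))"
          unfolding resolvent_eq_duhamel[OF f blk\<phi> t] by (rule integral_norm_bound)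
        also have "\<dots> \<le> (LINT s|?\<mu>. g s)"
        proof (rule integral_mono_AE[OF integrable_norm[OF Hi] g(1)])
          show "AE s in ?\<mu>. norm (duhamel lam f (blk j \<phi>) t s) \<le> g s" using Hb by eventually_elim (use g(2) order.trans in blast)
        qed
        finally show ?thesis .
      qed
      \<comment> \<open>One estimate for every Cauchy scale \<open>c\<close>; it is used with c =
        lambda, dropping the decay, and with c = 4^j, dropping the exponential.\<close>
      have q: "norm (?R (blk j \<phi>)) \<le> (a * D * L1 \<phi>) * (P / c)"
        if c: "c > 0" "\<And>r. r \<ge> 0 \<Longrightarrow> exp (- lam * r) * decay j r \<le> 4 * inverse (1 + (c * r)\<^sup>2)" for c
      proof -
        let ?g = "\<lambda>s. (4 * (a * D * L1 \<phi>)) * inverse (1 + (c * (t - s))\<^sup>2)"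
        have "norm (?R (blk j \<phi>)) \<le> (LINT s|?\<mu>. ?g s)"
        proof (rule est)
          show "integrable ?\<mu> ?g" by (intro integrable_mult_right cauchy_integral_bound c(1))
          show "b s \<le> ?g s" for s
          proof (cases "0 \<le> s \<and> s \<le> t")
            case True
            then have "b s \<le> (a * D * L1 \<phi>) * (4 * inverse (1 + (c * (t - s))\<^sup>2))"
              using c(2)[of "t - s"] aDL by (simp add: b_def mult_left_mono del: mult_minus_left)
            then show ?thesis by (simp add: mult_ac)
          next
            case False
            have "0 \<le> inverse (1 + (c * (t - s))\<^sup>2)" by (simp add: add_nonneg_nonneg)
            then show ?thesis using False aDL by (auto simp: b_def)
          qed
        qed
        also have "\<dots> = (4 * (a * D * L1 \<phi>)) * (LINT s|?\<mu>. inverse (1 + (c * (t - s))\<^sup>2))" by simp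
        also have "\<dots> \<le> (4 * (a * D * L1 \<phi>)) * (cauchy_mass / c)"
          using aDL by (intro mult_left_mono cauchy_integral_bound c(1)) auto
        finally show ?thesis by (simp add: P_def mult_ac)
      qed
      have q1: "norm (?R (blk j \<phi>)) \<le> (a * D * L1 \<phi>) * (P / lam)"
      proof (rule q[OF lam0(2)])
        fix r :: real assume r: "r \<ge> 0"
        have "exp (- lam * r) * decay j r \<le> exp (- lam * r) * 1" by (intro mult_left_mono decay_le1) auto
        also have "\<dots> \<le> 4 * inverse (1 + (lam * r)\<^sup>2)" using exp_neg_le_cauchy[of "lam * r"] r lam0 by simp
        finally show "exp (- lam * r) * decay j r \<le> 4 * inverse (1 + (lam * r)\<^sup>2)" .
      qed
      \<comment> \<open>Block 0 does not decay in time; there the claim follows from the first bound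
        because lambda >= 1.\<close>
      have q2: "norm (?R (blk j \<phi>)) \<le> (a * D * L1 \<phi>) * (P / 4 ^ j)"
      proof (cases "j = 0")
        case True
        have "P / lam \<le> P / 1" using P lam by (intro divide_left_mono) auto
        then have "(a * D * L1 \<phi>) * (P / lam) \<le> (a * D * L1 \<phi>) * (P / 4 ^ j)"
          using True aDL by (intro mult_left_mono) auto
        then show ?thesis using q1 by linarith
      next
        case False
        show ?thesis
        proof (rule q)
          fix r :: real assume r: "r \<ge> 0"
          have "exp (- lam * r) * decay j r \<le> 1 * decay j r" using r lam0 decay_nonneg by (intro mult_right_mono) auto
          also have "\<dots> \<le> 4 * inverse (1 + (4 ^ j * r)\<^sup>2)" using False decay_nonneg[of j r] by (simp add: decay_def)
          finally show "exp (- lam * r) * decay j r \<le> 4 * inverse (1 + (4 ^ j * r)\<^sup>2)" .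
        qed simp
      qed
      have "(P * D * a * ?q) * L1 \<phi> = (a * D * L1 \<phi>) * (P * ?q)" by (simp only: mult_ac)
      moreover have "P * ?q = P / lam \<or> P * ?q = P / 4 ^ j" by (auto simp: min_def)
      then have "norm (?R (blk j \<phi>)) \<le> (a * D * L1 \<phi>) * (P * ?q)"
        using q1 q2 by (elim disjE) (simp_all only:)
      ultimately show ?thesis by (simp only:)
    qed
    \<comment> \<open>The block functional is invariant under the fattened block, which is a
      convolution with a dilated Schwartz kernel; this supplies the band limitation.\<close>
    obtain k h where k: "k \<in> schwartz" "h > 0" "L1 k \<le> K" "\<And>\<phi>. \<phi> \<in> schwartz \<Longrightarrow> fatblk j \<phi> = dconv k h \<phi>"
      using fatblk_dilate[of j] unfolding K_def by blast
    have q0: "?q \<ge> 0" using lam0 by auto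
    let ?M = "P * D * a * ?q"
    have M: "?M \<ge> 0" using P D(1) a q0 by simp
    obtain g where g: "g \<in> borel_measurable borel" "\<And>x. norm (g x) \<le> ?M * L1 k"
      "\<And>\<phi>. \<phi> \<in> schwartz \<Longrightarrow> integrable lborel (\<lambda>x. g x * \<phi> x)"
      "\<And>\<phi>. \<phi> \<in> schwartz \<Longrightarrow> ?R (blk j \<phi>) = (LINT x|lborel. g x * \<phi> x)"
    proof (rule represent_band_limited[of "\<lambda>\<phi>. ?R (blk j \<phi>)" ?M k h])
      fix \<phi> \<psi> :: "real^'n \<Rightarrow> complex" assume "\<phi> \<in> schwartz" "\<psi> \<in> schwartz"
      then show "?R (blk j (\<lambda>x. \<phi> x + \<psi> x)) = ?R (blk j \<phi>) + ?R (blk j \<psi>)"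
        using tempered_add[OF temp(1) blk_schwartz blk_schwartz] by (simp add: blk_def dconv_add schwartz_kern chi_schwartz)
    next
      fix c and \<phi> :: "real^'n \<Rightarrow> complex" assume "\<phi> \<in> schwartz"
      then show "?R (blk j (\<lambda>x. c * \<phi> x)) = c * ?R (blk j \<phi>)"
        using tempered_cmult[OF temp(1) blk_schwartz] by (simp add: blk_def dconv_cmult)
    next
      fix \<phi> :: "real^'n \<Rightarrow> complex" assume "\<phi> \<in> schwartz"
      then show "?R (blk j (dconv k h \<phi>)) = ?R (blk j \<phi>)" by (simp add: k(4)[symmetric] blk_fatblk)
    qed (use key M k in auto)
    have rep: "represents g (lp_block \<chi>\<^sub>0 j ?R)"
      unfolding represents_def using g by (simp add: lp_block_eq)
    have "norm (g x) \<le> P * D * K * ?q * a" for x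
    proof -
      have "norm (g x) \<le> ?M * K" by (rule order.trans[OF g(2)]) (intro mult_left_mono k(3) M)
      then show ?thesis by (simp only: mult_ac)
    qed
    from sup_norm_distr_le[OF rep this]
    show "sup_norm_distr (lp_block \<chi>\<^sub>0 j ?R) \<le> ennreal (P * D * K * ?q * (n / (weight m \<epsilon> \<theta> j * 2 powr (real j * \<beta>))))"
      unfolding a_def .
  qed
qed

text \<open>The common core of both estimates. Between the weights of input and output there remain
  4^j, from the two derivatives gained, and the factor \<open>ell (m + 2)\<close> to the power
  theta. Multiplied by 4^j the gain becomes the minimum of 4^j / lambda and 1, so all that is left
  is the scalar comparison in the last assumption.\<close>

lemma resolvent_bound:
  assumes E: "resolvent_gain E"
    and f: "f \<in> LinfC \<chi>\<^sub>0 m \<epsilon> \<theta> (\<alpha> - 2) T" and lam: "lam \<ge> 1" and \<epsilon>: "\<epsilon> > 0"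
    and c: "E \<ge> 0" "c \<ge> 0" "\<And>j. E * min (4 ^ j / lam) 1 \<le> c * ell (m + 2) (real j) ^ \<theta>"
  shows "resolvent lam f \<in> LinfC \<chi>\<^sub>0 m \<epsilon> 0 \<alpha> T \<and>
     LinfC_norm \<chi>\<^sub>0 m \<epsilon> 0 \<alpha> T (resolvent lam f) \<le> ennreal c * LinfC_norm \<chi>\<^sub>0 m \<epsilon> \<theta> (\<alpha> - 2) T f"
proof -
  have fin: "LinfC_norm \<chi>\<^sub>0 m \<epsilon> \<theta> (\<alpha> - 2) T f < \<infinity>" using f by (simp add: LinfC_def)
  then obtain n where n: "LinfC_norm \<chi>\<^sub>0 m \<epsilon> \<theta> (\<alpha> - 2) T f = ennreal n" "n \<ge> 0"
    by (cases "LinfC_norm \<chi>\<^sub>0 m \<epsilon> \<theta> (\<alpha> - 2) T f") auto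
  have ae: "AE s in lebesgue_on {0..T}. C_norm \<chi>\<^sub>0 m \<epsilon> \<theta> (\<alpha> - 2) (f s) \<le> ennreal n"
    using AE_LinfC_norm[OF fin] unfolding n(1) .
  \<comment> \<open>This holds for every t: the exceptional null set lies in the integration
    variable s. Hence the norm of the output is finite at every time, as membership in
    \<open>LinfC\<close> requires.\<close>
  have bd: "C_norm \<chi>\<^sub>0 m \<epsilon> 0 \<alpha> (resolvent lam f t) \<le> ennreal (c * n)" if t: "t \<in> {0..T}" for t
    unfolding C_norm_def
  proof (rule SUP_least)
    fix j
    define w where "w = weight m \<epsilon> 0 j"
    define l where "l = ell (m + 2) (real j) ^ \<theta>"
    define q where "q = min (1 / lam) (1 / 4 ^ j)"
    define p where "p = (2::real) powr (real j * \<alpha>)"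
    have w: "w > 0" unfolding w_def using weight_ge1[OF \<epsilon>, of m 0 j] by linarith
    have l: "l > 0" unfolding l_def using ell_ge1[of "real j" "m + 2"] by (intro zero_less_power) auto
    have p: "p > 0" by (simp add: p_def)
    have q0: "q \<ge> 0" unfolding q_def using lam by auto
    have wl: "weight m \<epsilon> \<theta> j = w * l" by (simp add: weight_def w_def l_def)
    have pw: "2 powr (real j * (\<alpha> - 2)) = p / 4 ^ j"
    proof -
      have "(4::real) ^ j = 2 powr (real j * 2)" by (simp add: powr_powr[symmetric] powr_realpow mult.commute[of _ 2])
      then show ?thesis by (simp add: p_def right_diff_distrib powr_diff)
    qed
    have q4: "4 ^ j * q = min (4 ^ j / lam) 1" unfolding q_def by (simp add: min_mult_distrib_left)
    have "ennreal (w * p) * sup_norm_distr (lp_block \<chi>\<^sub>0 j (resolvent lam f t)) \<le>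
       ennreal (w * p) * ennreal (E * q * (n / (weight m \<epsilon> \<theta> j * 2 powr (real j * (\<alpha> - 2)))))"
      unfolding q_def by (intro mult_left_mono E[unfolded resolvent_gain_def, rule_format, OF f lam t ae n(2) \<epsilon>]) simp
    also have "\<dots> = ennreal ((w * p) * (E * q * (n / (weight m \<epsilon> \<theta> j * 2 powr (real j * (\<alpha> - 2))))))"
      by (rule ennreal_mult'[symmetric]) (use w p in simp)
    also have "(w * p) * (E * q * (n / (weight m \<epsilon> \<theta> j * 2 powr (real j * (\<alpha> - 2))))) = (E * (4 ^ j * q)) * n / l"
      unfolding wl pw using w p l by (simp add: field_simps)
    also have "\<dots> \<le> (c * l) * n / l"
      using c(3)[of j] l n(2) unfolding q4 l_def by (intro divide_right_mono mult_right_mono) auto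
    also have "\<dots> = c * n" using l by simp
    finally show "ennreal (weight m \<epsilon> 0 j * 2 powr (real j * \<alpha>)) * sup_norm_distr (lp_block \<chi>\<^sub>0 j (resolvent lam f t)) \<le> ennreal (c * n)"
      unfolding w_def p_def by (simp add: ennreal_leI)
  qed
  have norm: "LinfC_norm \<chi>\<^sub>0 m \<epsilon> 0 \<alpha> T (resolvent lam f) \<le> ennreal (c * n)"
    unfolding LinfC_norm_def by (rule Inf_lower) (auto intro!: AE_I2 bd)
  have lam0: "lam \<ge> 0" using lam by simp
  have "resolvent lam f \<in> LinfC \<chi>\<^sub>0 m \<epsilon> 0 \<alpha> T"
    unfolding LinfC_def C_space_def
  proof (intro CollectI conjI ballI)
    show "tempered (resolvent lam f t)" if "t \<in> {0..T}" for t
      by (rule resolvent_tempered(1)[OF f lam0 that ae n(2) \<epsilon>])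
    show "C_norm \<chi>\<^sub>0 m \<epsilon> 0 \<alpha> (resolvent lam f t) < \<infinity>" if "t \<in> {0..T}" for t
      using bd[OF that] by (rule order.strict_trans1) simp
    show "(\<lambda>t. resolvent lam f t \<phi>) \<in> borel_measurable (lebesgue_on {0..T})" if "\<phi> \<in> schwartz" for \<phi>
      by (rule resolvent_measurable[OF f that])
    show "LinfC_norm \<chi>\<^sub>0 m \<epsilon> 0 \<alpha> T (resolvent lam f) < \<infinity>"
      using norm by (rule order.strict_trans1) simp
  qed
  moreover have "ennreal (c * n) = ennreal c * ennreal n" using c(2) n(2) by (simp add: ennreal_mult)
  ultimately show ?thesis using norm unfolding n(1) by simp
qed

end

theorem lemma3p4:
  fixes \<chi>\<^sub>0 :: "real ^ 'n::finite \<Rightarrow> real" and \<epsilon> T :: real and m :: nat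
  assumes "CARD('n) \<ge> 2" and "lp_cutoff \<chi>\<^sub>0" and "\<epsilon> > 0" and "m \<ge> 1" and "T > 0"
  shows "\<exists>C>0. \<forall>\<alpha>::real. \<forall>lam\<ge>1.
     (\<forall>f \<in> LinfC_ss \<chi>\<^sub>0 m \<epsilon> (\<alpha> - 2) T.
        resolvent lam f \<in> LinfC_ss \<chi>\<^sub>0 m \<epsilon> \<alpha> T \<and>
        LinfC_ss_norm \<chi>\<^sub>0 m \<epsilon> \<alpha> T (resolvent lam f)
          \<le> ennreal C * LinfC_ss_norm \<chi>\<^sub>0 m \<epsilon> (\<alpha> - 2) T f) \<and>
     (\<forall>f \<in> LinfC_s \<chi>\<^sub>0 m \<epsilon> (\<alpha> - 2) T.
        resolvent lam f \<in> LinfC_ss \<chi>\<^sub>0 m \<epsilon> \<alpha> T \<and>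
        LinfC_ss_norm \<chi>\<^sub>0 m \<epsilon> \<alpha> T (resolvent lam f)
          \<le> ennreal (C / ell (m + 2) (real_of_int (J_idx lam))) *
             LinfC_s_norm \<chi>\<^sub>0 m \<epsilon> (\<alpha> - 2) T f)"
proof -
  interpret littlewood_paley \<chi>\<^sub>0 by standard fact
  obtain E where E0: "E \<ge> 0" and E: "resolvent_gain E"
    using resolvent_gain by blast
  \<comment> \<open>The 64 comes from \<open>ell_J_idx\<close>; the summand 1 keeps the constant
    positive when \<open>E\<close> is 0.\<close>
  define C where "C = 64 * E + 1"
  have C: "C > 0" "E \<le> C" "64 * E \<le> C" using E0 by (auto simp: C_def)
  show ?thesis
  proof (intro exI[of _ C] conjI allI impI ballI C(1))
    fix \<alpha> lam :: real and f assume lam: "lam \<ge> 1" and f: "f \<in> LinfC_ss \<chi>\<^sub>0 m \<epsilon> (\<alpha> - 2) T"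
    have "E * min (4 ^ j / lam) 1 \<le> C * ell (m + 2) (real j) ^ 0" for j
    proof -
      have "E * min (4 ^ j / lam) 1 \<le> E * 1" using E0 by (intro mult_left_mono) auto
      then show ?thesis using C(2) by simp
    qed
    note * = resolvent_bound[OF E f lam assms(3) E0 less_imp_le[OF C(1)] this]
    show "resolvent lam f \<in> LinfC_ss \<chi>\<^sub>0 m \<epsilon> \<alpha> T" using * by blast
    show "LinfC_ss_norm \<chi>\<^sub>0 m \<epsilon> \<alpha> T (resolvent lam f) \<le> ennreal C * LinfC_ss_norm \<chi>\<^sub>0 m \<epsilon> (\<alpha> - 2) T f"
      using * by blast
  next
    fix \<alpha> lam :: real and f assume lam: "lam \<ge> 1" and f: "f \<in> LinfC_s \<chi>\<^sub>0 m \<epsilon> (\<alpha> - 2) T"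
    let ?l = "ell (m + 2) (real_of_int (J_idx lam))"
    have J: "real_of_int (J_idx lam) \<ge> 0"
    proof -
      have "exp 1 + lam \<ge> 1" using lam exp_ge_zero[of 1] by linarith
      then show ?thesis unfolding J_idx_def by (simp add: add_nonneg_nonneg)
    qed
    have l: "?l \<ge> 1" by (rule ell_ge1[OF J])
    have "E * min (4 ^ j / lam) 1 \<le> C / ?l * ell (m + 2) (real j) ^ 1" for j
    proof -
      have "E * (?l * min (4 ^ j / lam) 1) \<le> E * (64 * ell (m + 2) (real j))"
        by (intro mult_left_mono ell_J_idx lam E0)
      also have "\<dots> = (64 * E) * ell (m + 2) (real j)" by simp
      also have "\<dots> \<le> C * ell (m + 2) (real j)" using C(3) ell_ge1[of "real j" "m + 2"] by (intro mult_right_mono) auto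
      finally have "(E * min (4 ^ j / lam) 1) * ?l \<le> C * ell (m + 2) (real j)" by (simp only: mult_ac)
      then show ?thesis using l by (simp add: pos_le_divide_eq)
    qed
    note * = resolvent_bound[OF E f lam assms(3) E0 _ this]
    have "0 \<le> C / ?l" using C(1) l by simp
    note * = *[OF this]
    show "resolvent lam f \<in> LinfC_ss \<chi>\<^sub>0 m \<epsilon> \<alpha> T" using * by blast
    show "LinfC_ss_norm \<chi>\<^sub>0 m \<epsilon> \<alpha> T (resolvent lam f) \<le> ennreal (C / ?l) * LinfC_s_norm \<chi>\<^sub>0 m \<epsilon> (\<alpha> - 2) T f"
      using * by blast
  qed
qed

end
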